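(* Let $k,\ell$ be integers with $k\ge 4$ and $\ell\in\{2,\dots,k-1\}$. Then, as $n\to\infty$ through integers with $n\equiv \ell\pmod k$, $$m_{k-2}'(k,n) = \left(1- \left(1- \frac{1}{k} \right)^{2} +o(1)\right)\binom{n-k+2}{2}= \left(\frac{2k-1}{k^2} +o(1)\right)\binom{n-k+2}{2}.$$
   Context: A $k$-graph $H$ is a $k$-uniform hypergraph: a finite vertex set $V(H)$ with edge set $E(H)\subseteq\binom{V(H)}{k}$. A matching is a collection of pairwise disjoint edges; its size is its number of edges. For $1\le d\le k-1$, $\deg_H(S)$ is the number of edges containing a $d$-set $S\subseteq V(H)$, and $\delta_d(H)=\min\deg_H(S)$ over all $d$-subsets $S$ of $V(H)$. $m_d'(k,n)$ is the smallest integer $m$ such that every $n$-vertex $k$-graph $H$ with $\delta_d(H)\ge m$ contains a matching of size $\lfloor n/k\rfloor$. $o(1)$ denotes a function of $n$ tending to $0$ as $n\to\infty$ (with $k,\ell$ fixed). *)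

theory Defs
  imports Complex_Main "HOL-Number_Theory.Cong"
begin

definition kgraph :: "nat \<Rightarrow> 'a set \<Rightarrow> 'a set set \<Rightarrow> bool" where
  "kgraph k V E \<longleftrightarrow> finite V \<and> E \<subseteq> {e. e \<subseteq> V \<and> card e = k}"

definition degree :: "'a set set \<Rightarrow> 'a set \<Rightarrow> nat" where
  "degree E S = card {e \<in> E. S \<subseteq> e}"

(* Only meaningful if V has at least d elements; otherwise this is Min {}. *)
definition min_degree :: "nat \<Rightarrow> 'a set \<Rightarrow> 'a set set \<Rightarrow> nat" where
  "min_degree d V E = Min (degree E ` {S. S \<subseteq> V \<and> card S = d})"

definition matching :: "'a set set \<Rightarrow> 'a set set \<Rightarrow> bool" where
  "matching E M \<longleftrightarrow> M \<subseteq> E \<and> pairwise disjnt M"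

(* Every finite k-graph is isomorphic to one with vertices in nat.
   For 1 \<le> d < k \<le> n the least integer threshold is positive, as the edgeless
   k-graph has minimum d-degree 0 and no matching of size n div k \<ge> 1, and it exists,
   as no minimum d-degree exceeds (n - d) choose (k - d); so it is the least natural number. *)
definition matching_threshold :: "nat \<Rightarrow> nat \<Rightarrow> nat \<Rightarrow> nat" where
  "matching_threshold d k n =
     (LEAST m. \<forall>(V :: nat set) E. kgraph k V E \<and> card V = n \<and> min_degree d V E \<ge> m \<longrightarrow>
        (\<exists>M. matching E M \<and> card M = n div k))"

end

theory Submission imports Defs begin

text \<open>
The lower bound comes from the space barrier: all edges meet a set of \<open>n div k - 1\<close> vertices.

For the upper bound, an almost perfect matching comes first. Let \<open>M\<close> be a maximum matching that leaves
many vertices uncovered, choose disjoint \<open>(k - 2)\<close>-sets among these, and let \<open>F\<close> be the graph of the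
pairs that complete at least four of them to an edge. Whenever \<open>r \<le> 3\<close> edges of \<open>M\<close> span \<open>r + 1\<close>
disjoint \<open>F\<close>-edges, \<open>M\<close> can be enlarged. Hence between two edges of \<open>M\<close> there are at most \<open>2 k\<close> edges
of \<open>F\<close>, with equality only if two vertices of one edge \<open>e\<close> are joined to all of the other edge \<open>f\<close>; and a
given \<open>f\<close> admits only one such \<open>e\<close>, since \<open>e\<close>, \<open>e'\<close> and \<open>f\<close> would span four disjoint \<open>F\<close>-edges (this
uses \<open>k \<ge> 4\<close>). So the density of \<open>F\<close> is at most \<open>(2 k - 1) / k\<^sup>2\<close> up to lower order terms, and only
boundedly many vertices remain uncovered.

The remaining vertices are absorbed. Since \<open>n mod k \<ge> 2\<close>, it suffices to absorb sets \<open>U\<close> of \<open>k + 2\<close>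
vertices up to two leftover vertices, which need not belong to \<open>U\<close>. An absorber is found by a game: vertices
are drawn at random, and edges are added either to a matching \<open>M1\<close> that avoids \<open>U\<close> or to a matching \<open>M2\<close>
that may use \<open>U\<close>, until \<open>M2\<close> covers all of \<open>U\<close> and \<open>M1\<close> except two vertices. For \<open>k \<ge> 5\<close> any
positive density suffices. For \<open>k = 4\<close> the density exceeds \<open>1 / 3\<close>, so two of any three vertices, and two
of any three pairs, have many common neighbours. Each \<open>U\<close> has a positive proportion of all bounded vertex
tuples as absorbers, and a greedy choice produces a small matching that absorbs every \<open>U\<close>.
\<close>

section \<open>Matchings\<close>

text \<open>For \<open>k \<ge> 4\<close> the density \<open>(2 k - 1) / k^2\<close> is below 1/2,
  and this is the obstacle to absorption: if the edges are the \<open>k\<close>-sets that meet a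
  fixed half of the vertices in an even number of points, the density is about 1/2, yet two vertices
  from different halves have no common link. So a prescribed vertex cannot in general be exchanged
  for another prescribed one, and the absorbers must use the free choice of the two leftover
  vertices to escape such parity constraints. In the game, \<open>|P| - |N|\<close> changes only by
  multiples of \<open>k\<close>, from \<open>k + 2\<close> at the start to 2 at the end, so a
  strategy is a path of size pairs \<open>(|P|, |N|)\<close>. Edges are found by extending sets of
  \<open>k - 2\<close> vertices. From \<open>k = 5\<close> on such a set can contain three vertices
  of \<open>P\<close>, and an exchange of three for two becomes possible; for \<open>k = 4\<close>
  it has only two vertices, and common neighbours have to serve instead.\<close>

definition extensions :: "'a set \<Rightarrow> 'a set set \<Rightarrow> 'a set \<Rightarrow> ('a \<times> 'a) set" where
  "extensions V E S = {(x, y). x \<in> V \<and> y \<in> V \<and> S \<union> {x, y} \<in> E}"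

text \<open>The minimum \<open>(k - 2)\<close>-degree in normalised form. Extensions are ordered
  pairs, so every edge through a \<open>(k - 2)\<close>-set counts twice, and
  \<open>\<alpha> * n^2\<close> corresponds to \<open>\<alpha>\<close> times a binomial coefficient
  up to lower order terms.\<close>

definition dense_kgraph :: "nat \<Rightarrow> real \<Rightarrow> 'a set \<Rightarrow> 'a set set \<Rightarrow> bool" where
  "dense_kgraph k \<alpha> V E \<longleftrightarrow> kgraph k V E \<and>
     (\<forall>S. S \<subseteq> V \<and> card S = k - 2 \<longrightarrow> \<alpha> * (real (card V))\<^sup>2 \<le> real (card (extensions V E S)))"

text \<open>Greedy choice: fewer than \<open>t\<close> elements are in use when a set with at least
  \<open>t\<close> elements is served.\<close>

lemma distinct_representatives:
  assumes "finite J" "card J \<le> t" "\<And>j. j \<in> J \<Longrightarrow> finite (A j) \<and> t \<le> card (A j)"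
  shows "\<exists>f. inj_on f J \<and> (\<forall>j\<in>J. f j \<in> A j)"
  using assms
proof (induction J rule: finite_induct)
  case empty
  then show ?case by simp
next
  case (insert j J)
  then obtain f where f: "inj_on f J" "\<forall>j\<in>J. f j \<in> A j"
    by auto
  have "card (f ` J) < card (A j)"
    using insert.hyps insert.prems(1) insert.prems(2)[of j] card_image_le[of J f] by auto
  then obtain a where a: "a \<in> A j" "a \<notin> f ` J"
    using insert.hyps(1) by (metis card_mono finite_imageI leD subsetI)
  have "inj_on (f(j := a)) (insert j J)"
    using f(1) a(2) insert.hyps(2) by (auto simp: inj_on_def)
  moreover have "\<forall>i\<in>insert j J. (f(j := a)) i \<in> A i"
    using f(2) a(1) insert.hyps(2) by auto
  ultimately show ?case by blast
qed

lemma sum_if_const: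
  "finite A \<Longrightarrow> (\<Sum>x\<in>A. if P x then c else 0) = card {x \<in> A. P x} * (c :: nat)"
  by (simp add: sum.inter_filter[symmetric])

lemma matching_subset: "matching E M \<Longrightarrow> M' \<subseteq> M \<Longrightarrow> matching E M'"
  unfolding matching_def by (auto intro: pairwise_subset)

lemma matching_Un:
  assumes "matching E M" "matching E M'" "\<Union>M \<inter> \<Union>M' = {}"
  shows "matching E (M \<union> M')"
  unfolding matching_def pairwise_def
proof (intro conjI ballI impI)
  show "M \<union> M' \<subseteq> E" using assms unfolding matching_def by simp
  fix e f assume ef: "e \<in> M \<union> M'" "f \<in> M \<union> M'" "e \<noteq> f"
  have "disjnt a b" if "a \<in> M" "b \<in> M'" for a b
    using assms(3) that unfolding disjnt_def by fast
  moreover have "pairwise disjnt M" "pairwise disjnt M'"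
    using assms(1,2) unfolding matching_def by auto
  ultimately show "disjnt e f"
    using ef unfolding pairwise_def by (metis UnE disjnt_sym)
qed

lemma kgraph_finite_edges: "kgraph k V E \<Longrightarrow> finite E"
  unfolding kgraph_def by (auto intro: finite_subset[of E "Pow V"])

lemma matching_card_Union:
  assumes "kgraph k V E" "matching E M"
  shows "card (\<Union>M) = k * card M" "finite M" "\<Union>M \<subseteq> V"
proof -
  have fin: "finite E" "finite V" and E: "\<And>e. e \<in> E \<Longrightarrow> e \<subseteq> V \<and> card e = k"
    using assms(1) kgraph_finite_edges unfolding kgraph_def by auto
  show fM: "finite M" using assms(2) fin finite_subset unfolding matching_def by auto
  show "\<Union>M \<subseteq> V" using assms(2) E unfolding matching_def by blast
  have "card (\<Union>M) = sum card M"
    using assms(2) E fin unfolding matching_def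
    by (intro card_Union_disjoint) (auto intro: finite_subset)
  also have "\<dots> = sum (\<lambda>_. k) M"
    using assms(2) E unfolding matching_def by (intro sum.cong) auto
  finally show "card (\<Union>M) = k * card M" by simp
qed

section \<open>Bipartite graphs without two or three independent edges\<close>

lemma no_two_independent_star:
  assumes "\<And>p q. p \<in> G \<Longrightarrow> q \<in> G \<Longrightarrow> fst p = fst q \<or> snd p = snd q"
  shows "(\<exists>x. \<forall>p\<in>G. fst p = x) \<or> (\<exists>y. \<forall>p\<in>G. snd p = y)"
  using assms by metis

text \<open>Pairwise meeting edges form a star, since a bipartite graph has no triangle.\<close>

lemma no_two_independent_card:
  assumes "finite A" "finite B" "G \<subseteq> A \<times> B"
    and "\<And>p q. p \<in> G \<Longrightarrow> q \<in> G \<Longrightarrow> fst p = fst q \<or> snd p = snd q"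
  shows "card G \<le> card A + card B"
proof -
  from no_two_independent_star[OF assms(4)] consider
      x where "\<forall>p\<in>G. fst p = x" | y where "\<forall>p\<in>G. snd p = y"
    by blast
  then show ?thesis
  proof cases
    case 1
    then have "G \<subseteq> {x} \<times> B" using assms(3) by (auto simp: subset_iff)
    then have "card G \<le> card ({x} \<times> B)" using assms(2) by (intro card_mono) auto
    then show ?thesis by (simp add: card_cartesian_product)
  next
    case 2
    then have "G \<subseteq> A \<times> {y}" using assms(3) by (auto simp: subset_iff)
    then have "card G \<le> card (A \<times> {y})" using assms(1) by (intro card_mono) auto
    then show ?thesis by (simp add: card_cartesian_product)
  qed
qed

definition has_independent_triple :: "('a \<times> 'b) set \<Rightarrow> bool" where
  "has_independent_triple G \<longleftrightarrow> (\<exists>p\<in>G. \<exists>q\<in>G. \<exists>r\<in>G.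
     fst p \<noteq> fst q \<and> fst p \<noteq> fst r \<and> fst q \<noteq> fst r \<and>
     snd p \<noteq> snd q \<and> snd p \<noteq> snd r \<and> snd q \<noteq> snd r)"

text \<open>Two independent edges that avoid \<open>x\<close> would leave a third neighbour of
  \<open>x\<close> free, so the edges that avoid \<open>x\<close> form a star. If its centre lies in
  \<open>B\<close>, there are at most \<open>k + (k - 1)\<close> edges in all; if it lies in
  \<open>A\<close>, the \<open>2 * k\<close> edges must fill two rows completely.\<close>

lemma no_independent_triple_row:
  fixes G :: "('a \<times> 'b) set"
  assumes fin: "finite A" "finite B" and kA: "card A = k" and kB: "card B = k"
    and G: "G \<subseteq> A \<times> B" and k: "2 * k \<le> card G" "k > 0"
    and no3: "\<not> has_independent_triple G" and x: "3 \<le> card (G `` {x})"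
  shows "\<exists>y. x \<noteq> y \<and> x \<in> A \<and> y \<in> A \<and> G = {x, y} \<times> B"
proof -
  define G' where "G' = {p \<in> G. fst p \<noteq> x}"
  have finG: "finite G" using fin G by (auto intro: finite_subset)
  have star: "fst p = fst q \<or> snd p = snd q" if "p \<in> G'" "q \<in> G'" for p q
  proof (rule ccontr)
    assume ne: "\<not> ?thesis"
    have "card {snd p, snd q} \<le> 2" by (simp add: card_insert_if)
    then have "\<not> G `` {x} \<subseteq> {snd p, snd q}"
      using x card_mono[of "{snd p, snd q}" "G `` {x}"] by auto
    then obtain y where "(x, y) \<in> G" "y \<noteq> snd p" "y \<noteq> snd q" by blast
    then have "has_independent_triple G"
      unfolding has_independent_triple_def using ne that unfolding G'_def
      by (intro bexI[of _ "(x, y)"] bexI[of _ p] bexI[of _ q]) auto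
    then show False using no3 by simp
  qed
  have xA: "x \<in> A"
  proof (rule ccontr)
    assume "x \<notin> A"
    then have "G `` {x} = {}" using G by auto
    then show False using x by simp
  qed
  from no_two_independent_star[OF star] consider
      y where "\<forall>p\<in>G'. fst p = y" | z where "\<forall>p\<in>G'. snd p = z"
    by blast
  then show ?thesis
  proof cases
    case 1
    have ne: "G' \<noteq> {}"
    proof
      assume "G' = {}"
      then have "G \<subseteq> {x} \<times> B" using G unfolding G'_def by auto
      then have "card G \<le> card ({x} \<times> B)" using fin by (intro card_mono) auto
      then show False using k kB by (simp add: card_cartesian_product)
    qed
    then obtain p where p: "p \<in> G'" by blast
    have "fst p = y" using p 1 by blast
    moreover have "fst p \<noteq> x" "fst p \<in> A" using p G unfolding G'_def by auto
    ultimately have "y \<noteq> x" "y \<in> A" by auto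
    moreover have sub: "G \<subseteq> {x, y} \<times> B"
    proof
      fix r assume r: "r \<in> G"
      then have "fst r = x \<or> fst r = y" using 1 unfolding G'_def by blast
      then show "r \<in> {x, y} \<times> B" using r G by (cases r) auto
    qed
    moreover have "card ({x, y} \<times> B) \<le> card G"
      using \<open>y \<noteq> x\<close> kB k by (simp add: card_cartesian_product)
    ultimately have "G = {x, y} \<times> B"
      using fin by (metis card_seteq finite.emptyI finite.insertI finite_cartesian_product)
    then show ?thesis using \<open>y \<noteq> x\<close> \<open>y \<in> A\<close> xA by (intro exI[of _ y]) auto
  next
    case 2
    have "G \<subseteq> {x} \<times> B \<union> (A - {x}) \<times> {z}"
    proof
      fix r assume r: "r \<in> G"
      then have "fst r = x \<or> snd r = z" using 2 unfolding G'_def by blast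
      then show "r \<in> {x} \<times> B \<union> (A - {x}) \<times> {z}" using r G by (cases r) auto
    qed
    then have "card G \<le> card ({x} \<times> B \<union> (A - {x}) \<times> {z})" using fin by (intro card_mono) auto
    also have "\<dots> \<le> card ({x} \<times> B) + card ((A - {x}) \<times> {z})" by (rule card_Un_le)
    also have "\<dots> = k + (k - 1)"
      using xA kA kB fin by (simp add: card_cartesian_product)
    finally show ?thesis using k by simp
  qed
qed


text \<open>If some vertex has degree at least three, the previous lemma applies to \<open>G\<close>
  or to its converse. Otherwise an edge meets at most three edges, itself included; two edges block
  at most six of the \<open>2 * k \<ge> 8\<close>, and three independent edges can be chosen
  greedily.\<close>

lemma no_independent_triple_cover:
  fixes G :: "('a \<times> 'b) set"
  assumes fin: "finite A" "finite B" and kA: "card A = k" and kB: "card B = k"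
    and G: "G \<subseteq> A \<times> B" and k: "2 * k \<le> card G" "k \<ge> 4"
    and no3: "\<not> has_independent_triple G"
  shows "(\<exists>x y. x \<noteq> y \<and> x \<in> A \<and> y \<in> A \<and> G = {x, y} \<times> B) \<or>
         (\<exists>x y. x \<noteq> y \<and> x \<in> B \<and> y \<in> B \<and> G = A \<times> {x, y})"
proof -
  have finG: "finite G" using fin G by (auto intro: finite_subset)
  consider x where "3 \<le> card (G `` {x})" | y where "3 \<le> card (G\<inverse> `` {y})"
    | "\<And>x. card (G `` {x}) \<le> 2" "\<And>y. card (G\<inverse> `` {y}) \<le> 2"
  proof -
    have "m \<le> 2 \<or> 3 \<le> m" for m :: nat by linarith
    then show ?thesis using that by blast
  qed
  then show ?thesis
  proof cases
    case 1
    then show ?thesis using no_independent_triple_row[OF fin kA kB G k(1) _ no3 1] k(2) by auto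
  next
    case 2
    have "\<not> has_independent_triple (G\<inverse>)"
      using no3 unfolding has_independent_triple_def by fastforce
    then obtain z where "y \<noteq> z" "y \<in> B" "z \<in> B" "G\<inverse> = {y, z} \<times> A"
      using no_independent_triple_row[of B A k "G\<inverse>" y] fin kA kB G k 2
      by (auto simp: card_inverse)
    then have "G = A \<times> {y, z}" by auto
    then show ?thesis using \<open>y \<noteq> z\<close> \<open>y \<in> B\<close> \<open>z \<in> B\<close> by blast
  next
    case 3
    define R where "R p = {q \<in> G. fst q = fst p \<or> snd q = snd p}" for p
    have R: "card (R p) \<le> 3" if "p \<in> G" for p
    proof -
      have "R p \<subseteq> Pair (fst p) ` (G `` {fst p}) \<union> (\<lambda>x. (x, snd p)) ` (G\<inverse> `` {snd p} - {fst p})"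
      proof
        fix q assume q: "q \<in> R p"
        obtain a b where qq: "q = (a, b)" by (cases q)
        show "q \<in> Pair (fst p) ` (G `` {fst p}) \<union> (\<lambda>x. (x, snd p)) ` (G\<inverse> `` {snd p} - {fst p})"
          using q unfolding R_def qq by auto
      qed
      moreover have finr: "finite (G `` {fst p})" "finite (G\<inverse> `` {snd p})" using finG by auto
      ultimately have "card (R p) \<le> card (Pair (fst p) ` (G `` {fst p}) \<union> (\<lambda>x. (x, snd p)) ` (G\<inverse> `` {snd p} - {fst p}))"
        by (intro card_mono) auto
      also have "\<dots> \<le> card (Pair (fst p) ` (G `` {fst p})) + card ((\<lambda>x. (x, snd p)) ` (G\<inverse> `` {snd p} - {fst p}))"
        by (rule card_Un_le)
      also have "\<dots> \<le> card (G `` {fst p}) + card (G\<inverse> `` {snd p} - {fst p})"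
        using finr by (intro add_mono card_image_le) auto
      also have "\<dots> \<le> 2 + (2 - 1)"
      proof -
        have "fst p \<in> G\<inverse> `` {snd p}" using that by auto
        then have "card (G\<inverse> `` {snd p} - {fst p}) = card (G\<inverse> `` {snd p}) - 1"
          using finr by simp
        then show ?thesis using 3(1)[of "fst p"] 3(2)[of "snd p"] by linarith
      qed
      finally show ?thesis by simp
    qed
    have "G \<noteq> {}" using k by auto
    then obtain p where p: "p \<in> G" by blast
    have "card G > card (R p)" using R[OF p] k by linarith
    then have "\<not> G \<subseteq> R p" using card_mono[of "R p" G] finG unfolding R_def by auto
    then obtain q where q: "q \<in> G" "q \<notin> R p" by blast
    have "card G > card (R p \<union> R q)"
      using R[OF p] R[OF q(1)] k card_Un_le[of "R p" "R q"] by linarith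
    then have "\<not> G \<subseteq> R p \<union> R q" using card_mono[of "R p \<union> R q" G] finG unfolding R_def by auto
    then obtain r where r: "r \<in> G" "r \<notin> R p" "r \<notin> R q" by blast
    have "has_independent_triple G"
      unfolding has_independent_triple_def using p q r unfolding R_def
      by (intro bexI[of _ p] bexI[of _ q] bexI[of _ r]) auto
    then show ?thesis using no3 by simp
  qed
qed

section \<open>Augmentation of a matching\<close>

lemma matching_Union_Diff:
  assumes "matching E M" "M0 \<subseteq> M"
  shows "\<Union>M0 \<inter> \<Union>(M - M0) = {}"
proof (rule ccontr)
  assume "\<not> ?thesis"
  then obtain x e f where x: "x \<in> e" "x \<in> f" "e \<in> M0" "f \<in> M - M0" by auto
  then have "disjnt e f"
    using assms unfolding matching_def by (elim conjE pairwiseD) auto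
  then show False using x unfolding disjnt_def by auto
qed

text \<open>Each pair in \<open>Q\<close> completes at least \<open>t \<ge> card Q\<close> of the
  disjoint sets \<open>S i\<close> to edges, so different pairs can be given different sets. The
  resulting edges avoid what is kept of \<open>M\<close> and replace \<open>M0\<close>.\<close>

lemma augment_matching:
  assumes kg: "kgraph k V E" and M: "matching E M" and I: "finite I"
    and S: "\<And>i. i \<in> I \<Longrightarrow> S i \<subseteq> V - \<Union>M"
    and S_disj: "\<And>i j. i \<in> I \<Longrightarrow> j \<in> I \<Longrightarrow> i \<noteq> j \<Longrightarrow> S i \<inter> S j = {}"
    and Q: "finite Q" "card Q \<le> t"
    and Qt: "\<And>p. p \<in> Q \<Longrightarrow> t \<le> card {i \<in> I. S i \<union> {fst p, snd p} \<in> E}"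
    and QS: "\<And>p i. p \<in> Q \<Longrightarrow> i \<in> I \<Longrightarrow> {fst p, snd p} \<inter> S i = {}"
    and Q_disj: "\<And>p q. p \<in> Q \<Longrightarrow> q \<in> Q \<Longrightarrow> p \<noteq> q \<Longrightarrow> {fst p, snd p} \<inter> {fst q, snd q} = {}"
    and M0: "M0 \<subseteq> M" and QM: "\<And>p. p \<in> Q \<Longrightarrow> {fst p, snd p} \<inter> \<Union>(M - M0) = {}"
  shows "\<exists>M'. matching E M' \<and> card M' = card M - card M0 + card Q"
proof -
  have "\<exists>f. inj_on f Q \<and> (\<forall>p\<in>Q. f p \<in> {i \<in> I. S i \<union> {fst p, snd p} \<in> E})"
    using Q Qt I by (intro distinct_representatives[of Q t]) auto
  then obtain f where f: "inj_on f Q" "\<And>p. p \<in> Q \<Longrightarrow> f p \<in> I \<and> S (f p) \<union> {fst p, snd p} \<in> E"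
    by auto
  define g where "g p = S (f p) \<union> {fst p, snd p}" for p
  have g_disj: "g p \<inter> g q = {}" if "p \<in> Q" "q \<in> Q" "p \<noteq> q" for p q
  proof -
    have "f p \<noteq> f q" using f(1) that by (auto dest: inj_onD)
    then have "S (f p) \<inter> S (f q) = {}" using f(2)[OF that(1)] f(2)[OF that(2)] S_disj by simp
    moreover have "{fst p, snd p} \<inter> S (f q) = {}" using QS[OF that(1)] f(2)[OF that(2)] by simp
    moreover have "S (f p) \<inter> {fst q, snd q} = {}"
      using QS[OF that(2), of "f p"] f(2)[OF that(1)] by (simp add: Int_commute)
    ultimately show ?thesis
      using Q_disj[OF that] unfolding g_def Int_Un_distrib Int_Un_distrib2 by simp
  qed
  have g_ne: "g p \<noteq> {}" for p unfolding g_def by simp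
  have inj: "inj_on g Q"
    using g_disj g_ne by (metis inf.idem inj_onI)
  have M': "matching E (g ` Q)"
    unfolding matching_def pairwise_def disjnt_def
  proof (intro conjI ballI impI)
    show "g ` Q \<subseteq> E" using f(2) unfolding g_def by blast
    fix a b assume ab: "a \<in> g ` Q" "b \<in> g ` Q" "a \<noteq> b"
    then obtain p q where "p \<in> Q" "q \<in> Q" "a = g p" "b = g q" by blast
    then show "a \<inter> b = {}" using g_disj[of p q] ab by auto
  qed
  have disj: "\<Union>(M - M0) \<inter> \<Union>(g ` Q) = {}"
  proof -
    have "\<Union>(M - M0) \<inter> g p = {}" if "p \<in> Q" for p
    proof -
      have "S (f p) \<inter> \<Union>M = {}" using S[of "f p"] f(2)[OF that] by fast
      then have "S (f p) \<inter> \<Union>(M - M0) = {}" by fast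
      then show ?thesis using QM[OF that] unfolding g_def Int_Un_distrib Int_Un_distrib2
        by (simp add: Int_commute)
    qed
    then show ?thesis by fast
  qed
  have fM: "finite M" by (rule matching_card_Union(2)[OF kg M])
  have "matching E ((M - M0) \<union> g ` Q)"
    using matching_Un[OF matching_subset[OF M] M' disj] by auto
  moreover have "(M - M0) \<inter> g ` Q = {}"
  proof -
    have "a \<noteq> {}" if "a \<in> g ` Q" for a using that g_ne by auto
    then show ?thesis using disj by fast
  qed
  then have "card ((M - M0) \<union> g ` Q) = card (M - M0) + card (g ` Q)"
    using fM Q(1) by (intro card_Un_disjoint) auto
  then have "card ((M - M0) \<union> g ` Q) = card M - card M0 + card Q"
    using fM M0 inj by (simp add: card_Diff_subset card_image finite_subset)
  ultimately show ?thesis by blast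
qed

text \<open>By \<open>aug\<close>, \<open>r\<close> edges of \<open>M\<close> together with
  \<open>W\<close> span at most \<open>r\<close> disjoint edges of \<open>F\<close> for
  \<open>r \<le> 3\<close>. This is applied with \<open>r = 0\<close> inside \<open>W\<close>,
  \<open>r = 1\<close> between an edge and \<open>W\<close>, \<open>r = 2\<close> between two edges,
  and \<open>r = 3\<close> to bound \<open>D\<close>.\<close>

lemma no_augmentation_card:
  fixes M :: "'a set set" and F :: "('a \<times> 'a) set"
  assumes k: "k \<ge> 4" and fM: "finite M" and Mk: "\<And>e. e \<in> M \<Longrightarrow> card e = k"
    and disj: "pairwise disjnt M" and W: "finite W" "W \<inter> \<Union>M = {}"
    and F: "F \<subseteq> (\<Union>M \<union> W) \<times> (\<Union>M \<union> W)" and sym: "sym F" and irr: "\<And>x. (x, x) \<notin> F"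
    and aug: "\<And>Q M0. \<lbrakk>Q \<subseteq> F; finite Q; card Q \<le> 4;
        \<And>p q. p \<in> Q \<Longrightarrow> q \<in> Q \<Longrightarrow> p \<noteq> q \<Longrightarrow> {fst p, snd p} \<inter> {fst q, snd q} = {};
        M0 \<subseteq> M; \<And>p. p \<in> Q \<Longrightarrow> {fst p, snd p} \<subseteq> \<Union>M0 \<union> W\<rbrakk> \<Longrightarrow> card Q \<le> card M0"
  shows "card F \<le> (2 * k - 1) * (card M)\<^sup>2 + card M * k\<^sup>2 + 2 * card M + 2 * card M * (card W + k)"
proof -
  define m where "m = card M"
  have fe: "finite e" if "e \<in> M" for e using Mk[OF that] k card.infinite by fastforce
  have fUM: "finite (\<Union>M)" using fM fe by auto
  have finF: "finite F" using F fUM W(1) by (auto intro: finite_subset)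
  have ef: "e \<inter> f = {}" if "e \<in> M" "f \<in> M" "e \<noteq> f" for e f
    using disj that unfolding pairwise_def disjnt_def by auto
  \<comment> \<open>The ordered pairs of edges that may carry one \<open>F\<close>-edge more than
    \<open>2 * k - 1\<close>. They are determined by their second component, so they contribute only
    to the linear terms of the bound.\<close>
  define D where "D = {(e, f). e \<in> M \<and> f \<in> M \<and> e \<noteq> f \<and>
    (\<exists>x y. x \<noteq> y \<and> x \<in> e \<and> y \<in> e \<and> {x, y} \<times> f \<subseteq> F)}"
  have DM: "D \<subseteq> M \<times> M" unfolding D_def by auto
  then have finD: "finite D" using fM by (auto intro: finite_subset)
  have "inj_on snd D"
  proof (rule inj_onI, rule ccontr)
    fix p q assume pq: "p \<in> D" "q \<in> D" "snd p = snd q" "p \<noteq> q"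
    obtain e1 f e2 where eq: "p = (e1, f)" "q = (e2, f)" using pq(3) by (cases p; cases q) auto
    have "e1 \<noteq> e2" using pq eq by auto
    obtain x1 y1 where 1: "x1 \<noteq> y1" "x1 \<in> e1" "y1 \<in> e1" "{x1, y1} \<times> f \<subseteq> F"
      and M1: "e1 \<in> M" "f \<in> M" "e1 \<noteq> f"
      using pq(1) unfolding eq D_def by auto
    obtain x2 y2 where 2: "x2 \<noteq> y2" "x2 \<in> e2" "y2 \<in> e2" "{x2, y2} \<times> f \<subseteq> F"
      and M2: "e2 \<in> M" "e2 \<noteq> f"
      using pq(2) unfolding eq D_def by auto
    have "4 \<le> card f" using Mk M1(2) k by auto
    then obtain B where "B \<subseteq> f" "card B = 4" by (meson obtain_subset_with_card_n)
    then obtain xs where xs: "set xs = B" "distinct xs"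
      using finite_distinct_list[of B] fe[OF M1(2)] finite_subset by blast
    then have "length xs = 4" using \<open>card B = 4\<close> distinct_card by fastforce
    then obtain a b c d where "xs = [a, b, c, d]"
      by (auto simp: numeral_eq_Suc length_Suc_conv)
    then have B: "{a, b, c, d} \<subseteq> f" "distinct [a, b, c, d]" using xs \<open>B \<subseteq> f\<close> by auto
    have e12: "e1 \<inter> e2 = {}" "e1 \<inter> f = {}" "e2 \<inter> f = {}" using ef M1 M2 \<open>e1 \<noteq> e2\<close> by auto
    let ?Q = "{(x1, a), (y1, b), (x2, c), (y2, d)}"
    have c4: "card ?Q = 4" using B by auto
    have "card ?Q \<le> card {e1, e2, f}"
    proof (rule aug)
      show "?Q \<subseteq> F" using 1 2 B by auto
      show "card ?Q \<le> 4" using c4 by simp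
      show "{fst p, snd p} \<inter> {fst q, snd q} = {}" if "p \<in> ?Q" "q \<in> ?Q" "p \<noteq> q" for p q
      proof -
        have "x1 \<notin> f" "y1 \<notin> f" "x2 \<notin> f" "y2 \<notin> f" "x1 \<noteq> x2" "x1 \<noteq> y2" "y1 \<noteq> x2" "y1 \<noteq> y2"
          using e12 1(2,3) 2(2,3) by auto
        then have "distinct [x1, y1, x2, y2, a, b, c, d]" using B 1(1-3) 2(1-3) by auto
        then show ?thesis using that by auto
      qed
      show "{e1, e2, f} \<subseteq> M" using M1 M2 by auto
      show "{fst p, snd p} \<subseteq> \<Union>{e1, e2, f} \<union> W" if "p \<in> ?Q" for p
        using that 1(2,3) 2(2,3) B(1) by (elim insertE) simp_all
    qed auto
    moreover have "card {e1, e2, f} \<le> 3" by (simp add: card_insert_if)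
    ultimately show False using c4 by linarith
  qed
  then have "card D = card (snd ` D)" by (simp add: card_image)
  also have "\<dots> \<le> m" unfolding m_def using DM fM by (intro card_mono) auto
  finally have cD: "card D \<le> m" .
  have cross: "card (F \<inter> e \<times> f) \<le> 2 * k - 1 + (if (e, f) \<in> D then 1 else 0) + (if (f, e) \<in> D then 1 else 0)"
    if M': "e \<in> M" "f \<in> M" "e \<noteq> f" for e f
  proof (cases "2 * k \<le> card (F \<inter> e \<times> f)")
    case False
    then show ?thesis by simp
  next
    case True
    have "\<not> has_independent_triple (F \<inter> e \<times> f)"
    proof
      assume "has_independent_triple (F \<inter> e \<times> f)"
      then obtain p q r where pqr: "p \<in> F \<inter> e \<times> f" "q \<in> F \<inter> e \<times> f" "r \<in> F \<inter> e \<times> f"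
        and ne: "fst p \<noteq> fst q" "fst p \<noteq> fst r" "fst q \<noteq> fst r"
          "snd p \<noteq> snd q" "snd p \<noteq> snd r" "snd q \<noteq> snd r"
        unfolding has_independent_triple_def by blast
      have "p \<noteq> q" "p \<noteq> r" "q \<noteq> r" using ne by blast+
      then have c3: "card {p, q, r} = 3" by simp
      have mem: "fst z \<in> e \<and> snd z \<in> f" if "z \<in> {p, q, r}" for z
        using that pqr by (elim insertE) (simp_all add: mem_Times_iff)
      have "card {p, q, r} \<le> card {e, f}"
      proof (rule aug)
        show "card {p, q, r} \<le> 4" using c3 by simp
        show "{fst a, snd a} \<inter> {fst b, snd b} = {}"
          if "a \<in> {p, q, r}" "b \<in> {p, q, r}" "a \<noteq> b" for a b
        proof -
          have "fst a \<noteq> fst b" "snd a \<noteq> snd b" using that ne by auto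
          moreover have "fst a \<noteq> snd b" "fst b \<noteq> snd a"
            using mem[OF that(1)] mem[OF that(2)] ef[OF M'] by (metis disjoint_iff)+
          ultimately show ?thesis by auto
        qed
        show "{fst a, snd a} \<subseteq> \<Union>{e, f} \<union> W" if "a \<in> {p, q, r}" for a
          using mem[OF that] by auto
      qed (use pqr M' in auto)
      also have "\<dots> \<le> 2" by (simp add: card_insert_if)
      finally show False using c3 by simp
    qed
    then have "(\<exists>x y. x \<noteq> y \<and> x \<in> e \<and> y \<in> e \<and> F \<inter> e \<times> f = {x, y} \<times> f) \<or>
       (\<exists>x y. x \<noteq> y \<and> x \<in> f \<and> y \<in> f \<and> F \<inter> e \<times> f = e \<times> {x, y})"
      using True k M' fe Mk by (intro no_independent_triple_cover[where k = k]) auto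
    then show ?thesis
    proof (elim disjE exE conjE)
      fix x y assume xy: "x \<noteq> y" "x \<in> e" "y \<in> e" "F \<inter> e \<times> f = {x, y} \<times> f"
      then have "(e, f) \<in> D" unfolding D_def using M' by blast
      moreover have "card (F \<inter> e \<times> f) = 2 * k"
        using xy Mk M' by (simp add: card_cartesian_product)
      ultimately show ?thesis by simp
    next
      fix x y assume xy: "x \<noteq> y" "x \<in> f" "y \<in> f" "F \<inter> e \<times> f = e \<times> {x, y}"
      then have "e \<times> {x, y} \<subseteq> F" by blast
      then have "{x, y} \<times> e \<subseteq> F" using sym unfolding sym_def by blast
      then have "(f, e) \<in> D" unfolding D_def using M' xy by blast
      moreover have "card (F \<inter> e \<times> f) = 2 * k"
        using xy Mk M' by (simp add: card_cartesian_product)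
      ultimately show ?thesis by simp
    qed
  qed
  have same: "card (F \<inter> e \<times> e) \<le> k\<^sup>2" if "e \<in> M" for e
  proof -
    have "card (F \<inter> e \<times> e) \<le> card (e \<times> e)" using fe[OF that] by (intro card_mono) auto
    then show ?thesis using Mk[OF that] by (simp add: card_cartesian_product power2_eq_square)
  qed
  have star: "card (F \<inter> e \<times> W) \<le> k + card W" if e: "e \<in> M" for e
  proof -
    have "fst p = fst q \<or> snd p = snd q" if pq: "p \<in> F \<inter> e \<times> W" "q \<in> F \<inter> e \<times> W" for p q
    proof (rule ccontr)
      assume ne: "\<not> ?thesis"
      have "p \<noteq> q" using ne by blast
      then have c2: "card {p, q} = 2" by simp
      have mem: "fst z \<in> e \<and> snd z \<in> W" if "z \<in> {p, q}" for z
        using that pq by (elim insertE) (simp_all add: mem_Times_iff)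
      have eW: "e \<inter> W = {}" using W(2) e by blast
      have "card {p, q} \<le> card {e}"
      proof (rule aug)
        show "card {p, q} \<le> 4" using c2 by simp
        show "{fst a, snd a} \<inter> {fst b, snd b} = {}" if "a \<in> {p, q}" "b \<in> {p, q}" "a \<noteq> b" for a b
        proof -
          have "fst a \<noteq> fst b" "snd a \<noteq> snd b" using that ne by auto
          moreover have "fst a \<noteq> snd b" "fst b \<noteq> snd a"
            using mem[OF that(1)] mem[OF that(2)] eW by (metis disjoint_iff)+
          ultimately show ?thesis by auto
        qed
        show "{fst a, snd a} \<subseteq> \<Union>{e} \<union> W" if "a \<in> {p, q}" for a
          using mem[OF that] by auto
      qed (use pq e in auto)
      then show False using c2 by simp
    qed
    then have "card (F \<inter> e \<times> W) \<le> card e + card W"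
      using fe[OF e] W(1) by (intro no_two_independent_card) auto
    then show ?thesis using Mk[OF e] by simp
  qed
  have star': "card (F \<inter> W \<times> e) \<le> k + card W" if e: "e \<in> M" for e
  proof -
    have "F \<inter> W \<times> e = (F \<inter> e \<times> W)\<inverse>" using sym unfolding sym_def by blast
    then show ?thesis using star[OF e] by (simp add: card_inverse)
  qed
  have WW: "F \<inter> W \<times> W = {}"
  proof (rule ccontr)
    assume "F \<inter> W \<times> W \<noteq> {}"
    then obtain p where p: "p \<in> F \<inter> W \<times> W" by blast
    have "card {p} \<le> card ({} :: 'a set set)"
      by (rule aug) (use p in auto)
    then show False by simp
  qed
  have "F \<subseteq> (\<Union>(e, f)\<in>M \<times> M. F \<inter> e \<times> f) \<union> (\<Union>e\<in>M. F \<inter> e \<times> W) \<union> (\<Union>e\<in>M. F \<inter> W \<times> e)"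
  proof
    fix p assume p: "p \<in> F"
    then have "p \<in> (\<Union>M \<union> W) \<times> (\<Union>M \<union> W)" using F by (rule subsetD[rotated])
    then have "fst p \<in> \<Union>M \<union> W" "snd p \<in> \<Union>M \<union> W" by (simp_all only: mem_Times_iff)
    then consider e f where "e \<in> M" "f \<in> M" "p \<in> e \<times> f" | e where "e \<in> M" "p \<in> e \<times> W"
      | e where "e \<in> M" "p \<in> W \<times> e" | "p \<in> W \<times> W"
      by (auto simp: mem_Times_iff)
    then show "p \<in> (\<Union>(e, f)\<in>M \<times> M. F \<inter> e \<times> f) \<union> (\<Union>e\<in>M. F \<inter> e \<times> W) \<union> (\<Union>e\<in>M. F \<inter> W \<times> e)"
    proof cases
      case 4
      then show ?thesis using WW p by blast
    qed (use p in \<open>blast+\<close>)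
  qed
  then have "card F \<le> card ((\<Union>(e, f)\<in>M \<times> M. F \<inter> e \<times> f) \<union> (\<Union>e\<in>M. F \<inter> e \<times> W) \<union> (\<Union>e\<in>M. F \<inter> W \<times> e))"
    using fM finF by (intro card_mono) auto
  also have "\<dots> \<le> card (\<Union>(e, f)\<in>M \<times> M. F \<inter> e \<times> f) + card (\<Union>e\<in>M. F \<inter> e \<times> W)
      + card (\<Union>e\<in>M. F \<inter> W \<times> e)"
    by (intro order_trans[OF card_Un_le] add_mono card_Un_le order_refl)
  also have "\<dots> \<le> (\<Sum>p\<in>M \<times> M. card (F \<inter> fst p \<times> snd p)) + (\<Sum>e\<in>M. card (F \<inter> e \<times> W))
      + (\<Sum>e\<in>M. card (F \<inter> W \<times> e))"
    using fM by (intro add_mono order_trans[OF card_UN_le]) (auto simp: case_prod_beta)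
  also have "\<dots> \<le> ((2 * k - 1) * m\<^sup>2 + m * k\<^sup>2 + 2 * m) + m * (k + card W) + m * (k + card W)"
  proof (intro add_mono)
    have finMM: "finite (M \<times> M)" using fM by simp
    have le: "(\<Sum>p\<in>M \<times> M. card (F \<inter> fst p \<times> snd p)) \<le>
        (\<Sum>p\<in>M \<times> M. (2 * k - 1) + (if fst p = snd p then k\<^sup>2 else 0) + (if p \<in> D then 1 else 0)
           + (if prod.swap p \<in> D then 1 else 0))"
    proof (rule sum_mono)
      fix p assume p: "p \<in> M \<times> M"
      show "card (F \<inter> fst p \<times> snd p) \<le> (2 * k - 1) + (if fst p = snd p then k\<^sup>2 else 0)
           + (if p \<in> D then 1 else 0) + (if prod.swap p \<in> D then 1 else 0)"
      proof -
        obtain e f where ef': "p = (e, f)" "e \<in> M" "f \<in> M" using p by blast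
        show ?thesis
        proof (cases "e = f")
          case True
          then show ?thesis using same[OF ef'(2)] unfolding ef'(1) by simp
        next
          case False
          then show ?thesis using cross[OF ef'(2,3) False] unfolding ef'(1) by simp
        qed
      qed
    qed
    have "(2 * k - 1) * card (M \<times> M) + card {p \<in> M \<times> M. fst p = snd p} * k\<^sup>2
        + card {p \<in> M \<times> M. p \<in> D} + card {p \<in> M \<times> M. prod.swap p \<in> D}
        \<le> (2 * k - 1) * m\<^sup>2 + m * k\<^sup>2 + (m + m)"
    proof -
      have "{p \<in> M \<times> M. fst p = snd p} = (\<lambda>e. (e, e)) ` M" by force
      then have "card {p \<in> M \<times> M. fst p = snd p} = m"
        unfolding m_def by (simp add: card_image inj_on_def)
      moreover have "{p \<in> M \<times> M. p \<in> D} = D" using DM by auto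
      moreover have "{p \<in> M \<times> M. prod.swap p \<in> D} = prod.swap ` D"
      proof (intro equalityI subsetI)
        fix p assume "p \<in> {p \<in> M \<times> M. prod.swap p \<in> D}"
        then show "p \<in> prod.swap ` D" by (intro image_eqI[of _ _ "prod.swap p"]) simp_all
      next
        fix p assume "p \<in> prod.swap ` D"
        then show "p \<in> {p \<in> M \<times> M. prod.swap p \<in> D}" using DM by auto
      qed
      then have "card {p \<in> M \<times> M. prod.swap p \<in> D} = card D"
        by (simp add: card_image)
      ultimately show ?thesis using cD
        by (simp add: card_cartesian_product m_def power2_eq_square)
    qed
    with le show "(\<Sum>p\<in>M \<times> M. card (F \<inter> fst p \<times> snd p)) \<le> (2 * k - 1) * m\<^sup>2 + m * k\<^sup>2 + 2 * m"
      unfolding sum.distrib sum_if_const[OF finMM] by (simp add: mult.commute)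
    show "(\<Sum>e\<in>M. card (F \<inter> e \<times> W)) \<le> m * (k + card W)"
      using sum_bounded_above[of M "\<lambda>e. card (F \<inter> e \<times> W)" "k + card W"] star unfolding m_def by simp
    show "(\<Sum>e\<in>M. card (F \<inter> W \<times> e)) \<le> m * (k + card W)"
      using sum_bounded_above[of M "\<lambda>e. card (F \<inter> W \<times> e)" "k + card W"] star' unfolding m_def by simp
  qed
  also have "\<dots> = (2 * k - 1) * m\<^sup>2 + m * k\<^sup>2 + 2 * m + 2 * m * (card W + k)"
    by (simp add: algebra_simps)
  finally show ?thesis unfolding m_def .
qed

section \<open>Almost perfect matchings\<close>

lemma maximum_matching_exists:
  assumes "kgraph k V E"
  obtains M where "matching E M" "\<And>M'. matching E M' \<Longrightarrow> card M' \<le> card M"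
proof -
  have "card M' \<le> card E" if "matching E M'" for M'
    using that kgraph_finite_edges[OF assms] unfolding matching_def by (auto intro: card_mono)
  moreover have "matching E {}" unfolding matching_def by simp
  ultimately have "\<exists>M. matching E M \<and> (\<forall>M'. matching E M' \<longrightarrow> card M' \<le> card M)"
    by (intro ex_has_greatest_nat[where b = "Suc (card E)"]) (auto simp: le_imp_less_Suc)
  then show thesis using that by blast
qed

lemma disjoint_subsets_of_card:
  assumes "N * r \<le> card U" "finite U"
  shows "\<exists>S. (\<forall>i<N. S i \<subseteq> U \<and> card (S i) = r) \<and> (\<forall>i<N. \<forall>j<N. i \<noteq> j \<longrightarrow> S i \<inter> S j = {})"
  using assms
proof (induction N arbitrary: U)
  case 0
  then show ?case by simp
next
  case (Suc N)
  obtain T where T: "T \<subseteq> U" "card T = r"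
    using Suc.prems obtain_subset_with_card_n[of r U] by auto
  have "N * r \<le> card (U - T)" "finite (U - T)"
    using T Suc.prems by (auto simp: card_Diff_subset finite_subset)
  then obtain S where S: "\<forall>i<N. S i \<subseteq> U - T \<and> card (S i) = r"
      "\<forall>i<N. \<forall>j<N. i \<noteq> j \<longrightarrow> S i \<inter> S j = {}"
    using Suc.IH by blast
  define S' where "S' = S(N := T)"
  have "\<forall>i<Suc N. S' i \<subseteq> U \<and> card (S' i) = r"
    using S(1) T unfolding S'_def by (auto simp: less_Suc_eq)
  moreover have "S' i \<inter> S' j = {}" if ij: "i < Suc N" "j < Suc N" "i \<noteq> j" for i j
  proof -
    consider "i < N" "j < N" | "i = N" "j < N" | "i < N" "j = N"
      using ij by (auto simp: less_Suc_eq)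
    then show ?thesis
    proof cases
      case 1
      then show ?thesis using S(2) ij unfolding S'_def by simp
    next
      case 2
      then show ?thesis using S(1) unfolding S'_def by (simp, blast)
    next
      case 3
      then show ?thesis using S(1) unfolding S'_def by (simp, blast)
    qed
  qed
  ultimately show ?case by blast
qed

lemma card_times_subset_le:
  assumes "finite V" "A \<subseteq> V"
  shows "card {p \<in> V \<times> V. fst p \<in> A \<or> snd p \<in> A} \<le> 2 * card A * card V"
proof -
  have "{p \<in> V \<times> V. fst p \<in> A \<or> snd p \<in> A} \<subseteq> A \<times> V \<union> V \<times> A" by auto
  then have "card {p \<in> V \<times> V. fst p \<in> A \<or> snd p \<in> A} \<le> card (A \<times> V \<union> V \<times> A)"
    using assms by (intro card_mono) (auto intro: finite_subset)
  also have "\<dots> \<le> card (A \<times> V) + card (V \<times> A)" by (rule card_Un_le)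
  finally show ?thesis by (simp add: card_cartesian_product mult.commute[of "card V"])
qed

text \<open>Double counting of the extensions of \<open>N\<close> disjoint uncovered
  \<open>(k - 2)\<close>-sets. A pair outside \<open>F\<close> extends at most three of them, unless
  it meets their union \<open>T\<close>. Since \<open>F\<close> has at most the critical density,
  the surplus \<open>N * \<gamma> * n^2\<close> has to be paid by \<open>3 * n^2\<close> and terms
  linear in \<open>n\<close>.\<close>

lemma almost_cover_aux:
  fixes N :: nat and \<gamma> :: real
  assumes k: "k \<ge> 4" and d: "dense_kgraph k (((2 * real k - 1) / (real k)\<^sup>2) + \<gamma>) V E"
    and M: "matching E M" and max: "\<And>M'. matching E M' \<Longrightarrow> card M' \<le> card M"
    and NU: "N * (k - 2) \<le> card (V - \<Union>M)"
  shows "real N * \<gamma> * (real (card V))\<^sup>2 \<le> 3 * (real (card V))\<^sup>2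
     + real N * (2 * real N * real k + 2 + (real k)\<^sup>2 + 2 * real k) * real (card V)"
proof -
  define n where "n = card V"
  define c where "c = (2 * real k - 1) / (real k)\<^sup>2"
  have kg: "kgraph k V E" using d unfolding dense_kgraph_def by simp
  have fV: "finite V" and Ek: "\<And>e. e \<in> E \<Longrightarrow> e \<subseteq> V \<and> card e = k"
    using kg unfolding kgraph_def by auto
  note MU = matching_card_Union[OF kg M]
  define U where "U = V - \<Union>M"
  have fU: "finite U" using fV unfolding U_def by simp
  obtain S where S: "\<And>i. i < N \<Longrightarrow> S i \<subseteq> U \<and> card (S i) = k - 2"
      "\<And>i j. i < N \<Longrightarrow> j < N \<Longrightarrow> i \<noteq> j \<Longrightarrow> S i \<inter> S j = {}"
  proof -
    have "\<exists>S. (\<forall>i<N. S i \<subseteq> U \<and> card (S i) = k - 2) \<and> (\<forall>i<N. \<forall>j<N. i \<noteq> j \<longrightarrow> S i \<inter> S j = {})"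
      using disjoint_subsets_of_card[of N "k - 2" U] NU fU unfolding U_def by simp
    then obtain S where "\<forall>i<N. S i \<subseteq> U \<and> card (S i) = k - 2"
        "\<forall>i<N. \<forall>j<N. i \<noteq> j \<longrightarrow> S i \<inter> S j = {}"
      by (elim exE conjE)
    then show ?thesis by (intro that[of S]) simp_all
  qed
  define T where "T = (\<Union>i<N. S i)"
  define W where "W = U - T"
  define cnt where "cnt p = card {i \<in> {..<N}. S i \<union> {fst p, snd p} \<in> E}" for p
  \<comment> \<open>Four candidates per pair, because up to four pairs are completed
    simultaneously.\<close>
  define F where "F = {p \<in> (V - T) \<times> (V - T). 4 \<le> cnt p}"
  have TU: "T \<subseteq> U" using S(1) unfolding T_def by auto
  have cT: "card T \<le> N * (k - 2)"
    unfolding T_def using S(1) card_UN_le[of "{..<N}" S] by simp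
  have VT: "V - T = \<Union>M \<union> W" using MU(3) TU unfolding W_def U_def by auto
  have irr: "(x, x) \<notin> F" for x
  proof
    assume "(x, x) \<in> F"
    then have "0 < cnt (x, x)" unfolding F_def by auto
    then obtain i where i: "i < N" "S i \<union> {x} \<in> E" unfolding cnt_def by (auto simp: card_gt_0_iff)
    then have "card (S i \<union> {x}) = k" using Ek by blast
    moreover have "card (S i \<union> {x}) \<le> Suc (k - 2)" using S(1)[OF i(1)] by (simp add: card_insert_le_m1)
    ultimately show False using k by linarith
  qed
  have F_sub: "F \<subseteq> (\<Union>M \<union> W) \<times> (\<Union>M \<union> W)" unfolding F_def VT by auto
  have symF: "sym F"
    unfolding sym_def F_def cnt_def by (auto simp: insert_commute)
  have bound: "card F \<le> (2 * k - 1) * (card M)\<^sup>2 + card M * k\<^sup>2 + 2 * card M + 2 * card M * (card W + k)"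
  proof (rule no_augmentation_card[OF k MU(2) _ _ _ _ F_sub symF irr])
    show "card e = k" if "e \<in> M" for e using that M Ek unfolding matching_def by auto
    show "pairwise disjnt M" using M unfolding matching_def by simp
    show "finite W" using fU unfolding W_def by simp
    show "W \<inter> \<Union>M = {}" unfolding W_def U_def by auto
    fix Q M0
    assume Q: "Q \<subseteq> F" "finite Q" "card Q \<le> 4"
        "\<And>p q. p \<in> Q \<Longrightarrow> q \<in> Q \<Longrightarrow> p \<noteq> q \<Longrightarrow> {fst p, snd p} \<inter> {fst q, snd q} = {}"
      and M0: "M0 \<subseteq> M" and QM: "\<And>p. p \<in> Q \<Longrightarrow> {fst p, snd p} \<subseteq> \<Union>M0 \<union> W"
    have "\<exists>M'. matching E M' \<and> card M' = card M - card M0 + card Q"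
    proof (rule augment_matching[OF kg M, where I = "{..<N}" and S = S and t = 4])
      show "S i \<subseteq> V - \<Union>M" if "i \<in> {..<N}" for i using S(1) that unfolding U_def by auto
      show "S i \<inter> S j = {}" if "i \<in> {..<N}" "j \<in> {..<N}" "i \<noteq> j" for i j using S(2) that by auto
      show "4 \<le> card {i \<in> {..<N}. S i \<union> {fst p, snd p} \<in> E}" if "p \<in> Q" for p
        using Q(1) that unfolding F_def cnt_def by blast
      show "{fst p, snd p} \<inter> S i = {}" if "p \<in> Q" "i \<in> {..<N}" for p i
      proof -
        have "p \<in> (V - T) \<times> (V - T)" using Q(1) that(1) unfolding F_def by blast
        then have "fst p \<notin> T" "snd p \<notin> T" by auto
        then show ?thesis using that(2) unfolding T_def by auto
      qed
      show "{fst p, snd p} \<inter> \<Union>(M - M0) = {}" if "p \<in> Q" for p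
      proof -
        have "\<Union>M0 \<inter> \<Union>(M - M0) = {}"
          using M M0 by (rule matching_Union_Diff)
        moreover have "W \<inter> \<Union>(M - M0) = {}" unfolding W_def U_def by auto
        ultimately show ?thesis using QM[OF that] by fast
      qed
    qed (use Q M0 in auto)
    then have "card M - card M0 + card Q \<le> card M" using max by metis
    moreover have "card M0 \<le> card M" using M0 MU(2) by (rule card_mono[rotated])
    ultimately show "card Q \<le> card M0" by linarith
  qed
  have lower: "real N * ((c + \<gamma>) * (real n)\<^sup>2) \<le> real N * real (card F) + 3 * (real n)\<^sup>2 + real N * (2 * real N * real k * real n)"
  proof -
    have "(\<Sum>i<N. card (extensions V E (S i))) = (\<Sum>i<N. card {p \<in> V \<times> V. S i \<union> {fst p, snd p} \<in> E})"
      by (intro sum.cong arg_cong[where f = card]) (auto simp: extensions_def)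
    also have "\<dots> = (\<Sum>i<N. \<Sum>p\<in>V \<times> V. if S i \<union> {fst p, snd p} \<in> E then 1 else 0)"
      using fV by (simp only: sum_if_const finite_cartesian_product mult_1_right simp_thms)
    also have "\<dots> = (\<Sum>p\<in>V \<times> V. cnt p)"
      by (subst sum.swap) (simp only: cnt_def[abs_def] sum_if_const finite_lessThan mult_1_right simp_thms)
    also have "\<dots> \<le> (\<Sum>p\<in>V \<times> V. 3 + (if p \<in> F then N else 0)
         + (if fst p \<in> T \<or> snd p \<in> T then N else 0))"
    proof (rule sum_mono)
      fix p assume p: "p \<in> V \<times> V"
      have "cnt p \<le> N"
        unfolding cnt_def using card_mono[of "{..<N}" "{i \<in> {..<N}. S i \<union> {fst p, snd p} \<in> E}"] by auto
      moreover have "p \<in> F" if "\<not> (fst p \<in> T \<or> snd p \<in> T)" "\<not> cnt p \<le> 3"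
        using that p unfolding F_def by (auto simp: mem_Times_iff)
      ultimately show "cnt p \<le> 3 + (if p \<in> F then N else 0) + (if fst p \<in> T \<or> snd p \<in> T then N else 0)"
        by (cases "cnt p \<le> 3") auto
    qed
    also have "\<dots> = 3 * card (V \<times> V) + N * card {p \<in> V \<times> V. p \<in> F}
         + N * card {p \<in> V \<times> V. fst p \<in> T \<or> snd p \<in> T}"
      using fV by (simp only: sum.distrib sum_if_const finite_cartesian_product sum_constant simp_thms)
        (simp add: mult.commute)
    also have "\<dots> \<le> 3 * n\<^sup>2 + N * card F + N * (2 * (N * k) * n)"
    proof (intro add_mono mult_left_mono)
      have "card {p \<in> V \<times> V. fst p \<in> T \<or> snd p \<in> T} \<le> 2 * card T * card V"
        using fV TU unfolding U_def by (intro card_times_subset_le) auto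
      also have "\<dots> \<le> 2 * (N * k) * n"
        unfolding n_def using cT mult_le_mono2[of "k - 2" k N] by (intro mult_le_mono) linarith+
      finally show "card {p \<in> V \<times> V. fst p \<in> T \<or> snd p \<in> T} \<le> 2 * (N * k) * n" .
      have "{p \<in> V \<times> V. p \<in> F} = F" unfolding F_def by auto
      then show "card {p \<in> V \<times> V. p \<in> F} \<le> card F" by simp
    qed (simp_all add: card_cartesian_product n_def power2_eq_square)
    finally have *: "(\<Sum>i<N. card (extensions V E (S i))) \<le> 3 * n\<^sup>2 + N * card F + N * (2 * (N * k) * n)" .
    have "real N * ((c + \<gamma>) * (real n)\<^sup>2) = (\<Sum>i<N. (c + \<gamma>) * (real n)\<^sup>2)" by simp
    also have "\<dots> \<le> (\<Sum>i<N. real (card (extensions V E (S i))))"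
    proof (rule sum_mono)
      fix i assume "i \<in> {..<N}"
      then have "S i \<subseteq> V" "card (S i) = k - 2" using S(1)[of i] unfolding U_def by auto
      then show "(c + \<gamma>) * (real n)\<^sup>2 \<le> real (card (extensions V E (S i)))"
        using d unfolding dense_kgraph_def c_def n_def by simp
    qed
    also have "\<dots> = real (\<Sum>i<N. card (extensions V E (S i)))" by simp
    also have "\<dots> \<le> real (3 * n\<^sup>2 + N * card F + N * (2 * (N * k) * n))"
      using * by (rule of_nat_mono)
    finally show ?thesis by (simp add: algebra_simps)
  qed
  define m w where "m = real (card M)" and "w = real (card W)"
  have n_ge: "real k * m + w \<le> real n"
  proof -
    have "card (\<Union>M) + card W = card (\<Union>M \<union> W)"
      using MU fV fU unfolding W_def U_def by (intro card_Un_disjoint[symmetric]) (auto intro: finite_subset)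
    also have "\<dots> \<le> card V" using fV MU(3) unfolding W_def U_def by (intro card_mono) auto
    finally have "real (k * card M + card W) \<le> real (card V)" using MU(1) by linarith
    then show ?thesis unfolding m_def w_def n_def by simp
  qed
  have mw: "0 \<le> m" "0 \<le> w" unfolding m_def w_def by auto
  have mn: "m \<le> real n"
    using n_ge mw k mult_right_mono[of 1 "real k" m] by auto
  have "real (card F) \<le> real ((2 * k - 1) * (card M)\<^sup>2 + card M * k\<^sup>2 + 2 * card M + 2 * card M * (card W + k))"
    using bound by (rule of_nat_mono)
  also have "\<dots> = (2 * real k - 1) * m\<^sup>2 + m * (real k)\<^sup>2 + 2 * m + 2 * m * (w + real k)"
    using k unfolding m_def w_def by (simp add: of_nat_diff)
  also have "\<dots> = ((2 * real k - 1) * m\<^sup>2 + 2 * m * w) + m * ((real k)\<^sup>2 + 2 + 2 * real k)"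
    by (simp add: algebra_simps)
  also have "\<dots> \<le> c * (real n)\<^sup>2 + real n * ((real k)\<^sup>2 + 2 + 2 * real k)"
  proof (intro add_mono mult_right_mono mn)
    have kk: "real k \<ge> 4" using k by simp
    \<comment> \<open>As \<open>(2 * k - 1) / k \<ge> 1\<close>, the mixed term can be enlarged,
      which completes the square \<open>c * (k * m + w)^2\<close>.\<close>
    have "(2 * real k - 1) * m\<^sup>2 + 2 * m * w \<le> (2 * real k - 1) * m\<^sup>2 + (2 * (2 * real k - 1) / real k) * (m * w) + c * w\<^sup>2"
    proof -
      have "2 * (m * w) \<le> (2 * (2 * real k - 1) / real k) * (m * w)"
        using kk mw by (intro mult_right_mono) (auto simp: field_simps)
      moreover have "0 \<le> c * w\<^sup>2" unfolding c_def using kk by auto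
      ultimately show ?thesis by (simp add: mult.assoc)
    qed
    also have "\<dots> = c * (real k * m + w)\<^sup>2"
      unfolding c_def using kk by (simp add: field_simps power2_eq_square)
    also have "\<dots> \<le> c * (real n)\<^sup>2"
      unfolding c_def using kk n_ge mw by (intro mult_left_mono power_mono) auto
    finally show "(2 * real k - 1) * m\<^sup>2 + 2 * m * w \<le> c * (real n)\<^sup>2" .
  qed auto
  finally have "real N * real (card F) \<le> real N * (c * (real n)\<^sup>2 + real n * ((real k)\<^sup>2 + 2 + 2 * real k))"
    by (intro mult_left_mono) auto
  then show ?thesis using lower unfolding n_def[symmetric] by (simp add: algebra_simps)
qed

lemma almost_cover:
  fixes \<gamma> :: real
  assumes k: "k \<ge> 4" and g: "\<gamma> > 0"
  shows "\<exists>C n0. \<forall>(V :: 'a set) E. n0 \<le> card V \<longrightarrow> dense_kgraph k (((2 * real k - 1) / (real k)\<^sup>2) + \<gamma>) V E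
    \<longrightarrow> (\<exists>M. matching E M \<and> card (V - \<Union>M) \<le> C)"
proof -
  \<comment> \<open>Now \<open>N * \<gamma> > 4\<close>, and \<open>almost_cover_aux\<close> would
    give \<open>4 * n^2 < 3 * n^2 + K * n\<close>, which fails for \<open>n > K\<close>.\<close>
  obtain N :: nat where N: "4 / \<gamma> < real N" using reals_Archimedean2 by blast
  then have Ng: "4 < real N * \<gamma>" using g by (simp add: field_simps)
  define K where "K = real N * (2 * real N * real k + 2 + (real k)\<^sup>2 + 2 * real k)"
  obtain n0 :: nat where n0: "K < real n0" using reals_Archimedean2 by blast
  have "\<exists>M. matching E M \<and> card (V - \<Union>M) \<le> N * (k - 2)"
    if n: "n0 \<le> card V" and d: "dense_kgraph k (((2 * real k - 1) / (real k)\<^sup>2) + \<gamma>) V E"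
    for V :: "'a set" and E
  proof -
    have kg: "kgraph k V E" using d unfolding dense_kgraph_def by simp
    obtain M where M: "matching E M" "\<And>M'. matching E M' \<Longrightarrow> card M' \<le> card M"
      using maximum_matching_exists[OF kg] by blast
    have "card (V - \<Union>M) \<le> N * (k - 2)"
    proof (rule ccontr)
      assume "\<not> ?thesis"
      then have "N * (k - 2) \<le> card (V - \<Union>M)" by simp
      then have "real N * \<gamma> * (real (card V))\<^sup>2 \<le> 3 * (real (card V))\<^sup>2 + K * real (card V)"
        unfolding K_def using almost_cover_aux[OF k d M] by blast
      moreover have K0: "K \<ge> 0" unfolding K_def by simp
      then have V0: "real (card V) > 0" using n n0 by linarith
      moreover have "4 * (real (card V))\<^sup>2 < real N * \<gamma> * (real (card V))\<^sup>2"
        using Ng V0 by (intro mult_strict_right_mono) auto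
      moreover have "K * real (card V) < (real (card V))\<^sup>2"
        using n n0 V0 by (simp add: power2_eq_square)
      ultimately show False by linarith
    qed
    then show ?thesis using M(1) by blast
  qed
  then show ?thesis by blast
qed

section \<open>The absorption game\<close>

text \<open>With \<open>\<rho> > 0\<close>: for a positive proportion of the \<open>x1\<close>, for a positive proportion of the \<open>x2\<close>, ...,
  the set \<open>s \<union> {x1, \<dots>, xt}\<close> satisfies \<open>\<Phi>\<close>.\<close>

primrec robust :: "real \<Rightarrow> 'a set \<Rightarrow> ('a set \<Rightarrow> bool) \<Rightarrow> nat \<Rightarrow> 'a set \<Rightarrow> bool" where
  "robust \<rho> V \<Phi> 0 s = \<Phi> s"
| "robust \<rho> V \<Phi> (Suc t) s \<longleftrightarrow> \<rho> * real (card V) \<le> real (card {x \<in> V. robust \<rho> V \<Phi> t (insert x s)})"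

lemma robust_mono:
  assumes "finite V" "\<And>s s'. \<Phi> s \<Longrightarrow> s \<subseteq> s' \<Longrightarrow> \<Phi> s'" "robust \<rho> V \<Phi> t s" "s \<subseteq> s'"
  shows "robust \<rho> V \<Phi> t s'"
  using assms(3,4)
proof (induction t arbitrary: s s')
  case 0
  then show ?case using assms(2) by auto
next
  case (Suc t)
  have "card {x \<in> V. robust \<rho> V \<Phi> t (insert x s)} \<le> card {x \<in> V. robust \<rho> V \<Phi> t (insert x s')}"
    using assms(1) Suc.prems(2) by (intro card_mono) (auto intro: Suc.IH[OF _ insert_mono])
  then show ?case using Suc.prems(1) by simp
qed

text \<open>Draws after the end of a strategy do no harm, so strategies of different lengths can be
  compared with one common number of draws.\<close>

lemma robust_le:
  assumes V: "finite V" and mono: "\<And>s s'. \<Phi> s \<Longrightarrow> s \<subseteq> s' \<Longrightarrow> \<Phi> s'"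
    and \<rho>: "\<rho> \<le> 1" and r: "robust \<rho> V \<Phi> t s" and "t \<le> t'"
  shows "robust \<rho> V \<Phi> t' s"
  using \<open>t \<le> t'\<close>
proof (induction t' rule: dec_induct)
  case (step m)
  have "{x \<in> V. robust \<rho> V \<Phi> m (insert x s)} = V"
  proof -
    have "robust \<rho> V \<Phi> m (insert x s)" for x
      by (rule robust_mono[OF V mono step.IH]) auto
    then show ?thesis by auto
  qed
  then show ?case using mult_right_mono[OF \<rho>, of "real (card V)"] by simp
qed (rule r)

text \<open>The draws form a tree of depth \<open>t\<close> in which every node has at least
  \<open>\<rho> * card V\<close> children, and different leaves are different tuples.\<close>

lemma robust_count:
  assumes V: "finite V" and \<rho>: "0 \<le> \<rho>" and r: "robust \<rho> V \<Phi> t s"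
  shows "(\<rho> * real (card V)) ^ t \<le> real (card {xs. set xs \<subseteq> V \<and> length xs = t \<and> \<Phi> (set xs \<union> s)})"
  using r
proof (induction t arbitrary: s)
  case 0
  then have "{xs. set xs \<subseteq> V \<and> length xs = 0 \<and> \<Phi> (set xs \<union> s)} = {[]}" by auto
  then show ?case by simp
next
  case (Suc t)
  define X where "X = {x \<in> V. robust \<rho> V \<Phi> t (insert x s)}"
  define L where "L s t = {xs. set xs \<subseteq> V \<and> length xs = t \<and> \<Phi> (set xs \<union> s)}" for s t
  have fL: "finite (L s t)" for s t
    unfolding L_def by (rule finite_subset[OF _ finite_lists_length_eq[OF V, of t]]) auto
  have fX: "finite X" using V unfolding X_def by simp
  have cc: "card ((#) x ` A) = card A" for x :: 'a and A
    by (rule card_image) simp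
  have sub: "(\<Union>x\<in>X. (#) x ` L (insert x s) t) \<subseteq> L s (Suc t)"
    unfolding X_def L_def by auto
  have "(\<rho> * real (card V)) ^ Suc t \<le> real (card X) * (\<rho> * real (card V)) ^ t"
    using Suc.prems \<rho> unfolding X_def by (auto intro: mult_right_mono)
  also have "\<dots> = (\<Sum>x\<in>X. (\<rho> * real (card V)) ^ t)" by simp
  also have "\<dots> \<le> (\<Sum>x\<in>X. real (card (L (insert x s) t)))"
  proof (rule sum_mono)
    fix x assume "x \<in> X"
    then have "robust \<rho> V \<Phi> t (insert x s)" unfolding X_def by simp
    then show "(\<rho> * real (card V)) ^ t \<le> real (card (L (insert x s) t))"
      unfolding L_def by (rule Suc.IH)
  qed
  also have "\<dots> = real (\<Sum>x\<in>X. card ((#) x ` L (insert x s) t))"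
    unfolding cc by simp
  also have "(\<Sum>x\<in>X. card ((#) x ` L (insert x s) t)) = card (\<Union>x\<in>X. (#) x ` L (insert x s) t)"
    by (rule card_UN_disjoint[symmetric, OF fX]) (use fL in auto)
  also have "\<dots> \<le> card (L s (Suc t))" using sub fL by (intro card_mono) auto
  finally show ?case unfolding L_def by simp
qed

text \<open>One half of the proportion \<open>2 * \<rho>\<close> pays for the forbidden set
  \<open>A\<close>.\<close>

lemma robust_draw1:
  assumes V: "finite V" and Y: "Y \<subseteq> V" "2 * \<rho> * real (card V) \<le> real (card Y)"
    and A: "finite A" "real (card A) \<le> \<rho> * real (card V)"
    and step: "\<And>x. x \<in> Y \<Longrightarrow> x \<notin> A \<Longrightarrow> robust \<rho> V \<Phi> t (insert x s)"
  shows "robust \<rho> V \<Phi> (Suc t) s"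
proof -
  have "card Y - card A \<le> card (Y - A)" by (rule diff_card_le_card_Diff[OF A(1)])
  also have "\<dots> \<le> card {x \<in> V. robust \<rho> V \<Phi> t (insert x s)}"
    using V Y step by (intro card_mono) auto
  finally have "real (card Y) - real (card A) \<le> real (card {x \<in> V. robust \<rho> V \<Phi> t (insert x s)})"
    by linarith
  then show ?thesis using Y(2) A(2) by simp
qed

text \<open>Averaging: the light sections contribute at most \<open>c * card V * card W\<close> to
  \<open>R\<close>, and a heavy one at most \<open>card W\<close>.\<close>

lemma card_heavy_sections:
  fixes c :: real
  assumes V: "finite V" "finite W" "W \<noteq> {}" and c0: "c \<ge> 0" and R: "R \<subseteq> V \<times> W"
    and c: "2 * c * real (card V) * real (card W) \<le> real (card R)"
  shows "c * real (card V) \<le> real (card {x \<in> V. c * real (card W) \<le> real (card (R `` {x}))})"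
proof -
  define X where "X = {x \<in> V. c * real (card W) \<le> real (card (R `` {x}))}"
  have fX: "finite X" using V unfolding X_def by simp
  have w: "real (card W) > 0" using V by (simp add: card_gt_0_iff)
  have sec: "card (R `` {x}) \<le> card W" for x
    using R V(2) by (intro card_mono) auto
  have "card (SIGMA x:V. R `` {x}) = (\<Sum>x\<in>V. card (R `` {x}))"
  proof (rule card_SigmaI[OF V(1)])
    show "\<forall>x\<in>V. finite (R `` {x})" using R V(2) by (auto intro: finite_subset[of "R `` {x}" W for x])
  qed
  moreover have "(SIGMA x:V. R `` {x}) = R" using R by fast
  ultimately have "card R = (\<Sum>x\<in>V. card (R `` {x}))" by simp
  then have "real (card R) = (\<Sum>x\<in>V. real (card (R `` {x})))" by simp
  also have "\<dots> \<le> (\<Sum>x\<in>V. (if x \<in> X then real (card W) else 0) + c * real (card W))"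
  proof (rule sum_mono)
    fix x assume x: "x \<in> V"
    have "real (card (R `` {x})) \<le> real (card W)" using sec by simp
    moreover have "0 \<le> c * real (card W)" using c0 by simp
    ultimately show "real (card (R `` {x})) \<le> (if x \<in> X then real (card W) else 0) + c * real (card W)"
      using x unfolding X_def by simp
  qed
  also have "\<dots> = real (card X) * real (card W) + c * real (card V) * real (card W)"
  proof -
    have "V \<inter> X = X" unfolding X_def by auto
    then show ?thesis using V(1) by (simp add: sum.distrib sum.If_cases)
  qed
  finally have "c * real (card V) * real (card W) \<le> real (card X) * real (card W)"
    using c by simp
  then show ?thesis using w unfolding X_def by simp
qed

text \<open>The first vertex is drawn among those with a large section of \<open>R\<close>. Passing
  to sections halves the density once per coordinate, whence \<open>4 * \<rho>\<close> here and
  \<open>8 * \<rho>\<close> for triples. The \<open>+ 1\<close> leaves room to forbid the first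
  vertex when the second is drawn.\<close>

lemma robust_draw2:
  assumes V: "finite V" "V \<noteq> {}" and \<rho>: "0 \<le> \<rho>" and R: "R \<subseteq> V \<times> V"
      "4 * \<rho> * (real (card V))\<^sup>2 \<le> real (card R)"
    and A: "finite A" "real (card A + 1) \<le> \<rho> * real (card V)"
    and step: "\<And>x y. (x, y) \<in> R \<Longrightarrow> x \<notin> A \<Longrightarrow> y \<notin> A \<Longrightarrow> x \<noteq> y \<Longrightarrow>
      robust \<rho> V \<Phi> t (insert y (insert x s))"
  shows "robust \<rho> V \<Phi> (Suc (Suc t)) s"
proof (rule robust_draw1[OF V(1)])
  define Y where "Y = {x \<in> V. 2 * \<rho> * real (card V) \<le> real (card (R `` {x}))}"
  show "Y \<subseteq> V" unfolding Y_def by auto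
  show "2 * \<rho> * real (card V) \<le> real (card Y)"
    unfolding Y_def using V \<rho> R by (intro card_heavy_sections) (auto simp: power2_eq_square)
  show "finite A" by (rule A(1))
  show "real (card A) \<le> \<rho> * real (card V)" using A(2) by simp
  fix x assume x: "x \<in> Y" "x \<notin> A"
  show "robust \<rho> V \<Phi> (Suc t) (insert x s)"
  proof (rule robust_draw1[OF V(1)])
    show "R `` {x} \<subseteq> V" using R(1) by auto
    show "2 * \<rho> * real (card V) \<le> real (card (R `` {x}))" using x unfolding Y_def by simp
    show "finite (insert x A)" using A by simp
    show "real (card (insert x A)) \<le> \<rho> * real (card V)" using A x by simp
    fix y assume "y \<in> R `` {x}" "y \<notin> insert x A"
    then show "robust \<rho> V \<Phi> t (insert y (insert x s))" using x by (intro step) auto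
  qed
qed

lemma robust_draw3:
  assumes V: "finite V" "V \<noteq> {}" and \<rho>: "0 \<le> \<rho>" and R: "R \<subseteq> V \<times> V \<times> V"
      "8 * \<rho> * (real (card V)) ^ 3 \<le> real (card R)"
    and A: "finite A" "real (card A + 2) \<le> \<rho> * real (card V)"
    and step: "\<And>x y z. (x, y, z) \<in> R \<Longrightarrow> x \<notin> A \<Longrightarrow> y \<notin> A \<Longrightarrow> z \<notin> A \<Longrightarrow> distinct [x, y, z] \<Longrightarrow>
      robust \<rho> V \<Phi> t (insert z (insert y (insert x s)))"
  shows "robust \<rho> V \<Phi> (Suc (Suc (Suc t))) s"
proof (rule robust_draw1[OF V(1)])
  define Y where "Y = {x \<in> V. 4 * \<rho> * real (card (V \<times> V)) \<le> real (card (R `` {x}))}"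
  show "Y \<subseteq> V" unfolding Y_def by auto
  have "4 * \<rho> * real (card V) \<le> real (card Y)"
    unfolding Y_def using V \<rho> R
    by (intro card_heavy_sections) (auto simp: card_cartesian_product power3_eq_cube)
  then show "2 * \<rho> * real (card V) \<le> real (card Y)"
    using \<rho> by (auto intro: order_trans[rotated] mult_right_mono)
  show "finite A" by (rule A(1))
  show "real (card A) \<le> \<rho> * real (card V)" using A(2) by simp
  fix x assume x: "x \<in> Y" "x \<notin> A"
  show "robust \<rho> V \<Phi> (Suc (Suc t)) (insert x s)"
  proof (rule robust_draw2[OF V \<rho>])
    show "R `` {x} \<subseteq> V \<times> V" using R(1) by auto
    show "4 * \<rho> * (real (card V))\<^sup>2 \<le> real (card (R `` {x}))"
      using x unfolding Y_def by (simp add: card_cartesian_product power2_eq_square)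
    show "finite (insert x A)" using A by simp
    show "real (card (insert x A) + 1) \<le> \<rho> * real (card V)" using A x by simp
    fix y z assume "(y, z) \<in> R `` {x}" "y \<notin> insert x A" "z \<notin> insert x A" "y \<noteq> z"
    then show "robust \<rho> V \<Phi> t (insert z (insert y (insert x s)))" using x by (intro step) auto
  qed
qed

text \<open>If \<open>card U = k + 2\<close>, then \<open>M'\<close> misses exactly two vertices of
  \<open>\<Union>M \<union> U\<close>, and these may lie in \<open>\<Union>M\<close>.\<close>

definition absorbs :: "'a set set \<Rightarrow> 'a set \<Rightarrow> 'a set set \<Rightarrow> bool" where
  "absorbs E U M \<longleftrightarrow> matching E M \<and> \<Union>M \<inter> U = {} \<and>
     (\<exists>M'. matching E M' \<and> \<Union>M' \<subseteq> \<Union>M \<union> U \<and> card M' = Suc (card M))"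

text \<open>\<open>Z\<close> is the set that absorbers have to avoid, and \<open>B\<close> bounds
  the number of draws. By \<open>budget\<close>, every draw can avoid \<open>Z\<close> and
  everything drawn before.\<close>

locale absorber_game =
  fixes k :: nat and V U Z :: "'a set" and E :: "'a set set" and \<rho> :: real and B :: nat
  assumes kg: "kgraph k V E" and k4: "4 \<le> k" and UV: "U \<subseteq> V" and cardU: "card U = k + 2"
    and ZV: "Z \<subseteq> V" and UZ: "U \<subseteq> Z"
    and rho: "0 < \<rho>" "\<rho> \<le> 1" and budget: "real (card Z + B) \<le> \<rho> * real (card V)"
begin

lemma finV: "finite V" using kg unfolding kgraph_def by simp
lemma finZ: "finite Z" using ZV finV by (rule finite_subset)
lemma V_ne: "V \<noteq> {}" using UV cardU by auto

definition absorbed_in :: "'a set \<Rightarrow> bool" where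
  "absorbed_in s \<longleftrightarrow> (\<exists>M. absorbs E U M \<and> \<Union>M \<subseteq> s - Z)"

text \<open>\<open>s\<close> is the set of vertices drawn so far. \<open>P\<close> contains the vertices that \<open>M2\<close> has yet to cover or
  to leave over, \<open>N\<close> those covered by \<open>M2\<close> that \<open>M1\<close> has yet to cover, and \<open>F\<close> unused drawn vertices. As
  formal sums, \<open>U + \<Union>M1 + N = \<Union>M2 + P\<close>.\<close>

definition position :: "'a set \<Rightarrow> 'a set \<Rightarrow> 'a set \<Rightarrow> 'a set \<Rightarrow> bool" where
  "position s P N F \<longleftrightarrow> s \<subseteq> V \<and> s \<inter> Z = {} \<and> F \<subseteq> s \<and> N \<subseteq> s \<and> P \<inter> N = {} \<and>
     (\<exists>M1 M2. matching E M1 \<and> matching E M2 \<and> \<Union>M1 \<subseteq> s \<and> N \<inter> \<Union>M1 = {} \<and> P \<inter> \<Union>M2 = {} \<and>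
        \<Union>M2 \<union> P = U \<union> \<Union>M1 \<union> N \<and> F \<inter> (U \<union> \<Union>M1 \<union> N) = {})"

text \<open>A strategy sees only \<open>P\<close>, \<open>N\<close> and \<open>F\<close>. The drawn
  set \<open>s\<close> is therefore quantified over all positions with these data, the two matchings
  stay hidden in \<open>position\<close>, and \<open>card s + t \<le> B\<close> keeps the play
  within the budget.\<close>

definition wins :: "nat \<Rightarrow> 'a set \<Rightarrow> 'a set \<Rightarrow> 'a set \<Rightarrow> bool" where
  "wins t P N F \<longleftrightarrow> (\<forall>s. position s P N F \<longrightarrow> card s + t \<le> B \<longrightarrow> robust \<rho> V absorbed_in t s)"

lemma absorbed_in_mono: "absorbed_in s \<Longrightarrow> s \<subseteq> s' \<Longrightarrow> absorbed_in s'"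
proof -
  assume "absorbed_in s" and s: "s \<subseteq> s'"
  then obtain M where M: "absorbs E U M" "\<Union>M \<subseteq> s - Z" unfolding absorbed_in_def by auto
  have "\<Union>M \<subseteq> s' - Z" using M(2) Diff_mono[OF s subset_refl] by (rule order_trans)
  with M(1) show "absorbed_in s'" unfolding absorbed_in_def by (intro exI conjI)
qed

section \<open>Moves of the game\<close>

lemma matching_insert:
  assumes "matching E M" "e \<in> E" "e \<inter> \<Union>M = {}"
  shows "matching E (insert e M)"
proof -
  have "disjnt e f \<and> disjnt f e" if "f \<in> M" for f
    using assms(3) that unfolding disjnt_def by auto
  then show ?thesis using assms(1,2) unfolding matching_def pairwise_insert by simp
qed

lemma position_drop:
  assumes pos: "position s P N F" and F': "F' \<subseteq> F"
  shows "position s P N F'"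
proof -
  obtain M1 M2 where s': "s \<subseteq> V" "s \<inter> Z = {}" "F \<subseteq> s" "N \<subseteq> s" "P \<inter> N = {}"
    and M: "matching E M1" "matching E M2" "\<Union>M1 \<subseteq> s" "N \<inter> \<Union>M1 = {}" "P \<inter> \<Union>M2 = {}"
      "\<Union>M2 \<union> P = U \<union> \<Union>M1 \<union> N" and F: "F \<inter> (U \<union> \<Union>M1 \<union> N) = {}"
    using pos unfolding position_def by auto
  have "F' \<inter> (U \<union> \<Union>M1 \<union> N) \<subseteq> F \<inter> (U \<union> \<Union>M1 \<union> N)"
    by (rule Int_mono[OF F' subset_refl])
  then have "F' \<inter> (U \<union> \<Union>M1 \<union> N) = {}" unfolding F by (rule subset_antisym) simp
  moreover have "F' \<subseteq> s" using F' s'(3) by (rule order_trans)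
  ultimately show ?thesis unfolding position_def using s' M by blast
qed

lemma wins_drop: "wins t P N F' \<Longrightarrow> F' \<subseteq> F \<Longrightarrow> wins t P N F"
  unfolding wins_def using position_drop by blast

lemma winsD: "wins t P N F \<Longrightarrow> position s P N F \<Longrightarrow> card s + t \<le> B \<Longrightarrow> robust \<rho> V absorbed_in t s"
  unfolding wins_def by blast

lemma robust_absorbed_le:
  assumes "robust \<rho> V absorbed_in t s" "t \<le> t'"
  shows "robust \<rho> V absorbed_in t' s"
  using finV absorbed_in_mono rho(2) assms by (rule robust_le)

lemma wins_mono: "wins t P N F \<Longrightarrow> t \<le> t' \<Longrightarrow> wins t' P N F"
  unfolding wins_def
proof (intro allI impI)
  fix s assume w: "\<forall>s. position s P N F \<longrightarrow> card s + t \<le> B \<longrightarrow> robust \<rho> V absorbed_in t s"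
    and t: "t \<le> t'" and s: "position s P N F" "card s + t' \<le> B"
  have "card s + t \<le> B" using t s(2) by simp
  then have "robust \<rho> V absorbed_in t s" using w s(1) by blast
  then show "robust \<rho> V absorbed_in t' s" using t by (rule robust_absorbed_le)
qed

text \<open>With \<open>N\<close> empty, the formal sum is
  \<open>\<Union>M2 + P = U + \<Union>M1\<close>. Counting vertices gives
  \<open>k * card M2 + 2 = (k + 2) + k * card M1\<close>, so \<open>M2\<close> has exactly one edge
  more than \<open>M1\<close>.\<close>

lemma wins_end:
  assumes P: "card P = 2"
  shows "wins t P {} F"
  unfolding wins_def
proof (intro allI impI)
  fix s assume "position s P {} F"
  then obtain M1 M2 where s: "s \<inter> Z = {}" and M: "matching E M1" "matching E M2"
    and sub: "\<Union>M1 \<subseteq> s" and P2: "P \<inter> \<Union>M2 = {}" and eq: "\<Union>M2 \<union> P = U \<union> \<Union>M1"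
    unfolding position_def by auto
  have fin: "finite (\<Union>M1)" "finite (\<Union>M2)" "finite U" "finite P"
  proof -
    show "finite (\<Union>M1)" "finite (\<Union>M2)"
      using matching_card_Union(3)[OF kg] M finV by (auto intro: finite_subset)
    show "finite U" using UV finV by (rule finite_subset)
    show "finite P" using P by (intro card_ge_0_finite) simp
  qed
  have UM: "\<Union>M1 \<inter> U = {}" using sub s UZ by blast
  have "card (\<Union>M2) + card P = card (\<Union>M2 \<union> P)"
    using fin P2 by (intro card_Un_disjoint[symmetric]) auto
  also have "\<dots> = card U + card (\<Union>M1)"
    unfolding eq using fin UM by (intro card_Un_disjoint) auto
  finally have "k * card M2 + 2 = (k + 2) + k * card M1"
    using matching_card_Union(1)[OF kg] M P cardU by simp
  then have "k * card M2 = k * Suc (card M1)" by simp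
  then have "card M2 = Suc (card M1)" using k4 by (metis mult_cancel1 not_numeral_le_zero)
  moreover have "\<Union>M2 \<subseteq> \<Union>M1 \<union> U" using eq by blast
  ultimately have "absorbs E U M1" unfolding absorbs_def using M UM by blast
  then have "absorbed_in s" unfolding absorbed_in_def using sub s by blast
  then have "robust \<rho> V absorbed_in 0 s" by simp
  then show "robust \<rho> V absorbed_in t s"
    by (rule robust_absorbed_le) simp
qed

text \<open>The edge \<open>p \<union> q\<close> joins \<open>M2\<close>. Its new vertices
  \<open>q\<close> then have to be covered by \<open>M1\<close> too, and \<open>|P| - |N|\<close>
  drops by \<open>k\<close>.\<close>

lemma wins_op2:
  assumes pq: "p \<subseteq> P" "q \<subseteq> F" "p \<union> q \<in> E" and w: "wins t (P - p) (N \<union> q) (F - q)"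
  shows "wins t P N F"
  unfolding wins_def
proof (intro allI impI)
  fix s assume pos: "position s P N F" and s: "card s + t \<le> B"
  then obtain M1 M2 where s': "s \<subseteq> V" "s \<inter> Z = {}" "F \<subseteq> s" "N \<subseteq> s" "P \<inter> N = {}"
    and M: "matching E M1" "matching E M2" "\<Union>M1 \<subseteq> s" "N \<inter> \<Union>M1 = {}" "P \<inter> \<Union>M2 = {}"
      "\<Union>M2 \<union> P = U \<union> \<Union>M1 \<union> N" "F \<inter> (U \<union> \<Union>M1 \<union> N) = {}"
    unfolding position_def by auto
  have F2: "F \<inter> (\<Union>M2 \<union> P) = {}" using M by simp
  have "(p \<union> q) \<inter> \<Union>M2 = {}" using pq F2 M(5) by fast
  then have "matching E (insert (p \<union> q) M2)" using M(2) pq(3) by (intro matching_insert)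
  moreover have "\<Union>(insert (p \<union> q) M2) \<union> (P - p) = U \<union> \<Union>M1 \<union> (N \<union> q)"
  proof -
    have "\<Union>(insert (p \<union> q) M2) \<union> (P - p) = (\<Union>M2 \<union> P) \<union> q" using pq(1) by auto
    then show ?thesis unfolding M(6) by auto
  qed
  moreover have "(P - p) \<inter> \<Union>(insert (p \<union> q) M2) = {}" using M(5) F2 pq(2) by auto
  moreover have "(N \<union> q) \<inter> \<Union>M1 = {}" "(F - q) \<inter> (U \<union> \<Union>M1 \<union> (N \<union> q)) = {}"
    using M(4,7) pq(2) by auto
  moreover have "F - q \<subseteq> s" "N \<union> q \<subseteq> s" "(P - p) \<inter> (N \<union> q) = {}"
    using s' pq F2 by auto
  ultimately have "position s (P - p) (N \<union> q) (F - q)"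
    unfolding position_def using s'(1,2) M(1,3) by blast
  then show "robust \<rho> V absorbed_in t s" using w s unfolding wins_def by blast
qed

text \<open>The reverse move: \<open>n \<union> q\<close> joins \<open>M1\<close>, the vertices of
  \<open>q\<close> become a task for \<open>M2\<close>, and \<open>|P| - |N|\<close> grows by
  \<open>k\<close>.\<close>

lemma wins_op1:
  assumes nq: "n \<subseteq> N" "q \<subseteq> F" "n \<union> q \<in> E" and w: "wins t (P \<union> q) (N - n) (F - q)"
  shows "wins t P N F"
  unfolding wins_def
proof (intro allI impI)
  fix s assume pos: "position s P N F" and s: "card s + t \<le> B"
  then obtain M1 M2 where s': "s \<subseteq> V" "s \<inter> Z = {}" "F \<subseteq> s" "N \<subseteq> s" "P \<inter> N = {}"
    and M: "matching E M1" "matching E M2" "\<Union>M1 \<subseteq> s" "N \<inter> \<Union>M1 = {}" "P \<inter> \<Union>M2 = {}"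
      "\<Union>M2 \<union> P = U \<union> \<Union>M1 \<union> N" "F \<inter> (U \<union> \<Union>M1 \<union> N) = {}"
    unfolding position_def by auto
  have F2: "F \<inter> (\<Union>M2 \<union> P) = {}" using M by simp
  have "(n \<union> q) \<inter> \<Union>M1 = {}" using nq M(4,7) by fast
  then have "matching E (insert (n \<union> q) M1)" using M(1) nq(3) by (intro matching_insert)
  moreover have "\<Union>M2 \<union> (P \<union> q) = U \<union> \<Union>(insert (n \<union> q) M1) \<union> (N - n)"
  proof -
    have "U \<union> \<Union>(insert (n \<union> q) M1) \<union> (N - n) = (U \<union> \<Union>M1 \<union> N) \<union> q" using nq(1) by auto
    then show ?thesis unfolding M(6)[symmetric] by auto
  qed
  moreover have "(P \<union> q) \<inter> \<Union>M2 = {}" using M(5) F2 nq(2) by auto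
  moreover have "(N - n) \<inter> \<Union>(insert (n \<union> q) M1) = {}" using M(4,7) nq(2) by auto
  moreover have "(F - q) \<inter> (U \<union> \<Union>(insert (n \<union> q) M1) \<union> (N - n)) = {}"
    using M(7) nq by auto
  moreover have "F - q \<subseteq> s" "N - n \<subseteq> s" "(P \<union> q) \<inter> (N - n) = {}" "\<Union>(insert (n \<union> q) M1) \<subseteq> s"
    using s' nq M(3,7) by auto
  ultimately have "position s (P \<union> q) (N - n) (F - q)"
    unfolding position_def using s'(1,2) M(2) by blast
  then show "robust \<rho> V absorbed_in t s" using w s unfolding wins_def by blast
qed

text \<open>The formal sum forces \<open>P \<subseteq> U \<union> \<Union>M1 \<union> N\<close>, so
  a vertex outside \<open>Z\<close> and \<open>s\<close> is new to the whole position.\<close>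

lemma position_insert:
  assumes "position s P N F" "x \<in> V" "x \<notin> Z \<union> s"
  shows "position (insert x s) P N (insert x F)" "x \<notin> Z \<union> P \<union> N \<union> F"
proof -
  obtain M1 M2 where s': "s \<subseteq> V" "s \<inter> Z = {}" "F \<subseteq> s" "N \<subseteq> s" "P \<inter> N = {}"
    and M: "matching E M1" "matching E M2" "\<Union>M1 \<subseteq> s" "N \<inter> \<Union>M1 = {}" "P \<inter> \<Union>M2 = {}"
      "\<Union>M2 \<union> P = U \<union> \<Union>M1 \<union> N" "F \<inter> (U \<union> \<Union>M1 \<union> N) = {}"
    using assms(1) unfolding position_def by auto
  have x: "x \<notin> U \<union> \<Union>M1 \<union> N" using assms(3) M(3) s' UZ by blast
  have "P \<subseteq> U \<union> \<Union>M1 \<union> N" using M(6) by blast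
  then show "x \<notin> Z \<union> P \<union> N \<union> F" using x assms(3) s' by blast
  have "insert x s \<subseteq> V" "insert x s \<inter> Z = {}" "insert x F \<subseteq> insert x s" "N \<subseteq> insert x s"
      "\<Union>M1 \<subseteq> insert x s" "insert x F \<inter> (U \<union> \<Union>M1 \<union> N) = {}"
    using s' M(3,7) x assms(2,3) by auto
  then show "position (insert x s) P N (insert x F)"
    unfolding position_def using s'(5) M(1,2,4,5,6) by blast
qed

lemma position_finite: "position s P N F \<Longrightarrow> finite s"
  unfolding position_def by (elim conjE) (rule finite_subset[OF _ finV])

lemma wins_draw1:
  assumes Y: "Y \<subseteq> V" "2 * \<rho> * real (card V) \<le> real (card Y)"
    and w: "\<And>x. x \<in> Y \<Longrightarrow> x \<notin> Z \<union> P \<union> N \<union> F \<Longrightarrow> wins t P N (insert x F)"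
  shows "wins (Suc t) P N F"
  unfolding wins_def
proof (intro allI impI)
  fix s assume pos: "position s P N F" and s: "card s + Suc t \<le> B"
  show "robust \<rho> V absorbed_in (Suc t) s"
  proof (rule robust_draw1[OF finV Y, where A = "Z \<union> s"])
    show "finite (Z \<union> s)" using finZ position_finite[OF pos] by simp
    have "real (card (Z \<union> s)) \<le> real (card Z + B)"
      using card_Un_le[of Z s] s by simp
    then show "real (card (Z \<union> s)) \<le> \<rho> * real (card V)" using budget by simp
    fix x assume x: "x \<in> Y" "x \<notin> Z \<union> s"
    then have xV: "x \<in> V" using Y by auto
    have "wins t P N (insert x F)"
      using w x(1) position_insert(2)[OF pos xV x(2)] by simp
    moreover have "card (insert x s) + t \<le> B"
      using s position_finite[OF pos] x by simp
    ultimately show "robust \<rho> V absorbed_in t (insert x s)"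
      using position_insert(1)[OF pos xV x(2)] unfolding wins_def by blast
  qed
qed

lemma wins_draw2:
  assumes R: "R \<subseteq> V \<times> V" "4 * \<rho> * (real (card V))\<^sup>2 \<le> real (card R)"
    and w: "\<And>x y. (x, y) \<in> R \<Longrightarrow> x \<noteq> y \<Longrightarrow> {x, y} \<inter> (Z \<union> P \<union> N \<union> F) = {} \<Longrightarrow> wins t P N (F \<union> {x, y})"
  shows "wins (t + 2) P N F"
  unfolding wins_def
proof (intro allI impI)
  fix s assume pos: "position s P N F" and s: "card s + (t + 2) \<le> B"
  have fs: "finite s" by (rule position_finite[OF pos])
  have "robust \<rho> V absorbed_in (Suc (Suc t)) s"
  proof (rule robust_draw2[OF finV V_ne _ R, where A = "Z \<union> s"])
    show "0 \<le> \<rho>" using rho by simp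
    show "finite (Z \<union> s)" using finZ fs by simp
    have "real (card (Z \<union> s) + 1) \<le> real (card Z + B)"
      using card_Un_le[of Z s] s by simp
    then show "real (card (Z \<union> s) + 1) \<le> \<rho> * real (card V)" using budget by simp
    fix x y assume xy: "(x, y) \<in> R" "x \<notin> Z \<union> s" "y \<notin> Z \<union> s" "x \<noteq> y"
    then have xV: "x \<in> V" "y \<in> V" using R by auto
    note px = position_insert[OF pos xV(1) xy(2)]
    have y: "y \<notin> Z \<union> insert x s" using xy by auto
    note py = position_insert[OF px(1) xV(2) y]
    have "wins t P N (F \<union> {x, y})"
      using w[OF xy(1,4)] px(2) py(2) by simp
    moreover have "F \<union> {x, y} = insert y (insert x F)" by auto
    moreover have "card (insert y (insert x s)) + t \<le> B"
      using s fs xy by simp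
    ultimately show "robust \<rho> V absorbed_in t (insert y (insert x s))"
      using py(1) winsD by simp
  qed
  then show "robust \<rho> V absorbed_in (t + 2) s" by simp
qed

lemma wins_draw3:
  assumes R: "R \<subseteq> V \<times> V \<times> V" "8 * \<rho> * (real (card V)) ^ 3 \<le> real (card R)"
    and w: "\<And>x y z. (x, y, z) \<in> R \<Longrightarrow> distinct [x, y, z] \<Longrightarrow> {x, y, z} \<inter> (Z \<union> P \<union> N \<union> F) = {} \<Longrightarrow>
       wins t P N (F \<union> {x, y, z})"
  shows "wins (t + 3) P N F"
  unfolding wins_def
proof (intro allI impI)
  fix s assume pos: "position s P N F" and s: "card s + (t + 3) \<le> B"
  have fs: "finite s" by (rule position_finite[OF pos])
  have "robust \<rho> V absorbed_in (Suc (Suc (Suc t))) s"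
  proof (rule robust_draw3[OF finV V_ne _ R, where A = "Z \<union> s"])
    show "0 \<le> \<rho>" using rho by simp
    show "finite (Z \<union> s)" using finZ fs by simp
    have "real (card (Z \<union> s) + 2) \<le> real (card Z + B)"
      using card_Un_le[of Z s] s by simp
    then show "real (card (Z \<union> s) + 2) \<le> \<rho> * real (card V)" using budget by simp
    fix x y z assume xy: "(x, y, z) \<in> R" "x \<notin> Z \<union> s" "y \<notin> Z \<union> s" "z \<notin> Z \<union> s" "distinct [x, y, z]"
    then have xV: "x \<in> V" "y \<in> V" "z \<in> V" using R by auto
    note px = position_insert[OF pos xV(1) xy(2)]
    have y: "y \<notin> Z \<union> insert x s" using xy by auto
    note py = position_insert[OF px(1) xV(2) y]
    have z: "z \<notin> Z \<union> insert y (insert x s)" using xy by auto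
    note pz = position_insert[OF py(1) xV(3) z]
    have "wins t P N (F \<union> {x, y, z})"
      using w[OF xy(1,5)] px(2) py(2) pz(2) by simp
    moreover have "F \<union> {x, y, z} = insert z (insert y (insert x F))" by auto
    moreover have "card (insert z (insert y (insert x s))) + t \<le> B"
      using s fs xy by (auto simp: card_insert_if)
    ultimately show "robust \<rho> V absorbed_in t (insert z (insert y (insert x s)))"
      using pz(1) winsD by simp
  qed
  then show "robust \<rho> V absorbed_in (t + 3) s" by (simp only: add_Suc_right numeral_3_eq_3 add_0_right)
qed

lemma wins_start:
  assumes "wins t U {} {}" "t \<le> B"
  shows "robust \<rho> V absorbed_in t {}"
proof -
  have "position {} U {} {}"
    unfolding position_def matching_def by (intro conjI exI[of _ "{}"]) auto
  then show ?thesis using assms unfolding wins_def by simp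
qed

end

section \<open>Absorbers for uniformity at least five\<close>

text \<open>\<open>4 * \<rho> \<le> \<alpha>\<close> is the price of drawing both vertices of an
  extension with \<open>wins_draw2\<close>.\<close>

locale dense_absorber_game = absorber_game k V U Z E \<rho> B
  for k V and U Z :: "'a set" and E \<rho> B +
  fixes \<alpha> :: real
  assumes dense: "dense_kgraph k \<alpha> V E" and rho_alpha: "4 * \<rho> \<le> \<alpha>"
begin

lemma extensions_sub: "extensions V E S \<subseteq> V \<times> V"
  unfolding extensions_def by auto

lemma extensions_iff: "(x, y) \<in> extensions V E S \<longleftrightarrow> x \<in> V \<and> y \<in> V \<and> S \<union> {x, y} \<in> E"
  unfolding extensions_def by simp

lemma extensions_card:
  assumes "S \<subseteq> V" "card S = k - 2"
  shows "\<alpha> * (real (card V))\<^sup>2 \<le> real (card (extensions V E S))"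
  using dense assms unfolding dense_kgraph_def by simp

lemma wins_extend:
  assumes S: "S \<subseteq> V" "card S = k - 2"
    and w: "\<And>q. q \<subseteq> V \<Longrightarrow> card q = 2 \<Longrightarrow> q \<inter> (Z \<union> P \<union> N \<union> F) = {} \<Longrightarrow> S \<union> q \<in> E \<Longrightarrow> wins t P N (F \<union> q)"
  shows "wins (t + 2) P N F"
proof (rule wins_draw2[OF extensions_sub])
  have "4 * \<rho> * (real (card V))\<^sup>2 \<le> \<alpha> * (real (card V))\<^sup>2"
    using rho_alpha by (rule mult_right_mono) simp
  then show "4 * \<rho> * (real (card V))\<^sup>2 \<le> real (card (extensions V E S))"
    using extensions_card[OF S] by linarith
  fix x y assume "(x, y) \<in> extensions V E S" "x \<noteq> y" "{x, y} \<inter> (Z \<union> P \<union> N \<union> F) = {}"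
  then show "wins t P N (F \<union> {x, y})"
    by (intro w) (auto simp: extensions_iff)
qed

text \<open>Supplies filler vertices that bring a chosen set up to size
  \<open>k - 2\<close>.\<close>

lemma wins_draw_set:
  assumes "\<And>R. R \<subseteq> V \<Longrightarrow> card R = r \<Longrightarrow> R \<inter> (Z \<union> P \<union> N \<union> F) = {} \<Longrightarrow> wins t P N (F \<union> R)"
    and \<rho>: "2 * \<rho> \<le> 1"
  shows "wins (t + r) P N F"
  using assms(1)
proof (induction r arbitrary: F)
  case 0
  then show ?case using 0[of "{}"] by simp
next
  case (Suc r)
  have "wins (Suc (t + r)) P N F"
  proof (rule wins_draw1[where Y = V])
    show "2 * \<rho> * real (card V) \<le> real (card V)" using mult_right_mono[OF \<rho>, of "real (card V)"] by simp
    fix x assume x: "x \<in> V" "x \<notin> Z \<union> P \<union> N \<union> F"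
    show "wins (t + r) P N (insert x F)"
    proof (rule Suc.IH)
      fix R assume R: "R \<subseteq> V" "card R = r" "R \<inter> (Z \<union> P \<union> N \<union> insert x F) = {}"
      have "finite R" using R(1) finV by (rule finite_subset)
      then have "card (insert x R) = Suc r" using R by auto
      then have "wins t P N (F \<union> insert x R)" using R x by (intro Suc.prems) auto
      then show "wins t P N (insert x F \<union> R)" by simp
    qed
  qed simp
  then show ?case by simp
qed

text \<open>With \<open>p' = p \<union> {a}\<close>, the edges \<open>p' \<union> R \<union> q\<close> and \<open>{b} \<union> R \<union> q \<union> q'\<close> exchange \<open>p + a - b\<close> for the pair \<open>q'\<close>.\<close>

lemma wins_exchange:
  assumes k5: "5 \<le> k" and \<rho>: "2 * \<rho> \<le> 1"
    and PV: "P \<subseteq> V" "3 \<le> card P" and b: "b \<in> N" and NV: "N \<subseteq> V"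
    and w: "\<And>P'. P' \<subseteq> V \<Longrightarrow> Suc (card P') = card P \<Longrightarrow> wins t P' (N - {b}) {}"
  shows "wins (t + (k - 1)) P N {}"
proof -
  have fP: "finite P" using PV finV finite_subset by blast
  obtain p' where p': "p' \<subseteq> P" "card p' = 3" using PV(2) by (meson obtain_subset_with_card_n)
  have fp': "finite p'" using p' fP finite_subset by blast
  \<comment> \<open>The set \<open>R\<close> fills the three vertices of \<open>p'\<close> up to
    \<open>k - 2\<close>; this is where \<open>k \<ge> 5\<close> enters.\<close>
  have "wins (t + 4 + (k - 5)) P N {}"
  proof (rule wins_draw_set[OF _ \<rho>])
    fix R assume R: "R \<subseteq> V" "card R = k - 5" "R \<inter> (Z \<union> P \<union> N \<union> {}) = {}"
    have fR: "finite R" using R finV finite_subset by blast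
    have "wins (t + 2 + 2) P N ({} \<union> R)"
    proof (rule wins_extend[where S = "p' \<union> R"])
      show "p' \<union> R \<subseteq> V" using p' PV R by blast
      have "p' \<inter> R = {}" using p' R by blast
      then show "card (p' \<union> R) = k - 2" using card_Un_disjoint[OF fp' fR] p' R k5 by simp
      fix q assume q: "q \<subseteq> V" "card q = 2" "q \<inter> (Z \<union> P \<union> N \<union> ({} \<union> R)) = {}" "p' \<union> R \<union> q \<in> E"
      have fq: "finite q" using q finV finite_subset by blast
      show "wins (t + 2) P N ({} \<union> R \<union> q)"
      proof (rule wins_op2[where p = p' and q = "R \<union> q"])
        show "p' \<subseteq> P" by (rule p'(1))
        show "p' \<union> (R \<union> q) \<in> E" using q(4) by (simp add: Un_assoc)
        have "wins (t + 2) (P - p') (N \<union> (R \<union> q)) {}"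
        \<comment> \<open>\<open>b\<close> together with \<open>R \<union> q\<close> has again
          \<open>1 + (k - 5) + 2 = k - 2\<close> vertices. The second edge clears \<open>b\<close>
          from \<open>N\<close> along with everything that the first edge put there.\<close>
        proof (rule wins_extend[where S = "insert b (R \<union> q)"])
          show "insert b (R \<union> q) \<subseteq> V" using b NV R q by blast
          have "R \<inter> q = {}" "b \<notin> R \<union> q" using R q b by blast+
          then show "card (insert b (R \<union> q)) = k - 2"
            using card_Un_disjoint[OF fR fq] fR fq R q k5 by simp
          fix q' assume q': "q' \<subseteq> V" "card q' = 2" "q' \<inter> (Z \<union> (P - p') \<union> (N \<union> (R \<union> q)) \<union> {}) = {}"
            "insert b (R \<union> q) \<union> q' \<in> E"
          have fq': "finite q'" using q' finV finite_subset by blast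
          show "wins t (P - p') (N \<union> (R \<union> q)) ({} \<union> q')"
          proof (rule wins_op1[where n = "insert b (R \<union> q)" and q = q'])
            show "insert b (R \<union> q) \<subseteq> N \<union> (R \<union> q)" using b by auto
            show "insert b (R \<union> q) \<union> q' \<in> E" by (rule q'(4))
            have "wins t ((P - p') \<union> q') (N - {b}) {}"
            proof (rule w)
              show "P - p' \<union> q' \<subseteq> V" using PV q' by blast
              have "card (P - p' \<union> q') = card (P - p') + card q'"
                using fP fq' q' by (intro card_Un_disjoint) auto
              then show "Suc (card (P - p' \<union> q')) = card P"
                using p' fp' q' PV card_Diff_subset[OF fp' p'(1)] by simp
            qed
            moreover have "N \<union> (R \<union> q) - insert b (R \<union> q) = N - {b}"
              using R(3) q(3) by blast
            ultimately show "wins t (P - p' \<union> q') (N \<union> (R \<union> q) - insert b (R \<union> q)) ({} \<union> q' - q')"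
              by simp
          qed simp
        qed
        then show "wins (t + 2) (P - p') (N \<union> (R \<union> q)) ({} \<union> R \<union> q - (R \<union> q))" by simp
      qed simp
    qed
    then show "wins (t + 4) P N ({} \<union> R)" by (simp only: add.assoc numeral_plus_numeral semiring_norm)
  qed
  moreover have "t + 4 + (k - 5) = t + (k - 1)" using k5 by simp
  ultimately show ?thesis by metis
qed

text \<open>The size pairs \<open>(|P|, |N|)\<close> are (k + 2, 0), (4, 2), (3, 1), (2, 0): one
  edge, then two exchanges of \<open>k - 1\<close> draws each.\<close>

lemma wins_start_ge5:
  assumes k5: "5 \<le> k" and \<rho>: "2 * \<rho> \<le> 1"
  shows "wins (2 * k) U {} {}"
proof -
  obtain S where S: "S \<subseteq> U" "card S = k - 2"
    using cardU by (metis diff_le_self le_add1 le_trans obtain_subset_with_card_n)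
  have fU: "finite U" using UV finV by (rule finite_subset)
  have fS: "finite S" using S fU finite_subset by blast
  have "wins ((k - 1) + (k - 1) + 2) U {} {}"
  proof (rule wins_extend[where S = S])
    show "S \<subseteq> V" "card S = k - 2" using S UV by auto
    fix q assume q: "q \<subseteq> V" "card q = 2" "q \<inter> (Z \<union> U \<union> {} \<union> {}) = {}" "S \<union> q \<in> E"
    show "wins ((k - 1) + (k - 1)) U {} ({} \<union> q)"
    proof (rule wins_op2[where p = S and q = q])
      obtain a b where ab: "q = {a, b}" "a \<noteq> b" using q(2) by (auto simp: card_2_iff)
      have cU: "card (U - S) = 4" using card_Diff_subset[OF fS S(1)] S cardU k5 by simp
      have "wins ((k - 1) + (k - 1)) (U - S) q {}"
      proof (rule wins_exchange[OF k5 \<rho>, where b = a])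
        show "U - S \<subseteq> V" "q \<subseteq> V" "a \<in> q" "3 \<le> card (U - S)" using UV q ab cU by auto
        fix P assume P: "P \<subseteq> V" "Suc (card P) = card (U - S)"
        have "wins (0 + (k - 1)) P (q - {a}) {}"
        proof (rule wins_exchange[OF k5 \<rho>, where b = b])
          show "P \<subseteq> V" "3 \<le> card P" "b \<in> q - {a}" "q - {a} \<subseteq> V" using P cU ab q by auto
          fix P' assume "P' \<subseteq> V" "Suc (card P') = card P"
          then have "card P' = 2" using P cU by simp
          moreover have empty: "q - {a} - {b} = {}" using ab by auto
          ultimately show "wins 0 P' (q - {a} - {b}) {}" unfolding empty by (intro wins_end)
        qed
        then show "wins (k - 1) P (q - {a}) {}" by simp
      qed
      then show "wins ((k - 1) + (k - 1)) (U - S) ({} \<union> q) ({} \<union> q - q)" by simp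
    qed (use S q in auto)
  qed
  moreover have "(k - 1) + (k - 1) + 2 = 2 * k" using k5 by simp
  ultimately show ?thesis by metis
qed

end

section \<open>Absorbers for uniformity four\<close>

text \<open>Inclusion-exclusion: the excess of \<open>|A| + |B| + |C|\<close> over
  \<open>|X|\<close> is at most the sum of the pairwise intersections.\<close>

lemma three_large_sets:
  fixes a b :: real
  assumes X: "finite X" "A \<subseteq> X" "B \<subseteq> X" "C \<subseteq> X"
    and a: "a \<le> real (card A)" "a \<le> real (card B)" "a \<le> real (card C)"
    and ab: "real (card X) + 3 * b \<le> 3 * a"
  shows "b \<le> real (card (A \<inter> B)) \<or> b \<le> real (card (A \<inter> C)) \<or> b \<le> real (card (B \<inter> C))"
proof -
  have fin: "finite A" "finite B" "finite C" using X finite_subset by blast+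
  have "card A + card B = card (A \<union> B) + card (A \<inter> B)"
    using fin by (intro card_Un_Int) auto
  moreover have "card (A \<union> B) + card C = card (A \<union> B \<union> C) + card ((A \<union> B) \<inter> C)"
    using fin by (intro card_Un_Int) auto
  moreover have "card ((A \<union> B) \<inter> C) \<le> card (A \<inter> C) + card (B \<inter> C)"
    unfolding Int_Un_distrib2 by (rule card_Un_le)
  moreover have "card (A \<union> B \<union> C) \<le> card X" using X by (intro card_mono) auto
  ultimately have "card A + card B + card C \<le> card X + card (A \<inter> B) + card (A \<inter> C) + card (B \<inter> C)"
    by linarith
  then have "real (card A) + real (card B) + real (card C) \<le>
      real (card X) + real (card (A \<inter> B)) + real (card (A \<inter> C)) + real (card (B \<inter> C))"
    by linarith
  then show ?thesis using a ab by linarith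
qed

text \<open>2/5 lies between 1/3 and the critical density 7/16 for \<open>k = 4\<close>. Its surplus
  over 1/3 yields common neighbourhoods of density 1/15 for pairs and 1/30 for vertices, and drawing
  a triple from density 1/30 costs a factor 8, hence 1/240. The bound 40 takes care of lower order
  terms.\<close>

locale quadruple_game = dense_absorber_game 4 V U Z E "1 / 240" B "2 / 5"
  for V U Z :: "'a set" and E B +
  assumes large: "40 \<le> card V"
begin

section \<open>Common neighbours and popular vertices in 4-graphs\<close>

definition triples :: "'a \<Rightarrow> ('a \<times> 'a \<times> 'a) set" where
  "triples v = {(x, y, z). x \<in> V \<and> y \<in> V \<and> z \<in> V \<and> {v, x, y, z} \<in> E}"

definition near :: "'a \<Rightarrow> 'a \<Rightarrow> bool" where
  "near v w \<longleftrightarrow> (real (card V)) ^ 3 / 30 \<le> real (card (triples v \<inter> triples w))"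

definition near_pair :: "'a set \<Rightarrow> 'a set \<Rightarrow> bool" where
  "near_pair p q \<longleftrightarrow> (real (card V))\<^sup>2 / 15 \<le> real (card (extensions V E p \<inter> extensions V E q))"

text \<open>Popular vertices have many possible substitutes, from which \<open>wins_cancel\<close>
  draws its intermediate vertices.\<close>

definition popular :: "'a set" where
  "popular = {v \<in> V. real (card V) / 10 \<le> real (card {w \<in> V. near v w})}"

lemma near_sym: "near v w \<longleftrightarrow> near w v"
  unfolding near_def by (simp add: Int_commute)

lemma near_pair_cases:
  assumes "p \<subseteq> V" "card p = 2" "q \<subseteq> V" "card q = 2" "r \<subseteq> V" "card r = 2"
  shows "near_pair p q \<or> near_pair p r \<or> near_pair q r"
  unfolding near_pair_def
proof (rule three_large_sets[where X = "V \<times> V" and a = "2 / 5 * (real (card V))\<^sup>2"])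
  show "finite (V \<times> V)" using finV by simp
  show "real (card (V \<times> V)) + 3 * ((real (card V))\<^sup>2 / 15) \<le> 3 * (2 / 5 * (real (card V))\<^sup>2)"
    by (simp add: card_cartesian_product power2_eq_square)
qed (use assms extensions_sub extensions_card in auto)

lemma triples_sub: "triples v \<subseteq> V \<times> V \<times> V"
  unfolding triples_def by auto

text \<open>Summation of the pair degrees over \<open>x \<noteq> v\<close>. Giving up 1/30 of the
  density 2/5 pays for the missing \<open>x = v\<close> and still leaves
  \<open>3 * 11/30 = 1 + 3/30\<close>, as \<open>near_cases\<close> requires.\<close>

lemma triples_card:
  assumes v: "v \<in> V"
  shows "11 / 30 * (real (card V)) ^ 3 \<le> real (card (triples v))"
proof -
  define n where "n = real (card V)"
  have n: "40 \<le> n" using large unfolding n_def by simp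
  have "(\<Sum>x\<in>V - {v}. card (extensions V E {v, x})) = card (SIGMA x:V - {v}. extensions V E {v, x})"
    using finV finite_subset[OF extensions_sub] by (intro card_SigmaI[symmetric]) auto
  also have "\<dots> \<le> card (triples v)"
  proof (intro card_mono)
    show "finite (triples v)" using triples_sub by (rule finite_subset) (use finV in simp)
    show "(SIGMA x:V - {v}. extensions V E {v, x}) \<subseteq> triples v"
      unfolding triples_def extensions_def by (auto simp: insert_commute)
  qed
  finally have le: "(\<Sum>x\<in>V - {v}. real (card (extensions V E {v, x}))) \<le> real (card (triples v))"
    by (metis of_nat_le_iff of_nat_sum)
  have "(\<Sum>x\<in>V - {v}. 2 / 5 * n\<^sup>2) \<le> (\<Sum>x\<in>V - {v}. real (card (extensions V E {v, x})))"
    using v unfolding n_def by (intro sum_mono extensions_card) auto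
  then have "real (card (V - {v})) * (2 / 5 * n\<^sup>2) \<le> real (card (triples v))" using le by simp
  moreover have "real (card (V - {v})) = n - 1"
    using v finV large unfolding n_def by (simp add: of_nat_diff)
  moreover have "11 / 30 * n ^ 3 \<le> (n - 1) * (2 / 5 * n\<^sup>2)"
  proof -
    have "(n - 1) * (2 / 5 * n\<^sup>2) - 11 / 30 * n ^ 3 = n\<^sup>2 * (n / 30 - 2 / 5)"
      by (simp add: field_simps power2_eq_square power3_eq_cube)
    also have "\<dots> \<ge> 0" using n by simp
    finally show ?thesis by simp
  qed
  ultimately have "11 / 30 * n ^ 3 \<le> real (card (triples v))" by simp
  then show ?thesis unfolding n_def .
qed

lemma near_cases:
  assumes "u \<in> V" "v \<in> V" "w \<in> V"
  shows "near u v \<or> near u w \<or> near v w"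
  unfolding near_def
proof (rule three_large_sets[where X = "V \<times> V \<times> V" and a = "11 / 30 * (real (card V)) ^ 3"])
  show "finite (V \<times> V \<times> V)" using finV by simp
  show "real (card (V \<times> V \<times> V)) + 3 * (real (card V) ^ 3 / 30) \<le> 3 * (11 / 30 * real (card V) ^ 3)"
    by (simp add: card_cartesian_product power3_eq_cube)
qed (use assms triples_sub triples_card in auto)

text \<open>Two unpopular vertices are near each other: otherwise \<open>near_cases\<close> makes
  every vertex near one of them, while each is near fewer than a tenth of all vertices. So every
  unpopular vertex is near one fixed unpopular vertex.\<close>

lemma unpopular_card: "real (card (V - popular)) \<le> real (card V) / 10 + 1"
proof (cases "V - popular = {}")
  case False
  then obtain v where v: "v \<in> V" "v \<notin> popular" by blast
  have "near v w" if w: "w \<in> V" "w \<notin> popular" for w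
  proof (rule ccontr)
    assume nvw: "\<not> near v w"
    have "V \<subseteq> {u \<in> V. near v u} \<union> {u \<in> V. near w u}"
      using near_cases[OF v(1) w(1)] nvw by blast
    then have "card V \<le> card ({u \<in> V. near v u} \<union> {u \<in> V. near w u})"
      using finV by (intro card_mono) auto
    also have "\<dots> \<le> card {u \<in> V. near v u} + card {u \<in> V. near w u}" by (rule card_Un_le)
    finally have "real (card V) \<le> real (card {u \<in> V. near v u}) + real (card {u \<in> V. near w u})"
      by linarith
    then show False using v w large unfolding popular_def by auto
  qed
  then have "V - popular \<subseteq> {w \<in> V. near v w}" by auto
  then have "card (V - popular) \<le> card {w \<in> V. near v w}" using finV by (intro card_mono) auto
  then show ?thesis using v unfolding popular_def by auto
next
  case True
  show ?thesis unfolding True by simp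
qed

lemma wins_draw_pair_nbr:
  assumes p: "near_pair p p'"
    and w: "\<And>z. z \<subseteq> V \<Longrightarrow> card z = 2 \<Longrightarrow> z \<inter> (Z \<union> P \<union> N \<union> F) = {} \<Longrightarrow> p \<union> z \<in> E \<Longrightarrow> p' \<union> z \<in> E
      \<Longrightarrow> wins t P N (F \<union> z)"
  shows "wins (t + 2) P N F"
proof (rule wins_draw2[where R = "extensions V E p \<inter> extensions V E p'"])
  show "extensions V E p \<inter> extensions V E p' \<subseteq> V \<times> V" using extensions_sub by blast
  show "4 * (1 / 240) * (real (card V))\<^sup>2 \<le> real (card (extensions V E p \<inter> extensions V E p'))"
    using p unfolding near_pair_def by simp
  fix x y assume "(x, y) \<in> extensions V E p \<inter> extensions V E p'" "x \<noteq> y"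
     "{x, y} \<inter> (Z \<union> P \<union> N \<union> F) = {}"
  then show "wins t P N (F \<union> {x, y})" by (intro w) (auto simp: extensions_iff)
qed

lemma wins_draw_nbr:
  assumes ab: "near a b"
    and w: "\<And>z. z \<inter> (Z \<union> P \<union> N \<union> F) = {} \<Longrightarrow> insert a z \<in> E \<Longrightarrow> insert b z \<in> E \<Longrightarrow> wins t P N (F \<union> z)"
  shows "wins (t + 3) P N F"
proof (rule wins_draw3[where R = "triples a \<inter> triples b"])
  show "triples a \<inter> triples b \<subseteq> V \<times> V \<times> V" using triples_sub by blast
  show "8 * (1 / 240) * (real (card V)) ^ 3 \<le> real (card (triples a \<inter> triples b))"
    using ab unfolding near_def by simp
  fix x y z assume "(x, y, z) \<in> triples a \<inter> triples b" "{x, y, z} \<inter> (Z \<union> P \<union> N \<union> F) = {}"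
  then show "wins t P N (F \<union> {x, y, z})" by (intro w) (auto simp: triples_def)
qed

text \<open>A common neighbour \<open>z\<close> serves both matchings: \<open>insert a z\<close>
  joins \<open>M2\<close> and \<open>insert b z\<close> joins \<open>M1\<close>, so that
  \<open>z\<close> cancels.\<close>

lemma wins_cancel_near:
  assumes ab: "near a b" "a \<in> P" "b \<in> N" and w: "wins t (P - {a}) (N - {b}) F"
  shows "wins (t + 3) P N F"
proof (rule wins_draw_nbr[OF ab(1)])
  fix z assume z: "z \<inter> (Z \<union> P \<union> N \<union> F) = {}" "insert a z \<in> E" "insert b z \<in> E"
  show "wins t P N (F \<union> z)"
  proof (rule wins_op2[where p = "{a}" and q = z])
    show "wins t (P - {a}) (N \<union> z) (F \<union> z - z)"
    proof (rule wins_op1[where n = "insert b z" and q = "{}"])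
      have "N \<union> z - insert b z = N - {b}" "F \<union> z - z - {} = F" using z(1) by blast+
      then show "wins t (P - {a} \<union> {}) (N \<union> z - insert b z) (F \<union> z - z - {})" using w by simp
    qed (use z ab in auto)
  qed (use z ab in auto)
qed

lemma wins_replace_near:
  assumes ab: "near a b" "a \<in> P" "b \<in> F" and w: "wins t (insert b (P - {a})) N (F - {b})"
  shows "wins (t + 3) P N F"
proof (rule wins_draw_nbr[OF ab(1)])
  fix z assume z: "z \<inter> (Z \<union> P \<union> N \<union> F) = {}" "insert a z \<in> E" "insert b z \<in> E"
  show "wins t P N (F \<union> z)"
  proof (rule wins_op2[where p = "{a}" and q = z])
    show "wins t (P - {a}) (N \<union> z) (F \<union> z - z)"
    proof (rule wins_op1[where n = z and q = "{b}"])
      have "N \<union> z - z = N" "F \<union> z - z - {b} = F - {b}" using z(1) by blast+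
      then show "wins t (P - {a} \<union> {b}) (N \<union> z - z) (F \<union> z - z - {b})" using w by simp
    qed (use z ab in auto)
  qed (use z ab in auto)
qed

text \<open>Two of the pairs \<open>{n, m}\<close>, \<open>{p, b}\<close>, \<open>{b', a}\<close> have common neighbours, and each of the three cases
  trades \<open>p\<close> against one vertex of \<open>N\<close>.\<close>

lemma wins_cancel_pair:
  assumes pn: "p \<in> P" "n \<in> N" "m \<in> N" "n \<noteq> m" and PN: "P \<subseteq> V" "N \<subseteq> V" and fresh: "{a, b, b'} \<subseteq> V"
      "distinct [a, b, b']" "{a, b, b'} \<inter> (Z \<union> P \<union> N) = {}"
    and near: "near p b'" "near b b'" "near a n"
    and w: "\<And>N'. N - {n, m} \<subseteq> N' \<Longrightarrow> N' \<subseteq> V \<Longrightarrow> Suc (card N') = card N \<Longrightarrow> wins t (P - {p}) N' {}"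
  shows "wins (t + 8) P N {a, b, b'}"
proof -
  have fN: "finite N" using PN(2) finV by (rule finite_subset)
  have card_N: "Suc (Suc (card (N - {n, m}))) = card N"
  proof -
    have "card {n, m} \<le> card N" using pn fN by (intro card_mono) auto
    moreover have "card (N - {n, m}) = card N - card {n, m}" using pn by (intro card_Diff_subset) auto
    moreover have "card {n, m} = 2" using pn(4) by simp
    ultimately show ?thesis by linarith
  qed
  have w': "wins t (P - {p}) (insert c (N - {n, m})) {}" if "c \<in> V" "c \<notin> N" for c
  proof (rule w)
    show "Suc (card (insert c (N - {n, m}))) = card N" using that fN card_N by simp
    show "insert c (N - {n, m}) \<subseteq> V" using that PN by blast
  qed blast
  have wn: "wins t (P - {p}) (N - {n}) {}"
  proof (rule w)
    show "Suc (card (N - {n})) = card N" using fN pn(2) by (rule card_Suc_Diff1)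
  qed (use PN in blast)+
  have pb: "{n, m} \<subseteq> V" "card {n, m} = 2" "{p, b} \<subseteq> V" "card {p, b} = 2" "{b', a} \<subseteq> V" "card {b', a} = 2"
  proof -
    show "{n, m} \<subseteq> V" using pn(2,3) PN(2) by blast
    show "card {n, m} = 2" using pn(4) by simp
    show "{p, b} \<subseteq> V" "{b', a} \<subseteq> V" using pn(1) PN(1) fresh(1) by blast+
    have "p \<noteq> b" using pn(1) fresh(3) by blast
    then show "card {p, b} = 2" by simp
    show "card {b', a} = 2" using fresh(2) by auto
  qed
  from near_pair_cases[OF pb] show ?thesis
  proof (elim disjE)
    \<comment> \<open>\<open>{p, b} \<union> z\<close> joins \<open>M2\<close> and
      \<open>{n, m} \<union> z\<close> joins \<open>M1\<close>. The net effect is that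
      \<open>p\<close> disappears and \<open>b\<close> replaces \<open>n\<close> and
      \<open>m\<close> in \<open>N\<close>.\<close>
    assume 1: "near_pair {n, m} {p, b}"
    have "wins (t + 2) P N {b}"
    proof (rule wins_draw_pair_nbr[OF 1])
      fix z assume z: "z \<inter> (Z \<union> P \<union> N \<union> {b}) = {}" "{n, m} \<union> z \<in> E" "{p, b} \<union> z \<in> E"
      have zN: "z \<inter> N = {}" using z(1) by blast
      show "wins t P N ({b} \<union> z)"
      proof (rule wins_op2[where p = "{p}" and q = "insert b z"])
        have "{p} \<union> insert b z = {p, b} \<union> z" by auto
        then show "{p} \<union> insert b z \<in> E" using z(3) by (simp only:)
        show "wins t (P - {p}) (N \<union> insert b z) ({b} \<union> z - insert b z)"
        proof (rule wins_op1[where n = "{n, m} \<union> z" and q = "{}"])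
          have "b \<notin> N" using fresh(3) by blast
          then have "N \<union> insert b z - ({n, m} \<union> z) = insert b (N - {n, m})"
            using zN z(1) pn(2,3) by blast
          moreover have "{b} \<union> z - insert b z - {} = {}" by simp
          ultimately
          show "wins t (P - {p} \<union> {}) (N \<union> insert b z - ({n, m} \<union> z)) ({b} \<union> z - insert b z - {})"
            using w'[of b] \<open>b \<notin> N\<close> fresh(1) by simp
          show "{n, m} \<union> z \<subseteq> N \<union> insert b z" using pn(2,3) by blast
          show "{n, m} \<union> z \<union> {} \<in> E" using z(2) by simp
        qed simp
      qed (use pn in auto)
    qed
    then show ?thesis by (rule wins_mono[OF wins_drop]) auto
  next
    \<comment> \<open>\<open>{b', a} \<union> z\<close> in \<open>M2\<close> and
      \<open>{n, m} \<union> z\<close> in \<open>M1\<close> replace \<open>n, m\<close> by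
      \<open>b', a\<close> in \<open>N\<close>; then \<open>p\<close> is cancelled against the near
      vertex \<open>b'\<close>, and \<open>a\<close> remains.\<close>
    assume 2: "near_pair {n, m} {b', a}"
    have "wins (t + 3 + 2) P N {b', a}"
    proof (rule wins_draw_pair_nbr[OF 2])
      fix z assume z: "z \<inter> (Z \<union> P \<union> N \<union> {b', a}) = {}" "{n, m} \<union> z \<in> E" "{b', a} \<union> z \<in> E"
      show "wins (t + 3) P N ({b', a} \<union> z)"
      proof (rule wins_op2[where p = "{}" and q = "{b', a} \<union> z"])
        show "wins (t + 3) (P - {}) (N \<union> ({b', a} \<union> z)) ({b', a} \<union> z - ({b', a} \<union> z))"
        proof (rule wins_op1[where n = "{n, m} \<union> z" and q = "{}"])
          have ba: "b' \<notin> N" "a \<notin> N" using fresh(3) by blast+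
          then have eq: "N \<union> ({b', a} \<union> z) - ({n, m} \<union> z) = {b', a} \<union> (N - {n, m})"
            using z(1) pn(2,3) by blast
          have eq2: "{b', a} \<union> z - ({b', a} \<union> z) - {} = {}" "P - {} \<union> {} = P" by simp_all
          have "wins (t + 3) P ({b', a} \<union> (N - {n, m})) {}"
          proof (rule wins_cancel_near[OF near(1) pn(1)])
            have "b' \<noteq> a" using fresh(2) by auto
            then have "{b', a} \<union> (N - {n, m}) - {b'} = insert a (N - {n, m})" using ba by blast
            then show "wins t (P - {p}) ({b', a} \<union> (N - {n, m}) - {b'}) {}"
              using w'[of a] ba(2) fresh(1) by simp
          qed simp
          then show "wins (t + 3) (P - {} \<union> {}) (N \<union> ({b', a} \<union> z) - ({n, m} \<union> z))
              ({b', a} \<union> z - ({b', a} \<union> z) - {})"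
            unfolding eq eq2 .
          show "{n, m} \<union> z \<subseteq> N \<union> ({b', a} \<union> z)" using pn(2,3) by blast
          show "{n, m} \<union> z \<union> {} \<in> E" using z(2) by simp
        qed simp
        show "{} \<union> ({b', a} \<union> z) \<in> E" using z(3) by simp
      qed simp_all
    qed
    then show ?thesis by (rule wins_mono[OF wins_drop]) auto
  next
    \<comment> \<open>\<open>{p, b} \<union> z\<close> in \<open>M2\<close> and
      \<open>{b', a} \<union> z\<close> in \<open>M1\<close> replace \<open>p\<close> by
      \<open>b', a\<close> in \<open>P\<close> and add \<open>b\<close> to \<open>N\<close>; then
      \<open>b'\<close> is cancelled against \<open>b\<close>, and \<open>a\<close> against
      \<open>n\<close>.\<close>
    assume 3: "near_pair {p, b} {b', a}"
    have "wins (t + 3 + 3 + 2) P N {a, b, b'}"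
    proof (rule wins_draw_pair_nbr[OF 3])
      fix z assume z: "z \<inter> (Z \<union> P \<union> N \<union> {a, b, b'}) = {}" "{p, b} \<union> z \<in> E" "{b', a} \<union> z \<in> E"
      show "wins (t + 3 + 3) P N ({a, b, b'} \<union> z)"
      proof (rule wins_op2[where p = "{p}" and q = "insert b z"])
        have "{p} \<union> insert b z = {p, b} \<union> z" by auto
        then show "{p} \<union> insert b z \<in> E" using z(2) by (simp only:)
        show "wins (t + 3 + 3) (P - {p}) (N \<union> insert b z) ({a, b, b'} \<union> z - insert b z)"
        proof (rule wins_op1[where n = z and q = "{b', a}"])
          show "z \<union> {b', a} \<in> E" using z(3) by (simp only: Un_commute)
          have eq: "N \<union> insert b z - z = insert b N" using z(1) by blast
          have eq2: "{a, b, b'} \<union> z - insert b z - {b', a} = {}" by blast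
          have ab: "a \<notin> P" "b' \<notin> P" "b \<notin> N" using fresh(3) by blast+
          have ab': "a \<noteq> b'" "b' \<noteq> a" using fresh(2) by auto
          have "wins (t + 3 + 3) (P - {p} \<union> {b', a}) (insert b N) {}"
          proof (rule wins_cancel_near[where a = b' and b = b])
            show "near b' b" using near(2) near_sym by blast
            have eq': "P - {p} \<union> {b', a} - {b'} = insert a (P - {p})" "insert b N - {b} = N"
              using ab ab' by blast+
            have "wins (t + 3) (insert a (P - {p})) N {}"
            proof (rule wins_cancel_near[OF near(3) _ pn(2)])
              have "insert a (P - {p}) - {a} = P - {p}" using ab(1) by blast
              then show "wins t (insert a (P - {p}) - {a}) (N - {n}) {}" using wn by simp
            qed simp
            then show "wins (t + 3) (P - {p} \<union> {b', a} - {b'}) (insert b N - {b}) {}" unfolding eq' .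
          qed auto
          then show "wins (t + 3 + 3) (P - {p} \<union> {b', a}) (N \<union> insert b z - z)
             ({a, b, b'} \<union> z - insert b z - {b', a})" unfolding eq eq2 .
          have "b \<noteq> b'" "a \<noteq> b" using fresh(2) by auto
          then show "{b', a} \<subseteq> {a, b, b'} \<union> z - insert b z" using z(1) by blast
        qed blast
      qed (use pn(1) in blast)+
    qed
    then show ?thesis by (rule wins_mono) simp
  qed
qed

text \<open>If many \<open>x\<close> are near both \<open>p\<close> and \<open>n\<close>, then
  \<open>p\<close> is replaced by \<open>x\<close>, which is cancelled against \<open>n\<close>.
  Otherwise at least a twentieth of the vertices are near \<open>p\<close> but not \<open>n\<close>,
  and as many near \<open>n\<close> but not \<open>p\<close>. Two vertices \<open>b, b'\<close> of
  the first kind are near each other, because neither is near \<open>n\<close>; with some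
  \<open>a\<close> of the second kind they meet the requirements of
  \<open>wins_cancel_pair\<close>.\<close>

lemma wins_cancel:
  assumes pn: "p \<in> P" "n \<in> N" "m \<in> N" "n \<noteq> m" and PN: "P \<subseteq> V" "N \<subseteq> V"
    and pop: "p \<in> popular" "n \<in> popular"
    and w: "\<And>N'. N - {n, m} \<subseteq> N' \<Longrightarrow> N' \<subseteq> V \<Longrightarrow> Suc (card N') = card N \<Longrightarrow> wins t (P - {p}) N' {}"
  shows "wins (t + 11) P N {}"
proof (cases "real (card V) / 20 \<le> real (card {x \<in> V. near p x \<and> near x n})")
  case True
  have fN: "finite N" using PN(2) finV by (rule finite_subset)
  have wn: "wins t (P - {p}) (N - {n}) {}"
  proof (rule w)
    show "Suc (card (N - {n})) = card N" using fN pn(2) by (rule card_Suc_Diff1)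
  qed (use PN in blast)+
  have "wins (Suc (t + 3 + 3)) P N {}"
  proof (rule wins_draw1[where Y = "{x \<in> V. near p x \<and> near x n}"])
    show "2 * (1 / 240) * real (card V) \<le> real (card {x \<in> V. near p x \<and> near x n})"
      using True by simp
    fix x assume x: "x \<in> {x \<in> V. near p x \<and> near x n}" "x \<notin> Z \<union> P \<union> N \<union> {}"
    show "wins (t + 3 + 3) P N {x}"
    proof (rule wins_replace_near[of p x])
      have "wins (t + 3) (insert x (P - {p})) N {}"
      proof (rule wins_cancel_near[of x n])
        have "insert x (P - {p}) - {x} = P - {p}" using x by auto
        then show "wins t (insert x (P - {p}) - {x}) (N - {n}) {}" using wn by simp
      qed (use x pn in auto)
      then show "wins (t + 3) (insert x (P - {p})) N ({x} - {x})" by simp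
    qed (use x pn in auto)
  qed auto
  then show ?thesis by (rule wins_mono) simp
next
  case False
  define A where "A = {x \<in> V. near n x \<and> \<not> near p x}"
  define B' where "B' = {x \<in> V. near p x \<and> \<not> near n x}"
  have split: "real (card {x \<in> V. near u x}) \<le>
      real (card {x \<in> V. near u x \<and> \<not> near v x}) + real (card {x \<in> V. near p x \<and> near x n})"
    if "{u, v} = {p, n}" for u v
  proof -
    have "u = p \<and> v = n \<or> u = n \<and> v = p" using that by (simp add: doubleton_eq_iff)
    then have "near u x \<and> near v x \<longleftrightarrow> near p x \<and> near x n" for x
      using near_sym[of n x] by blast
    then have "{x \<in> V. near u x} = {x \<in> V. near u x \<and> \<not> near v x} \<union> {x \<in> V. near p x \<and> near x n}"
      by blast
    then have "card {x \<in> V. near u x} =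
        card ({x \<in> V. near u x \<and> \<not> near v x} \<union> {x \<in> V. near p x \<and> near x n})"
      by (rule arg_cong)
    also have "\<dots> \<le> card {x \<in> V. near u x \<and> \<not> near v x} + card {x \<in> V. near p x \<and> near x n}"
      by (rule card_Un_le)
    finally have "card {x \<in> V. near u x} \<le>
        card {x \<in> V. near u x \<and> \<not> near v x} + card {x \<in> V. near p x \<and> near x n}" .
    then show ?thesis by linarith
  qed
  have cA: "real (card V) / 20 \<le> real (card A)"
  proof -
    have "real (card V) / 10 \<le> real (card {x \<in> V. near n x})" using pop(2) unfolding popular_def by simp
    moreover have "{n, p} = {p, n}" by auto
    ultimately show ?thesis using split[of n p] False unfolding A_def by simp
  qed
  have cB: "real (card V) / 20 \<le> real (card B')"
  proof -
    have "real (card V) / 10 \<le> real (card {x \<in> V. near p x})" using pop(1) unfolding popular_def by simp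
    then show ?thesis using split[of p n, OF refl] False unfolding B'_def by simp
  qed
  have AV: "A \<subseteq> V" "B' \<subseteq> V" unfolding A_def B'_def by blast+
  have "wins (Suc (Suc (Suc (t + 8)))) P N {}"
  proof (rule wins_draw1[OF AV(2)])
    show "2 * (1 / 240) * real (card V) \<le> real (card B')" using cB by simp
    fix b' assume b': "b' \<in> B'" "b' \<notin> Z \<union> P \<union> N \<union> {}"
    show "wins (Suc (Suc (t + 8))) P N {b'}"
    proof (rule wins_draw1[OF AV(2)])
      show "2 * (1 / 240) * real (card V) \<le> real (card B')" using cB by simp
      fix b assume b: "b \<in> B'" "b \<notin> Z \<union> P \<union> N \<union> {b'}"
      show "wins (Suc (t + 8)) P N {b, b'}"
      proof (rule wins_draw1[OF AV(1)])
        show "2 * (1 / 240) * real (card V) \<le> real (card A)" using cA by simp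
        fix a assume a: "a \<in> A" "a \<notin> Z \<union> P \<union> N \<union> {b, b'}"
        show "wins (t + 8) P N {a, b, b'}"
        proof (rule wins_cancel_pair[OF pn PN])
          fix N' assume "N - {n, m} \<subseteq> N'" "N' \<subseteq> V" "Suc (card N') = card N"
          then show "wins t (P - {p}) N' {}" by (rule w)
        next
          show "near p b'" using b'(1) unfolding B'_def by simp
          have "b \<in> V" "b' \<in> V" "\<not> near n b" "\<not> near n b'" using b(1) b'(1) unfolding B'_def by simp_all
          moreover have "n \<in> V" using pn(2) PN(2) by blast
          ultimately show "near b b'"
            using near_cases[of b b' n] near_sym[of b n] near_sym[of b' n] by blast
          show "near a n" using a(1) near_sym[of a n] unfolding A_def by blast
          show "{a, b, b'} \<subseteq> V" using a(1) b(1) b'(1) AV by blast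
          show "distinct [a, b, b']" using a(2) b(2) by auto
          show "{a, b, b'} \<inter> (Z \<union> P \<union> N) = {}" using a(2) b(2) b'(2) by blast
        qed
      qed
    qed
  qed
  then show ?thesis by (rule wins_mono) simp
qed

text \<open>Unpopular vertices spoil about \<open>n^2 / 5\<close> ordered pairs, which is only half
  of the guaranteed \<open>2 / 5 * n^2\<close>.\<close>

lemma wins_extend_popular:
  assumes S: "S \<subseteq> V" "card S = 2"
    and w: "\<And>q. q \<subseteq> popular \<Longrightarrow> card q = 2 \<Longrightarrow> q \<inter> (Z \<union> P \<union> N \<union> F) = {} \<Longrightarrow> S \<union> q \<in> E \<Longrightarrow> wins t P N (F \<union> q)"
  shows "wins (t + 2) P N F"
proof -
  define R where "R = extensions V E S - {p \<in> V \<times> V. fst p \<in> V - popular \<or> snd p \<in> V - popular}"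
  have RV: "R \<subseteq> V \<times> V" unfolding R_def using extensions_sub by blast
  define n where "n = real (card V)"
  have n: "40 \<le> n" using large unfolding n_def by simp
  let ?D = "{p \<in> V \<times> V. fst p \<in> V - popular \<or> snd p \<in> V - popular}"
  have "finite ?D" using finV by simp
  then have "card (extensions V E S) - card ?D \<le> card R"
    unfolding R_def by (rule diff_card_le_card_Diff)
  moreover have "card ?D \<le> 2 * card (V - popular) * card V"
    using finV by (intro card_times_subset_le) auto
  ultimately have "card (extensions V E S) \<le> card R + 2 * card (V - popular) * card V" by linarith
  then have "real (card (extensions V E S)) \<le> real (card R) + 2 * real (card (V - popular)) * n"
  proof -
    assume "card (extensions V E S) \<le> card R + 2 * card (V - popular) * card V"
    then have "real (card (extensions V E S)) \<le> real (card R + 2 * card (V - popular) * card V)"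
      by (rule of_nat_mono)
    then show ?thesis unfolding n_def by simp
  qed
  moreover have "2 * real (card (V - popular)) * n \<le> 2 * (n / 10 + 1) * n"
    using unpopular_card n unfolding n_def[symmetric] by (intro mult_right_mono mult_left_mono) simp_all
  moreover have "2 / 5 * n\<^sup>2 \<le> real (card (extensions V E S))"
    unfolding n_def using S by (intro extensions_card) auto
  moreover have "2 / 5 * n\<^sup>2 - 2 * (n / 10 + 1) * n - 4 * (1 / 240) * n\<^sup>2 = n * (11 / 60 * n - 2)"
    by (simp add: field_simps power2_eq_square)
  moreover have "n * (11 / 60 * n - 2) \<ge> 0" using n by simp
  ultimately have "4 * (1 / 240) * n\<^sup>2 \<le> real (card R)" by linarith
  then have "4 * (1 / 240) * (real (card V))\<^sup>2 \<le> real (card R)" unfolding n_def .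
  with RV show ?thesis
  proof (rule wins_draw2)
    fix x y assume xy: "(x, y) \<in> R" "x \<noteq> y" "{x, y} \<inter> (Z \<union> P \<union> N \<union> F) = {}"
    then have "{x, y} \<subseteq> popular" "S \<union> {x, y} \<in> E" unfolding R_def by (auto simp: extensions_iff)
    then show "wins t P N (F \<union> {x, y})" using xy by (intro w) auto
  qed
qed

text \<open>The size pairs \<open>(|P|, |N|)\<close> are (0, 6), (2, 4), (1, 3), (0, 2), (2,
  0).\<close>

lemma wins_from_N6:
  assumes N: "N \<subseteq> popular" "card N = 6"
  shows "wins 26 {} N {}"
proof -
  have pV: "popular \<subseteq> V" unfolding popular_def by auto
  have fN: "finite N" using N by (intro card_ge_0_finite) simp
  obtain S where S: "S \<subseteq> N" "card S = 2"
  proof -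
    have "2 \<le> card N" using N(2) by simp
    then show ?thesis using that by (meson obtain_subset_with_card_n)
  qed
  have fS: "finite S" using S fN finite_subset by blast
  have "wins (24 + 2) {} N {}"
  proof (rule wins_extend_popular[where S = S])
    show "S \<subseteq> V" "card S = 2" using S N pV by auto
    fix q assume q: "q \<subseteq> popular" "card q = 2" "q \<inter> (Z \<union> {} \<union> N \<union> {}) = {}" "S \<union> q \<in> E"
    show "wins 24 {} N ({} \<union> q)"
    proof (rule wins_op1[where n = S and q = q])
      have c4: "card (N - S) = 4" using card_Diff_subset[OF fS S(1)] S N by simp
      \<comment> \<open>The four vertices are split into two pairs in advance. A cancellation may
        leave a vertex in \<open>N\<close> that is not popular, so the second one works with
        \<open>n2\<close> and \<open>m2\<close>, which survive the first.\<close>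
      obtain xs where xs: "set xs = N - S" "distinct xs"
        using finite_distinct_list[of "N - S"] fN by auto
      then have "length xs = 4" using c4 distinct_card by fastforce
      then obtain n1 m1 n2 m2 where "xs = [n1, m1, n2, m2]"
        by (auto simp: numeral_eq_Suc length_Suc_conv)
      then have nm: "N - S = {n1, m1, n2, m2}" "distinct [n1, m1, n2, m2]" using xs by auto
      obtain p1 p2 where p: "q = {p1, p2}" "p1 \<noteq> p2" using q(2) by (auto simp: card_2_iff)
      have NSV: "N - S \<subseteq> V" "N - S \<subseteq> popular" "q \<subseteq> V" using N pV q(1) by auto
      have nm': "n1 \<in> N - S" "m1 \<in> N - S" "n2 \<in> N - S" "n1 \<noteq> m1" "n2 \<noteq> m2" using nm by auto
      have pp: "p1 \<in> q" "p2 \<in> q - {p1}" "p1 \<in> popular" "p2 \<in> popular" using p q(1) by auto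
      have nn: "n1 \<in> popular" "n2 \<in> popular" using nm' NSV(2) by blast+
      have "wins (2 + 11 + 11) q (N - S) {}"
      proof (rule wins_cancel[of p1 q n1 "N - S" m1])
        fix N1 assume N1: "N - S - {n1, m1} \<subseteq> N1" "N1 \<subseteq> V" "Suc (card N1) = card (N - S)"
        show "wins (2 + 11) (q - {p1}) N1 {}"
        proof (rule wins_cancel[of p2 _ n2 N1 m2])
          have "{n2, m2} \<subseteq> N - S - {n1, m1}" unfolding nm(1) using nm(2) by auto
          then show "n2 \<in> N1" "m2 \<in> N1" using N1(1) by blast+
          show "q - {p1} \<subseteq> V" using NSV(3) by blast
          fix N2 assume N2': "N1 - {n2, m2} \<subseteq> N2" and N2: "N2 \<subseteq> V" "Suc (card N2) = card N1"
          have c2: "card N2 = 2" using N2 N1 c4 by simp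
          have qe: "q - {p1} - {p2} = {}" using p by auto
          have "wins (0 + 2) {} N2 {}"
          proof (rule wins_extend[where S = N2])
            fix r assume r: "r \<subseteq> V" "card r = 2" "r \<inter> (Z \<union> {} \<union> N2 \<union> {}) = {}" "N2 \<union> r \<in> E"
            show "wins 0 {} N2 ({} \<union> r)"
              by (rule wins_op1[where n = N2 and q = r]) (use r wins_end in auto)
          qed (use N2 c2 in auto)
          then show "wins 2 (q - {p1} - {p2}) N2 {}" unfolding qe by (simp only: add_0_left)
        qed (rule pp nm' nn N1(2))+
      qed (rule pp nm' nn NSV)+
      moreover have "{} \<union> q = q" "{} \<union> q - q = {}" by auto
      ultimately show "wins 24 ({} \<union> q) (N - S) ({} \<union> q - q)" by simp
    qed (use S q in auto)
  qed
  then show ?thesis by simp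
qed

lemma wins_move:
  assumes P: "P \<subseteq> V" "2 \<le> card P"
    and w: "\<And>P' N'. P' \<subseteq> P \<Longrightarrow> card P' + 2 = card P \<Longrightarrow> N' \<subseteq> popular \<Longrightarrow> card N' = card N + 2 \<Longrightarrow> wins t P' N' {}"
    and N: "N \<subseteq> popular"
  shows "wins (t + 2) P N {}"
proof -
  have pV: "popular \<subseteq> V" unfolding popular_def by auto
  have fin: "finite P" "finite N"
    using finite_subset[OF P(1) finV] finite_subset[OF subset_trans[OF N pV] finV] by simp_all
  obtain S where S: "S \<subseteq> P" "card S = 2"
    using P(2) by (meson obtain_subset_with_card_n)
  have fS: "finite S" using S fin finite_subset by blast
  show ?thesis
  proof (rule wins_extend_popular[where S = S])
    show "S \<subseteq> V" "card S = 2" using S P by auto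
    fix q assume q: "q \<subseteq> popular" "card q = 2" "q \<inter> (Z \<union> P \<union> N \<union> {}) = {}" "S \<union> q \<in> E"
    have fq: "finite q" using q by (intro card_ge_0_finite) simp
    show "wins t P N ({} \<union> q)"
    proof (rule wins_op2[where p = S and q = q])
      have "wins t (P - S) (N \<union> q) {}"
      proof (rule w)
        show "card (P - S) + 2 = card P" using card_Diff_subset[OF fS S(1)] S P by simp
        have "N \<inter> q = {}" using q(3) by auto
        then show "card (N \<union> q) = card N + 2" using card_Un_disjoint[OF fin(2) fq] q by simp
      qed (use N q in auto)
      then show "wins t (P - S) (N \<union> q) ({} \<union> q - q)" by simp
    qed (use S q in auto)
  qed
qed

text \<open>\<open>U\<close> may contain unpopular vertices, which cannot be cancelled directly.
  Three moves, with size pairs (6, 0), (4, 2), (2, 4), (0, 6), trade it for six popular vertices in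
  \<open>N\<close>.\<close>

lemma wins_start_4: "wins 32 U {} {}"
proof -
  have "wins (26 + 2 + 2 + 2) U {} {}"
  proof (rule wins_move)
    fix P1 N1 assume 1: "P1 \<subseteq> U" "card P1 + 2 = card U" "N1 \<subseteq> popular" "card N1 = card ({} :: 'a set) + 2"
    show "wins (26 + 2 + 2) P1 N1 {}"
    proof (rule wins_move)
      fix P2 N2 assume 2: "P2 \<subseteq> P1" "card P2 + 2 = card P1" "N2 \<subseteq> popular" "card N2 = card N1 + 2"
      show "wins (26 + 2) P2 N2 {}"
      proof (rule wins_move)
        fix P3 N3 assume 3: "P3 \<subseteq> P2" "card P3 + 2 = card P2" "N3 \<subseteq> popular" "card N3 = card N2 + 2"
        have "P3 \<subseteq> V" using 1(1) 2(1) 3(1) UV by blast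
        then have "finite P3" using finV by (rule finite_subset)
        moreover have "card P3 = 0" using 1 2 3 cardU by simp
        ultimately have "P3 = {}" by simp
        moreover have "card N3 = 6" using 1 2 3 by simp
        ultimately show "wins 26 P3 N3 {}" using wins_from_N6[OF 3(3)] by simp
      qed (use 1 2 UV cardU in auto)
    qed (use 1 UV cardU in auto)
  qed (use UV cardU in auto)
  then show ?thesis by simp
qed

end

section \<open>Absorbing families\<close>

lemma dense_kgraph_mono: "dense_kgraph k \<alpha> V E \<Longrightarrow> \<beta> \<le> \<alpha> \<Longrightarrow> dense_kgraph k \<beta> V E"
  unfolding dense_kgraph_def
  by (meson mult_right_mono order_trans zero_le_power2)

lemma (in absorber_game) count_absorbers:
  assumes "wins t U {} {}" "t \<le> B" "Z' \<subseteq> Z"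
  shows "(\<rho> * real (card V)) ^ t \<le>
    real (card {xs. set xs \<subseteq> V \<and> length xs = t \<and> (\<exists>M. absorbs E U M \<and> \<Union>M \<subseteq> set xs - Z')})"
proof -
  have "(\<rho> * real (card V)) ^ t \<le> real (card {xs. set xs \<subseteq> V \<and> length xs = t \<and> absorbed_in (set xs \<union> {})})"
    using finV rho(1) wins_start[OF assms(1,2)] by (intro robust_count) auto
  also have "card {xs. set xs \<subseteq> V \<and> length xs = t \<and> absorbed_in (set xs \<union> {})} \<le>
      card {xs. set xs \<subseteq> V \<and> length xs = t \<and> (\<exists>M. absorbs E U M \<and> \<Union>M \<subseteq> set xs - Z')}"
  proof (rule card_mono)
    show "finite {xs. set xs \<subseteq> V \<and> length xs = t \<and> (\<exists>M. absorbs E U M \<and> \<Union>M \<subseteq> set xs - Z')}"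
      by (rule finite_subset[OF _ finite_lists_length_eq[OF finV, of t]]) auto
    have "\<exists>M. absorbs E U M \<and> \<Union>M \<subseteq> set xs - Z'" if xs: "absorbed_in (set xs)" for xs
    proof -
      obtain M where M: "absorbs E U M" "\<Union>M \<subseteq> set xs - Z" using xs unfolding absorbed_in_def by auto
      have "\<Union>M \<subseteq> set xs - Z'" using M(2) Diff_mono[OF subset_refl assms(3)] by (rule order_trans)
      then show ?thesis using M(1) by (intro exI conjI)
    qed
    then show "{xs. set xs \<subseteq> V \<and> length xs = t \<and> absorbed_in (set xs \<union> {})} \<subseteq>
       {xs. set xs \<subseteq> V \<and> length xs = t \<and> (\<exists>M. absorbs E U M \<and> \<Union>M \<subseteq> set xs - Z')}"
      by auto
  qed
  finally show ?thesis by simp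
qed

definition has_many_absorbers :: "nat \<Rightarrow> real \<Rightarrow> nat \<Rightarrow> 'a set \<Rightarrow> 'a set set \<Rightarrow> bool" where
  "has_many_absorbers k \<rho> t V E \<longleftrightarrow> (\<forall>U Z. U \<subseteq> V \<longrightarrow> card U = k + 2 \<longrightarrow> Z \<subseteq> V \<longrightarrow>
     real (card Z) \<le> \<rho> * real (card V) \<longrightarrow>
     (\<rho> * real (card V)) ^ t \<le>
       real (card {xs. set xs \<subseteq> V \<and> length xs = t \<and> (\<exists>M. absorbs E U M \<and> \<Union>M \<subseteq> set xs - Z)}))"

text \<open>Half of \<open>\<rho>\<close> is reserved for \<open>U\<close>, which the draws avoid as
  well, and for the \<open>t\<close> drawn vertices themselves.\<close>

lemma has_many_absorbers_halve:
  assumes V: "finite V" and \<rho>: "0 < \<rho>" and n: "real (k + 2 + t) \<le> \<rho> / 2 * real (card V)"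
    and count: "\<And>U Z. U \<subseteq> V \<Longrightarrow> card U = k + 2 \<Longrightarrow> Z \<subseteq> V \<Longrightarrow>
      real (card (Z \<union> U) + t) \<le> \<rho> * real (card V) \<Longrightarrow>
      (\<rho> * real (card V)) ^ t \<le>
       real (card {xs. set xs \<subseteq> V \<and> length xs = t \<and> (\<exists>M. absorbs E U M \<and> \<Union>M \<subseteq> set xs - Z)})"
  shows "has_many_absorbers k (\<rho> / 2) t V E"
  unfolding has_many_absorbers_def
proof (intro allI impI)
  fix U Z assume UZ: "U \<subseteq> V" "card U = k + 2" "Z \<subseteq> V" "real (card Z) \<le> \<rho> / 2 * real (card V)"
  have "real (card (Z \<union> U) + t) \<le> real (card Z) + real (k + 2 + t)"
    using card_Un_le[of Z U] UZ(2) by simp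
  also have "\<dots> \<le> \<rho> * real (card V)" using n UZ(4) by simp
  finally have le: "real (card (Z \<union> U) + t) \<le> \<rho> * real (card V)" .
  have "(\<rho> / 2 * real (card V)) ^ t \<le> (\<rho> * real (card V)) ^ t"
    using \<rho> by (intro power_mono) (auto simp: field_simps)
  also have "\<dots> \<le> real (card {xs. set xs \<subseteq> V \<and> length xs = t \<and> (\<exists>M. absorbs E U M \<and> \<Union>M \<subseteq> set xs - Z)})"
    using UZ(1-3) le by (rule count)
  finally show "(\<rho> / 2 * real (card V)) ^ t \<le>
      real (card {xs. set xs \<subseteq> V \<and> length xs = t \<and> (\<exists>M. absorbs E U M \<and> \<Union>M \<subseteq> set xs - Z)})" .
qed

lemma many_absorbers:
  fixes \<alpha> :: real
  assumes k: "4 \<le> k" and \<alpha>: "0 < \<alpha>" "k = 4 \<Longrightarrow> 2 / 5 \<le> \<alpha>"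
  shows "\<exists>\<rho> t n0. 0 < \<rho> \<and> \<rho> \<le> 1 \<and>
    (\<forall>(V :: 'a set) E. n0 \<le> card V \<longrightarrow> dense_kgraph k \<alpha> V E \<longrightarrow> has_many_absorbers k \<rho> t V E)"
proof (cases "k = 4")
  case True
  obtain n0 :: nat where n0: "real (k + 2 + 32) / (1 / 240 / 2) \<le> real n0" using real_arch_simple by blast
  have "has_many_absorbers k (1 / 240 / 2) 32 V E"
    if n: "max n0 40 \<le> card V" and d: "dense_kgraph k \<alpha> V E" for V :: "'a set" and E
  proof (rule has_many_absorbers_halve)
    have kg: "kgraph 4 V E" using d True unfolding dense_kgraph_def by simp
    have d': "dense_kgraph 4 (2 / 5) V E" using dense_kgraph_mono[OF d] \<alpha>(2) True by simp
    show fV: "finite V" using kg unfolding kgraph_def by simp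
    show "real (k + 2 + 32) \<le> 1 / 240 / 2 * real (card V)" using n n0 by (simp add: field_simps)
    fix U Z assume UZ: "U \<subseteq> V" "card U = k + 2" "Z \<subseteq> V" "real (card (Z \<union> U) + 32) \<le> 1 / 240 * real (card V)"
    interpret quadruple_game V U "Z \<union> U" E 32
      by unfold_locales (use UZ kg d' n True in auto)
    show "(1 / 240 * real (card V)) ^ 32
       \<le> real (card {xs. set xs \<subseteq> V \<and> length xs = 32 \<and> (\<exists>M. absorbs E U M \<and> \<Union>M \<subseteq> set xs - Z)})"
      by (rule count_absorbers[OF wins_start_4]) auto
  qed simp
  then show ?thesis by (intro exI[of _ "1 / 240 / 2"] exI[of _ 32] exI[of _ "max n0 40"]) auto
next
  case False
  then have k5: "5 \<le> k" using k by simp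
  \<comment> \<open>\<open>\<alpha> / 4\<close> is dictated by drawing extensions,
    \<open>1 / 2\<close> by drawing fillers.\<close>
  define \<rho> where "\<rho> = min (\<alpha> / 4) (1 / 2)"
  have \<rho>: "0 < \<rho>" "\<rho> \<le> 1" "2 * \<rho> \<le> 1" "4 * \<rho> \<le> \<alpha>" using \<alpha> unfolding \<rho>_def by auto
  obtain n0 :: nat where n0: "real (k + 2 + 2 * k) / (\<rho> / 2) \<le> real n0" using real_arch_simple by blast
  have "has_many_absorbers k (\<rho> / 2) (2 * k) V E"
    if n: "n0 \<le> card V" and d: "dense_kgraph k \<alpha> V E" for V :: "'a set" and E
  proof (rule has_many_absorbers_halve)
    have kg: "kgraph k V E" using d unfolding dense_kgraph_def by simp
    show fV: "finite V" using kg unfolding kgraph_def by simp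
    show "0 < \<rho>" by (rule \<rho>)
    have "real (k + 2 + 2 * k) / (\<rho> / 2) \<le> real (card V)" using n n0 by linarith
    then show "real (k + 2 + 2 * k) \<le> \<rho> / 2 * real (card V)" using \<rho>(1) by (simp add: field_simps)
    fix U Z assume UZ: "U \<subseteq> V" "card U = k + 2" "Z \<subseteq> V" "real (card (Z \<union> U) + 2 * k) \<le> \<rho> * real (card V)"
    interpret dense_absorber_game k V U "Z \<union> U" E \<rho> "2 * k" \<alpha>
      by unfold_locales (use UZ kg d k \<rho> in auto)
    show "(\<rho> * real (card V)) ^ (2 * k)
       \<le> real (card {xs. set xs \<subseteq> V \<and> length xs = 2 * k \<and> (\<exists>M. absorbs E U M \<and> \<Union>M \<subseteq> set xs - Z)})"
      by (rule count_absorbers[OF wins_start_ge5[OF k5 \<rho>(3)]]) auto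
  qed
  then show ?thesis using \<rho> by (intro exI[of _ "\<rho> / 2"] exI[of _ "2 * k"] exI[of _ n0]) auto
qed

section \<open>Greedy choice of absorbers\<close>

lemma exists_above_average:
  fixes f :: "'a \<Rightarrow> real"
  assumes "finite A" "A \<noteq> {}" "b * real (card A) \<le> (\<Sum>x\<in>A. f x)"
  shows "\<exists>x\<in>A. b \<le> f x"
proof (rule ccontr)
  assume "\<not> ?thesis"
  then have "(\<Sum>x\<in>A. f x) < (\<Sum>x\<in>A. b)" using assms(1,2) by (intro sum_strict_mono) auto
  then show False using assms(3) by (simp add: mult.commute)
qed

text \<open>Averaging twice. Some tuple \<open>xs\<close> contains absorbers for a proportion
  \<open>\<rho> ^ t\<close> of \<open>W\<close>; its at most \<open>t\<close> vertices carry at most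
  \<open>2 ^ 2 ^ t\<close> set families, and one of these absorbs its share.\<close>

lemma popular_absorber:
  assumes kg: "kgraph k V E" and many: "has_many_absorbers k \<rho> t V E" and V: "V \<noteq> {}" and \<rho>: "0 < \<rho>"
    and W: "\<And>U. U \<in> W \<Longrightarrow> U \<subseteq> V \<and> card U = k + 2" and Z: "Z \<subseteq> V" "real (card Z) \<le> \<rho> * real (card V)"
  shows "\<exists>M. matching E M \<and> \<Union>M \<inter> Z = {} \<and> card (\<Union>M) \<le> t \<and>
    \<rho> ^ t / 2 ^ 2 ^ t * real (card W) \<le> real (card {U \<in> W. absorbs E U M})"
proof (cases "W = {}")
  case True
  then show ?thesis by (intro exI[of _ "{}"]) (auto simp: matching_def)
next
  case False
  define n where "n = real (card V)"
  have fV: "finite V" using kg unfolding kgraph_def by simp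
  have n0: "n > 0" using V fV unfolding n_def by (simp add: card_gt_0_iff)
  have "W \<subseteq> Pow V" using W by auto
  then have fW: "finite W" using fV by (meson finite_Pow_iff finite_subset)
  define L where "L = {xs. set xs \<subseteq> V \<and> length xs = t}"
  have fL: "finite L" unfolding L_def using fV by (rule finite_lists_length_eq)
  have cL: "real (card L) = n ^ t" unfolding L_def n_def using card_lists_length_eq[OF fV] by simp
  have "L \<noteq> {}"
  proof
    assume "L = {}"
    then have "n ^ t = 0" using cL by simp
    then show False using n0 by simp
  qed
  define A where "A U xs \<longleftrightarrow> (\<exists>M. absorbs E U M \<and> \<Union>M \<subseteq> set xs - Z)" for U xs
  have "(\<rho> ^ t * real (card W)) * real (card L) = (\<Sum>U\<in>W. (\<rho> * n) ^ t)"
    unfolding cL by (simp add: power_mult_distrib)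
  also have "\<dots> \<le> (\<Sum>U\<in>W. real (card {xs \<in> L. A U xs}))"
  proof (rule sum_mono)
    fix U assume "U \<in> W"
    then have "(\<rho> * n) ^ t \<le>
       real (card {xs. set xs \<subseteq> V \<and> length xs = t \<and> (\<exists>M. absorbs E U M \<and> \<Union>M \<subseteq> set xs - Z)})"
      using many W[of U] Z unfolding has_many_absorbers_def n_def by simp
    also have "{xs. set xs \<subseteq> V \<and> length xs = t \<and> (\<exists>M. absorbs E U M \<and> \<Union>M \<subseteq> set xs - Z)} = {xs \<in> L. A U xs}"
      unfolding L_def A_def by simp
    finally show "(\<rho> * n) ^ t \<le> real (card {xs \<in> L. A U xs})" .
  qed
  also have "\<dots> = real (\<Sum>U\<in>W. \<Sum>xs\<in>L. if A U xs then 1 else 0)"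
    using sum_if_const[OF fL, where c = 1] by simp
  also have "(\<Sum>U\<in>W. \<Sum>xs\<in>L. if A U xs then 1 else 0) = (\<Sum>xs\<in>L. \<Sum>U\<in>W. if A U xs then 1 else (0 :: nat))"
    by (rule sum.swap)
  also have "real \<dots> = (\<Sum>xs\<in>L. real (card {U \<in> W. A U xs}))"
    using sum_if_const[OF fW, where c = 1] by simp
  finally obtain xs where xs: "xs \<in> L" "\<rho> ^ t * real (card W) \<le> real (card {U \<in> W. A U xs})"
    using exists_above_average[OF fL \<open>L \<noteq> {}\<close>] by meson
  define \<M> where "\<M> = Pow (Pow (set xs - Z))"
  have lenxs: "card (set xs - Z) \<le> t"
    using card_length[of xs] xs(1) card_mono[of "set xs" "set xs - Z"] unfolding L_def by auto
  have "finite \<M>" "\<M> \<noteq> {}" unfolding \<M>_def by auto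
  have "card \<M> = 2 ^ 2 ^ card (set xs - Z)" unfolding \<M>_def by (simp add: card_Pow)
  then have cM: "card \<M> \<le> 2 ^ 2 ^ t" using lenxs by (simp add: power_increasing)
  have sub: "{U \<in> W. A U xs} \<subseteq> (\<Union>M\<in>\<M>. {U \<in> W. absorbs E U M})"
  proof
    fix U assume U: "U \<in> {U \<in> W. A U xs}"
    then obtain M where "absorbs E U M" "\<Union>M \<subseteq> set xs - Z" unfolding A_def by auto
    then show "U \<in> (\<Union>M\<in>\<M>. {U \<in> W. absorbs E U M})"
      using U unfolding \<M>_def by (intro UN_I[of M]) auto
  qed
  have "card {U \<in> W. A U xs} \<le> card (\<Union>M\<in>\<M>. {U \<in> W. absorbs E U M})"
    by (rule card_mono[OF _ sub]) (use fW \<open>finite \<M>\<close> in simp)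
  also have "\<dots> \<le> (\<Sum>M\<in>\<M>. card {U \<in> W. absorbs E U M})"
    by (rule card_UN_le) fact
  finally have "\<rho> ^ t * real (card W) \<le> real (\<Sum>M\<in>\<M>. card {U \<in> W. absorbs E U M})"
    using xs(2) by linarith
  moreover have "\<rho> ^ t / 2 ^ 2 ^ t * real (card W) * real (card \<M>) \<le> \<rho> ^ t * real (card W)"
  proof -
    have "real (card \<M>) \<le> 2 ^ 2 ^ t" using cM by (metis of_nat_le_iff of_nat_numeral of_nat_power)
    then have "\<rho> ^ t / 2 ^ 2 ^ t * real (card W) * real (card \<M>) \<le> \<rho> ^ t / 2 ^ 2 ^ t * real (card W) * 2 ^ 2 ^ t"
      using \<rho> by (intro mult_left_mono) auto
    then show ?thesis by simp
  qed
  ultimately have "\<rho> ^ t / 2 ^ 2 ^ t * real (card W) * real (card \<M>) \<le> (\<Sum>M\<in>\<M>. real (card {U \<in> W. absorbs E U M}))"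
    by simp
  then obtain M where M: "M \<in> \<M>" "\<rho> ^ t / 2 ^ 2 ^ t * real (card W) \<le> real (card {U \<in> W. absorbs E U M})"
    using exists_above_average[OF \<open>finite \<M>\<close> \<open>\<M> \<noteq> {}\<close>] by meson
  \<comment> \<open>Positivity yields some \<open>U\<close> absorbed by \<open>M\<close>, and only
    from this does it follow that \<open>M\<close> is a matching.\<close>
  have "0 < \<rho> ^ t / 2 ^ 2 ^ t * real (card W)" using \<rho> False fW by (simp add: card_gt_0_iff)
  then have "{U \<in> W. absorbs E U M} \<noteq> {}" using M(2) by (metis card.empty less_le_not_le of_nat_0)
  then have "matching E M" unfolding absorbs_def by auto
  moreover have MZ: "\<Union>M \<subseteq> set xs - Z" using M(1) unfolding \<M>_def by auto
  then have "\<Union>M \<inter> Z = {}" by auto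
  moreover have "card (\<Union>M) \<le> t" using card_mono[OF _ MZ] lenxs by simp
  ultimately show ?thesis using M(2) by (intro exI conjI)
qed

text \<open>By \<open>1 - c \<le> exp (- c)\<close>, the claim follows from the decay of
  \<open>x ^ K / exp x\<close> at \<open>x = c * s\<close>.\<close>

lemma eventually_power_beats:
  fixes c A :: real
  assumes c: "0 < c" "c \<le> 1" and A: "0 \<le> A"
  shows "\<exists>s0. \<forall>s\<ge>s0. A * real (s + 1) ^ K * (1 - c) ^ s < 1"
proof -
  have lim: "((\<lambda>s. (c * real s) ^ K / exp (c * real s)) \<longlongrightarrow> 0) sequentially"
  proof (rule filterlim_compose[OF tendsto_power_div_exp_0])
    show "filterlim (\<lambda>s. c * real s) at_top sequentially"
      using c(1) by (intro filterlim_tendsto_pos_mult_at_top[OF tendsto_const _ filterlim_real_sequentially])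
  qed
  \<comment> \<open>The factor \<open>(2 / c) ^ K\<close> comes from
    \<open>s + 1 \<le> 2 * s\<close>; \<open>A + 1\<close> in place of \<open>A\<close> keeps the
    denominator positive.\<close>
  define \<delta> where "\<delta> = 1 / ((A + 1) * (2 / c) ^ K)"
  have \<delta>: "0 < \<delta>" unfolding \<delta>_def using A c by simp
  from order_tendstoD(2)[OF lim \<delta>] obtain s0 where s0: "\<And>s. s \<ge> s0 \<Longrightarrow> (c * real s) ^ K / exp (c * real s) < \<delta>"
    unfolding eventually_sequentially by blast
  have "A * real (s + 1) ^ K * (1 - c) ^ s < 1" if s: "s \<ge> max s0 1" for s
  proof -
    have "1 - c \<le> exp (- c)" using exp_ge_add_one_self[of "- c"] by simp
    then have "(1 - c) ^ s \<le> exp (- c) ^ s" using c by (intro power_mono) auto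
    also have "\<dots> = 1 / exp (c * real s)"
      by (simp add: exp_of_nat_mult[symmetric] exp_minus field_simps)
    finally have e: "(1 - c) ^ s \<le> 1 / exp (c * real s)" .
    have "real (s + 1) ^ K \<le> (2 / c * (c * real s)) ^ K"
      using c s by (intro power_mono) auto
    then have p: "real (s + 1) ^ K \<le> (2 / c) ^ K * (c * real s) ^ K" by (simp only: power_mult_distrib)
    have "A * real (s + 1) ^ K * (1 - c) ^ s \<le> (A + 1) * ((2 / c) ^ K * (c * real s) ^ K) * (1 / exp (c * real s))"
      using A c p e by (intro mult_mono) auto
    also have "\<dots> = ((A + 1) * (2 / c) ^ K) * ((c * real s) ^ K / exp (c * real s))" by simp
    also have "\<dots> < ((A + 1) * (2 / c) ^ K) * \<delta>"
      using A c s s0[of s] by (intro mult_strict_left_mono) auto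
    also have "\<dots> = 1" unfolding \<delta>_def using A c by simp
    finally show ?thesis .
  qed
  then show ?thesis by blast
qed

definition absorbing_family :: "nat \<Rightarrow> 'a set \<Rightarrow> 'a set set \<Rightarrow> 'a set set set \<Rightarrow> bool" where
  "absorbing_family k V E \<F> \<longleftrightarrow> (\<forall>U. U \<subseteq> V \<longrightarrow> card U = k + 2 \<longrightarrow> (\<exists>M\<in>\<F>. absorbs E U M))"

text \<open>Every round handles a fixed fraction of the sets that are still unabsorbed, which
  therefore decrease geometrically. What has been chosen before is added to the forbidden set, so
  the union remains a matching.\<close>

lemma greedy_absorbers:
  assumes kg: "kgraph k V E" and many: "has_many_absorbers k \<rho> t V E" and V: "V \<noteq> {}" and \<rho>: "0 < \<rho>" "\<rho> \<le> 1"
    and Z: "Z \<subseteq> V" "real (card Z + s * t) \<le> \<rho> * real (card V)"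
  shows "\<exists>\<F>. matching E (\<Union>\<F>) \<and> \<Union>(\<Union>\<F>) \<inter> Z = {} \<and> card (\<Union>(\<Union>\<F>)) \<le> s * t \<and>
    real (card {U. U \<subseteq> V \<and> card U = k + 2 \<and> \<not> (\<exists>M\<in>\<F>. absorbs E U M)}) \<le>
      (1 - \<rho> ^ t / 2 ^ 2 ^ t) ^ s * real (card V) ^ (k + 2)"
  using Z(2)
proof (induction s)
  case 0
  have fV: "finite V" using kg unfolding kgraph_def by simp
  have "card {U. U \<subseteq> V \<and> card U = k + 2} \<le> card V ^ (k + 2)"
  proof (cases "k + 2 \<le> card V")
    case True
    then show ?thesis using n_subsets[OF fV] binomial_le_pow by metis
  next
    case False
    then show ?thesis using n_subsets[OF fV, of "k + 2"] by (simp add: binomial_eq_0)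
  qed
  then have "real (card {U. U \<subseteq> V \<and> card U = k + 2}) \<le> real (card V) ^ (k + 2)"
    by (metis of_nat_le_iff of_nat_power)
  then show ?case by (intro exI[of _ "{}"]) (simp add: matching_def)
next
  case (Suc s)
  let ?c = "\<rho> ^ t / 2 ^ 2 ^ t"
  have "real (card Z + s * t) \<le> \<rho> * real (card V)" using Suc.prems by simp
  from Suc.IH[OF this] obtain \<F> where \<F>: "matching E (\<Union>\<F>)" "\<Union>(\<Union>\<F>) \<inter> Z = {}" "card (\<Union>(\<Union>\<F>)) \<le> s * t"
      "real (card {U. U \<subseteq> V \<and> card U = k + 2 \<and> \<not> (\<exists>M\<in>\<F>. absorbs E U M)}) \<le>
      (1 - ?c) ^ s * real (card V) ^ (k + 2)"
    by blast
  define W where "W = {U. U \<subseteq> V \<and> card U = k + 2 \<and> \<not> (\<exists>M\<in>\<F>. absorbs E U M)}"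
  define X where "X = \<Union>(\<Union>\<F>)"
  have XV: "X \<subseteq> V" unfolding X_def by (rule matching_card_Union(3)[OF kg \<F>(1)])
  have fV: "finite V" using kg unfolding kgraph_def by simp
  have fW: "finite W" unfolding W_def by (rule finite_subset[of _ "Pow V"]) (use fV in auto)
  have "card (Z \<union> X) \<le> card Z + s * t" using card_Un_le[of Z X] \<F>(3) unfolding X_def by linarith
  then have "card (Z \<union> X) \<le> card Z + Suc s * t" by simp
  then have "real (card (Z \<union> X)) \<le> real (card Z + Suc s * t)" by (rule of_nat_mono)
  then have ZX: "real (card (Z \<union> X)) \<le> \<rho> * real (card V)" using Suc.prems by linarith
  have "\<exists>M. matching E M \<and> \<Union>M \<inter> (Z \<union> X) = {} \<and> card (\<Union>M) \<le> t \<and>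
      ?c * real (card W) \<le> real (card {U \<in> W. absorbs E U M})"
    by (rule popular_absorber[OF kg many V \<rho>(1) _ _ ZX]) (use Z(1) XV in \<open>auto simp: W_def\<close>)
  then obtain M where M: "matching E M" "\<Union>M \<inter> (Z \<union> X) = {}" "card (\<Union>M) \<le> t"
      "?c * real (card W) \<le> real (card {U \<in> W. absorbs E U M})"
    by blast
  define \<G> where "\<G> = insert M \<F>"
  have UG: "\<Union>\<G> = M \<union> \<Union>\<F>" "\<Union>(\<Union>\<G>) = \<Union>M \<union> X" unfolding \<G>_def X_def by auto
  have "\<Union>M \<inter> X \<subseteq> \<Union>M \<inter> (Z \<union> X)" by (intro Int_mono) auto
  then have "\<Union>M \<inter> X = {}" unfolding M(2) by simp
  then have "matching E (\<Union>\<G>)"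
    unfolding UG X_def using M(1) \<F>(1) by (intro matching_Un)
  moreover have "\<Union>(\<Union>\<G>) \<inter> Z = {}"
  proof -
    have "\<Union>M \<inter> Z \<subseteq> \<Union>M \<inter> (Z \<union> X)" by (intro Int_mono) auto
    then have "\<Union>M \<inter> Z = {}" unfolding M(2) by simp
    moreover have "X \<inter> Z = {}" using \<F>(2) unfolding X_def .
    ultimately show ?thesis unfolding UG(2) Int_Un_distrib2 by simp
  qed
  moreover have "card (\<Union>(\<Union>\<G>)) \<le> Suc s * t"
    unfolding UG using card_Un_le[of "\<Union>M" X] M(3) \<F>(3) unfolding X_def by simp
  moreover have "real (card {U. U \<subseteq> V \<and> card U = k + 2 \<and> \<not> (\<exists>M\<in>\<G>. absorbs E U M)}) \<le>
      (1 - ?c) ^ Suc s * real (card V) ^ (k + 2)"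
  proof -
    have eq: "{U. U \<subseteq> V \<and> card U = k + 2 \<and> \<not> (\<exists>M\<in>\<G>. absorbs E U M)} = W - {U \<in> W. absorbs E U M}"
      unfolding W_def \<G>_def by auto
    have "card (W - {U \<in> W. absorbs E U M}) = card W - card {U \<in> W. absorbs E U M}"
      using fW by (intro card_Diff_subset) auto
    moreover have "card {U \<in> W. absorbs E U M} \<le> card W" using fW by (intro card_mono) auto
    ultimately have "real (card (W - {U \<in> W. absorbs E U M})) = real (card W) - real (card {U \<in> W. absorbs E U M})"
      by simp
    also have "\<dots> \<le> (1 - ?c) * real (card W)" using M(4) by (simp add: algebra_simps)
    also have "\<dots> \<le> (1 - ?c) * ((1 - ?c) ^ s * real (card V) ^ (k + 2))"
    proof (rule mult_left_mono)
      show "real (card W) \<le> (1 - ?c) ^ s * real (card V) ^ (k + 2)" using \<F>(4) unfolding W_def .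
      have "\<rho> ^ t \<le> 1" using \<rho> by (intro power_le_one) auto
      also have "(1 :: real) \<le> 2 ^ 2 ^ t" by simp
      finally show "0 \<le> 1 - ?c" by simp
    qed
    finally show ?thesis unfolding eq by (simp add: mult.assoc)
  qed
  ultimately show ?case by blast
qed

text \<open>One absorption uses up a member of a family, so \<open>C\<close> absorptions are
  prepared by \<open>C\<close> disjoint families. By \<open>s\<close>, the number of sets that a
  family fails to absorb is below 1, hence zero.\<close>

lemma absorbing_families:
  assumes kg: "kgraph k V E" and many: "has_many_absorbers k \<rho> t V E" and V: "V \<noteq> {}" and \<rho>: "0 < \<rho>" "\<rho> \<le> 1"
    and s: "(1 - \<rho> ^ t / 2 ^ 2 ^ t) ^ s * real (card V) ^ (k + 2) < 1"
    and C: "real (C * (s * t)) \<le> \<rho> * real (card V)"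
  shows "\<exists>Fs. length Fs = C \<and> (\<forall>\<F>\<in>set Fs. absorbing_family k V E \<F>) \<and>
     sorted_wrt (\<lambda>\<F> \<G>. \<Union>(\<Union>\<F>) \<inter> \<Union>(\<Union>\<G>) = {}) Fs \<and>
     matching E (\<Union>(\<Union>(set Fs))) \<and> card (\<Union>(\<Union>(\<Union>(set Fs)))) \<le> C * (s * t)"
  using C
proof (induction C)
  case 0
  show ?case by (intro exI[of _ "[]"]) (simp add: matching_def)
next
  case (Suc C)
  have "real (C * (s * t)) \<le> real (Suc C * (s * t))" by (intro of_nat_mono) simp
  then have "real (C * (s * t)) \<le> \<rho> * real (card V)" using Suc.prems by linarith
  from Suc.IH[OF this] obtain Fs where Fs: "length Fs = C" "\<forall>\<F>\<in>set Fs. absorbing_family k V E \<F>"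
     "sorted_wrt (\<lambda>\<F> \<G>. \<Union>(\<Union>\<F>) \<inter> \<Union>(\<Union>\<G>) = {}) Fs"
     "matching E (\<Union>(\<Union>(set Fs)))" "card (\<Union>(\<Union>(\<Union>(set Fs)))) \<le> C * (s * t)"
    by blast
  define Z where "Z = \<Union>(\<Union>(\<Union>(set Fs)))"
  have ZV: "Z \<subseteq> V" unfolding Z_def by (rule matching_card_Union(3)[OF kg Fs(4)])
  have "card Z + s * t \<le> Suc C * (s * t)" using Fs(5) unfolding Z_def by simp
  then have "real (card Z + s * t) \<le> real (Suc C * (s * t))" by (rule of_nat_mono)
  then have "real (card Z + s * t) \<le> \<rho> * real (card V)" using Suc.prems by linarith
  from greedy_absorbers[OF kg many V \<rho> ZV this] obtain \<F> where
    \<F>: "matching E (\<Union>\<F>)" "\<Union>(\<Union>\<F>) \<inter> Z = {}" "card (\<Union>(\<Union>\<F>)) \<le> s * t"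
      "real (card {U. U \<subseteq> V \<and> card U = k + 2 \<and> \<not> (\<exists>M\<in>\<F>. absorbs E U M)}) \<le>
      (1 - \<rho> ^ t / 2 ^ 2 ^ t) ^ s * real (card V) ^ (k + 2)"
    by blast
  have fV: "finite V" using kg unfolding kgraph_def by simp
  have "finite {U. U \<subseteq> V \<and> card U = k + 2 \<and> \<not> (\<exists>M\<in>\<F>. absorbs E U M)}"
    by (rule finite_subset[of _ "Pow V"]) (use fV in auto)
  moreover have "card {U. U \<subseteq> V \<and> card U = k + 2 \<and> \<not> (\<exists>M\<in>\<F>. absorbs E U M)} = 0"
    using \<F>(4) s by linarith
  ultimately have "{U. U \<subseteq> V \<and> card U = k + 2 \<and> \<not> (\<exists>M\<in>\<F>. absorbs E U M)} = {}" by simp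
  then have af: "absorbing_family k V E \<F>" unfolding absorbing_family_def by blast
  have U1: "\<Union>(\<Union>(set (\<F> # Fs))) = \<Union>\<F> \<union> \<Union>(\<Union>(set Fs))" by simp
  have U2: "\<Union>(\<Union>(\<Union>(set (\<F> # Fs)))) = \<Union>(\<Union>\<F>) \<union> Z" unfolding Z_def by simp
  show ?case
  proof (intro exI[of _ "\<F> # Fs"] conjI)
    show "length (\<F> # Fs) = Suc C" using Fs(1) by simp
    show "\<forall>\<G>\<in>set (\<F> # Fs). absorbing_family k V E \<G>" using af Fs(2) by simp
    have "\<Union>(\<Union>\<F>) \<inter> \<Union>(\<Union>\<G>) = {}" if "\<G> \<in> set Fs" for \<G>
    proof -
      have "\<Union>(\<Union>\<G>) \<subseteq> Z" unfolding Z_def using that by (intro Union_mono) auto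
      then show ?thesis using \<F>(2) by blast
    qed
    then show "sorted_wrt (\<lambda>\<F> \<G>. \<Union>(\<Union>\<F>) \<inter> \<Union>(\<Union>\<G>) = {}) (\<F> # Fs)" using Fs(3) by simp
    show "matching E (\<Union>(\<Union>(set (\<F> # Fs))))"
      unfolding U1 using \<F>(1,2) Fs(4) unfolding Z_def by (intro matching_Un)
    show "card (\<Union>(\<Union>(\<Union>(set (\<F> # Fs))))) \<le> Suc C * (s * t)"
      unfolding U2 using card_Un_le[of "\<Union>(\<Union>\<F>)" Z] \<F>(3) Fs(5) unfolding Z_def by simp
  qed
qed

text \<open>Replacing the absorber by its larger version adds one edge, so the leftover shrinks by
  \<open>k\<close>, while the remaining families are disjoint from the absorber and stay in the
  matching. With at most \<open>k + 1\<close> vertices left, no \<open>U\<close> can be chosen any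
  more.\<close>

lemma absorb_leftover:
  assumes kg: "kgraph k V E" and k: "0 < k"
  shows "matching E M \<Longrightarrow> \<forall>\<F>\<in>set Fs. absorbing_family k V E \<F> \<and> \<Union>\<F> \<subseteq> M \<Longrightarrow>
    sorted_wrt (\<lambda>\<F> \<G>. \<Union>(\<Union>\<F>) \<inter> \<Union>(\<Union>\<G>) = {}) Fs \<Longrightarrow>
    card (V - \<Union>M) \<le> k + 1 + k * length Fs \<Longrightarrow> \<exists>M'. matching E M' \<and> card (V - \<Union>M') \<le> k + 1"
proof (induction Fs arbitrary: M)
  case Nil
  then show ?case by auto
next
  case (Cons \<F> Fs)
  have fV: "finite V" and Ek: "\<And>e. e \<in> E \<Longrightarrow> card e = k" using kg unfolding kgraph_def by auto
  show ?case
  proof (cases "card (V - \<Union>M) \<le> k + 1")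
    case True
    then show ?thesis using Cons.prems(1) by blast
  next
    case False
    then have "k + 2 \<le> card (V - \<Union>M)" by simp
    then obtain U where U: "U \<subseteq> V - \<Union>M" "card U = k + 2" by (meson obtain_subset_with_card_n)
    have "\<exists>M1\<in>\<F>. absorbs E U M1"
      using Cons.prems(2) U unfolding absorbing_family_def by auto
    then obtain M1 where M1: "M1 \<in> \<F>" "absorbs E U M1" by blast
    then obtain M2 where M2: "matching E M2" "\<Union>M2 \<subseteq> \<Union>M1 \<union> U" "card M2 = Suc (card M1)"
      unfolding absorbs_def by blast
    have M1M: "M1 \<subseteq> M" using M1(1) Cons.prems(2) by auto
    have d1: "\<Union>M1 \<inter> \<Union>(M - M1) = {}" by (rule matching_Union_Diff[OF Cons.prems(1) M1M])
    have "\<Union>(M - M1) \<subseteq> \<Union>M" by blast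
    then have d2: "\<Union>(M - M1) \<inter> \<Union>M2 = {}" using d1 M2(2) U(1) by blast
    define M' where "M' = (M - M1) \<union> M2"
    have mM': "matching E M'"
      unfolding M'_def using d2 M2(1) matching_subset[OF Cons.prems(1), of "M - M1"] by (intro matching_Un) auto
    have fM: "finite M" "finite M2" using matching_card_Union(2)[OF kg] Cons.prems(1) M2(1) by auto
    have ne: "e \<noteq> {}" if "e \<in> M2" for e
      using that M2(1) Ek k unfolding matching_def by force
    have "(M - M1) \<inter> M2 = {}"
    proof (rule ccontr)
      assume "(M - M1) \<inter> M2 \<noteq> {}"
      then obtain e where e: "e \<in> M - M1" "e \<in> M2" by blast
      then have "e \<subseteq> \<Union>(M - M1) \<inter> \<Union>M2" by blast
      then show False using d2 ne[OF e(2)] by simp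
    qed
    then have "card M' = card (M - M1) + card M2" unfolding M'_def using fM by (intro card_Un_disjoint) auto
    moreover have "card (M - M1) = card M - card M1" using fM(1) M1M by (intro card_Diff_subset) (auto intro: finite_subset)
    moreover have "card M1 \<le> card M" using fM(1) M1M by (rule card_mono)
    ultimately have cM': "card M' = Suc (card M)" using M2(3) by simp
    have left: "card (V - \<Union>N) + k * card N = card V" if N: "matching E N" for N
    proof -
      have sub: "\<Union>N \<subseteq> V" by (rule matching_card_Union(3)[OF kg N])
      have "card (V - \<Union>N) = card V - card (\<Union>N)"
        using fV sub by (intro card_Diff_subset) (auto intro: finite_subset)
      moreover have "card (\<Union>N) \<le> card V" using fV sub by (rule card_mono)
      ultimately show ?thesis using matching_card_Union(1)[OF kg N] by simp
    qed
    show ?thesis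
    proof (rule Cons.IH[OF mM'])
      show "\<forall>\<G>\<in>set Fs. absorbing_family k V E \<G> \<and> \<Union>\<G> \<subseteq> M'"
      proof (intro ballI conjI)
        fix \<G> assume G: "\<G> \<in> set Fs"
        then show "absorbing_family k V E \<G>" using Cons.prems(2) by simp
        have GM: "\<Union>\<G> \<subseteq> M" using G Cons.prems(2) by simp
        have disj: "\<Union>(\<Union>\<F>) \<inter> \<Union>(\<Union>\<G>) = {}" using G Cons.prems(3) by simp
        show "\<Union>\<G> \<subseteq> M'"
        proof
          fix e assume e: "e \<in> \<Union>\<G>"
          have "e \<notin> M1"
          proof
            assume "e \<in> M1"
            then have "e \<subseteq> \<Union>(\<Union>\<F>)" using M1(1) by blast
            moreover have "e \<subseteq> \<Union>(\<Union>\<G>)" using e by blast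
            ultimately have "e = {}" using disj by blast
            moreover have "card e = k" using e GM Cons.prems(1) Ek unfolding matching_def by blast
            ultimately show False using k by simp
          qed
          then show "e \<in> M'" using e GM unfolding M'_def by blast
        qed
      qed
      show "sorted_wrt (\<lambda>\<F> \<G>. \<Union>(\<Union>\<F>) \<inter> \<Union>(\<Union>\<G>) = {}) Fs" using Cons.prems(3) by simp
      show "card (V - \<Union>M') \<le> k + 1 + k * length Fs"
        using left[OF mM'] left[OF Cons.prems(1)] cM' Cons.prems(4) by simp
    qed
  qed
qed

section \<open>Near perfect matchings\<close>

lemma dense_kgraph_remove:
  assumes d: "dense_kgraph k (\<alpha> + \<gamma>) V E" and W: "W \<subseteq> V" "4 * real (card W) \<le> \<gamma> * real (card V)"
    and \<alpha>: "0 \<le> \<alpha>" "0 < \<gamma>"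
  shows "dense_kgraph k (\<alpha> + \<gamma> / 2) (V - W) {e \<in> E. e \<subseteq> V - W}"
proof -
  have kg: "kgraph k V E" using d unfolding dense_kgraph_def by simp
  have fV: "finite V" using kg unfolding kgraph_def by simp
  have kg': "kgraph k (V - W) {e \<in> E. e \<subseteq> V - W}" using kg unfolding kgraph_def by auto
  define n where "n = real (card V)"
  have "(\<alpha> + \<gamma> / 2) * (real (card (V - W)))\<^sup>2 \<le> real (card (extensions (V - W) {e \<in> E. e \<subseteq> V - W} S))"
    if S: "S \<subseteq> V - W" "card S = k - 2" for S
  proof -
    let ?D = "{p \<in> V \<times> V. fst p \<in> W \<or> snd p \<in> W}"
    have eq: "extensions (V - W) {e \<in> E. e \<subseteq> V - W} S = extensions V E S - ?D"
      using S(1) unfolding extensions_def by auto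
    have "finite ?D" using fV by simp
    then have "card (extensions V E S) - card ?D \<le> card (extensions V E S - ?D)"
      by (rule diff_card_le_card_Diff)
    moreover have "card ?D \<le> 2 * card W * card V" by (rule card_times_subset_le[OF fV W(1)])
    ultimately have "card (extensions V E S) \<le> card (extensions V E S - ?D) + 2 * card W * card V" by linarith
    then have "real (card (extensions V E S)) \<le> real (card (extensions V E S - ?D) + 2 * card W * card V)"
      by (rule of_nat_mono)
    moreover have "(\<alpha> + \<gamma>) * n\<^sup>2 \<le> real (card (extensions V E S))"
      using d S unfolding dense_kgraph_def n_def by auto
    moreover have "2 * real (card W) * n \<le> \<gamma> / 2 * n\<^sup>2"
      using mult_right_mono[OF W(2), of "real (card V)"] unfolding n_def
      by (simp add: power2_eq_square algebra_simps)
    ultimately have "(\<alpha> + \<gamma> / 2) * n\<^sup>2 \<le> real (card (extensions V E S - ?D))"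
      unfolding n_def by (simp add: algebra_simps)
    moreover have "(\<alpha> + \<gamma> / 2) * (real (card (V - W)))\<^sup>2 \<le> (\<alpha> + \<gamma> / 2) * n\<^sup>2"
      unfolding n_def using \<alpha> fV by (intro mult_left_mono power_mono) (auto intro: card_mono)
    ultimately show ?thesis unfolding eq by linarith
  qed
  then show ?thesis using kg' unfolding dense_kgraph_def by blast
qed

lemma near_perfect_matching:
  fixes \<gamma> :: real
  assumes k: "4 \<le> k" and \<gamma>: "0 < \<gamma>"
  shows "\<exists>n0. \<forall>(V :: 'a set) E. n0 \<le> card V \<longrightarrow> 2 \<le> card V mod k \<longrightarrow>
    dense_kgraph k ((2 * real k - 1) / (real k)\<^sup>2 + \<gamma>) V E \<longrightarrow>
    (\<exists>M. matching E M \<and> card M = card V div k)"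
proof -
  define \<alpha> where "\<alpha> = (2 * real k - 1) / (real k)\<^sup>2"
  have \<alpha>0: "0 < \<alpha>" unfolding \<alpha>_def using k by auto
  have "2 / 5 \<le> \<alpha> + \<gamma>" if "k = 4" using that \<gamma> unfolding \<alpha>_def by simp
  then have "\<exists>\<rho> t n1. 0 < \<rho> \<and> \<rho> \<le> 1 \<and>
      (\<forall>(V :: 'a set) E. n1 \<le> card V \<longrightarrow> dense_kgraph k (\<alpha> + \<gamma>) V E \<longrightarrow> has_many_absorbers k \<rho> t V E)"
    using k \<alpha>0 \<gamma> by (intro many_absorbers) simp_all
  then obtain \<rho> t n1 where \<rho>: "0 < \<rho>" "\<rho> \<le> 1"
    and many: "\<forall>(V :: 'a set) E. n1 \<le> card V \<longrightarrow> dense_kgraph k (\<alpha> + \<gamma>) V E \<longrightarrow> has_many_absorbers k \<rho> t V E"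
    by (elim exE conjE)
  have "\<exists>C n2. \<forall>(V :: 'a set) E. n2 \<le> card V \<longrightarrow> dense_kgraph k (\<alpha> + \<gamma> / 2) V E \<longrightarrow>
      (\<exists>M. matching E M \<and> card (V - \<Union>M) \<le> C)"
    unfolding \<alpha>_def using k \<gamma> by (intro almost_cover) simp_all
  then obtain C n2 where cover: "\<forall>(V :: 'a set) E. n2 \<le> card V \<longrightarrow> dense_kgraph k (\<alpha> + \<gamma> / 2) V E \<longrightarrow>
      (\<exists>M. matching E M \<and> card (V - \<Union>M) \<le> C)"
    by (elim exE)
  define c where "c = \<rho> ^ t / 2 ^ 2 ^ t"
  have c: "0 < c" "c \<le> 1"
  proof -
    show "0 < c" unfolding c_def using \<rho> by simp
    have "\<rho> ^ t \<le> 1" using \<rho> by (intro power_le_one) auto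
    also have "(1 :: real) \<le> 2 ^ 2 ^ t" by simp
    finally show "c \<le> 1" unfolding c_def by simp
  qed
  \<comment> \<open>A bound for the share of vertices used by absorbers: \<open>\<rho>\<close> lets
    the families be built, \<open>\<gamma> / 4\<close> preserves the density outside them, and
    \<open>1 / 2\<close> keeps enough vertices for \<open>cover\<close>.\<close>
  define \<sigma> where "\<sigma> = min \<rho> (min (\<gamma> / 4) (1 / 2))"
  have \<sigma>: "0 < \<sigma>" "\<sigma> \<le> \<rho>" "4 * \<sigma> \<le> \<gamma>" "2 * \<sigma> \<le> 1" unfolding \<sigma>_def using \<rho> \<gamma> by auto
  obtain q0 :: nat where q0: "real (C * t) / \<sigma> \<le> real q0" using real_arch_simple by blast
  define q where "q = Suc q0"
  have q: "real (C * t) \<le> \<sigma> * real q"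
  proof -
    have "real (C * t) / \<sigma> \<le> real q" using q0 unfolding q_def by simp
    then show ?thesis using \<sigma>(1) by (simp add: field_simps)
  qed
  have "\<exists>s0. \<forall>s\<ge>s0. real q ^ (k + 2) * real (s + 1) ^ (k + 2) * (1 - c) ^ s < 1"
    by (rule eventually_power_beats[OF c]) simp
  then obtain s0 where s0: "\<forall>s\<ge>s0. real q ^ (k + 2) * real (s + 1) ^ (k + 2) * (1 - c) ^ s < 1"
    by (elim exE)
  have "\<exists>M. matching E M \<and> card M = card V div k"
    if n: "max (max n1 (2 * n2)) (max (q * s0) 1) \<le> card V" and r: "2 \<le> card V mod k"
      and d: "dense_kgraph k (\<alpha> + \<gamma>) V E" for V :: "'a set" and E
  proof -
    \<comment> \<open>Linear in the number of vertices: \<open>q\<close> makes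
      \<open>C * s * t\<close> at most the share \<open>\<sigma>\<close>, while
      \<open>(1 - c) ^ s\<close> still beats the polynomial number of sets \<open>U\<close>.\<close>
    define s where "s = card V div q"
    have kg: "kgraph k V E" using d unfolding dense_kgraph_def by simp
    have fV: "finite V" using kg unfolding kgraph_def by simp
    have V: "V \<noteq> {}" using n by auto
    have hm: "has_many_absorbers k \<rho> t V E" using many n d by simp
    have "q * s0 \<le> card V" using n by simp
    then have "s0 \<le> s" unfolding s_def using div_le_mono[of "q * s0" "card V" q] nonzero_mult_div_cancel_left[of q s0] unfolding q_def by linarith
    then have "real q ^ (k + 2) * real (s + 1) ^ (k + 2) * (1 - c) ^ s < 1" using s0 by blast
    moreover have "real (card V) ^ (k + 2) \<le> real q ^ (k + 2) * real (s + 1) ^ (k + 2)"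
    proof -
      have "card V \<le> q * (s + 1)"
        unfolding s_def using dividend_less_times_div[of q "card V"] unfolding q_def by simp
      then have "real (card V) \<le> real q * real (s + 1)" by (metis of_nat_le_iff of_nat_mult)
      then have "real (card V) ^ (k + 2) \<le> (real q * real (s + 1)) ^ (k + 2)" by (intro power_mono) auto
      then show ?thesis by (simp only: power_mult_distrib)
    qed
    then have "(1 - c) ^ s * real (card V) ^ (k + 2) \<le> (1 - c) ^ s * (real q ^ (k + 2) * real (s + 1) ^ (k + 2))"
      using c by (intro mult_left_mono) auto
    ultimately have sc: "(1 - \<rho> ^ t / 2 ^ 2 ^ t) ^ s * real (card V) ^ (k + 2) < 1"
      unfolding c_def[symmetric] by (simp add: mult.commute)
    have small: "real (C * (s * t)) \<le> \<sigma> * real (card V)"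
    proof -
      have "real (C * (s * t)) = real (C * t) * real s" by simp
      also have "\<dots> \<le> \<sigma> * real q * real s" using q by (intro mult_right_mono) auto
      also have "\<dots> = \<sigma> * real (q * s)" by simp
      also have "\<dots> \<le> \<sigma> * real (card V)"
        unfolding s_def using \<sigma>(1) by (intro mult_left_mono of_nat_mono) auto
      finally show ?thesis .
    qed
    also have "\<dots> \<le> \<rho> * real (card V)" using \<sigma>(2) by (intro mult_right_mono) auto
    finally obtain Fs where Fs: "length Fs = C" "\<forall>\<F>\<in>set Fs. absorbing_family k V E \<F>"
      "sorted_wrt (\<lambda>\<F> \<G>. \<Union>(\<Union>\<F>) \<inter> \<Union>(\<Union>\<G>) = {}) Fs"
      "matching E (\<Union>(\<Union>(set Fs)))" "card (\<Union>(\<Union>(\<Union>(set Fs)))) \<le> C * (s * t)"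
      using absorbing_families[OF kg hm V \<rho> sc] by blast
    define MA where "MA = \<Union>(\<Union>(set Fs))"
    define W where "W = \<Union>MA"
    have mMA: "matching E MA" using Fs(4) unfolding MA_def .
    have WV: "W \<subseteq> V" unfolding W_def by (rule matching_card_Union(3)[OF kg mMA])
    have cW: "real (card W) \<le> \<sigma> * real (card V)"
    proof -
      have "real (card W) \<le> real (C * (s * t))" using Fs(5) unfolding W_def MA_def by (rule of_nat_mono)
      then show ?thesis using small by linarith
    qed
    have "4 * real (card W) \<le> 4 * \<sigma> * real (card V)" using cW by simp
    also have "\<dots> \<le> \<gamma> * real (card V)" using \<sigma>(3) by (rule mult_right_mono) simp
    finally have d': "dense_kgraph k (\<alpha> + \<gamma> / 2) (V - W) {e \<in> E. e \<subseteq> V - W}"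
      using \<alpha>0 \<gamma> by (intro dense_kgraph_remove[OF d WV]) auto
    have "2 * real (card W) \<le> real (card V)"
      using cW mult_right_mono[OF \<sigma>(4), of "real (card V)"] by simp
    then have "2 * card W \<le> card V" by linarith
    then have "n2 \<le> card (V - W)"
    proof -
      have "2 * n2 \<le> card V" using n by simp
      then show ?thesis
        using \<open>2 * card W \<le> card V\<close> card_Diff_subset[OF finite_subset[OF WV fV] WV] by linarith
    qed
    then have "\<exists>M0. matching {e \<in> E. e \<subseteq> V - W} M0 \<and> card (V - W - \<Union>M0) \<le> C"
      using cover d' by blast
    then obtain M0 where M0: "matching {e \<in> E. e \<subseteq> V - W} M0" "card (V - W - \<Union>M0) \<le> C"
      by blast
    have mM0: "matching E M0" and M0W: "\<Union>M0 \<subseteq> V - W" using M0(1) unfolding matching_def by auto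
    define M where "M = MA \<union> M0"
    have "W \<inter> \<Union>M0 = {}" using M0W by blast
    then have mM: "matching E M" unfolding M_def using mMA mM0 unfolding W_def by (intro matching_Un)
    have "V - \<Union>M = V - W - \<Union>M0" unfolding M_def W_def by auto
    then have left: "card (V - \<Union>M) \<le> k + 1 + k * length Fs"
    proof -
      have "1 * C \<le> k * C" using k by (intro mult_le_mono1) simp
      then show ?thesis using M0(2) unfolding \<open>V - \<Union>M = V - W - \<Union>M0\<close> Fs(1) by linarith
    qed
    have "\<exists>M'. matching E M' \<and> card (V - \<Union>M') \<le> k + 1"
    proof (rule absorb_leftover[OF kg _ mM _ Fs(3) left])
      show "\<forall>\<F>\<in>set Fs. absorbing_family k V E \<F> \<and> \<Union>\<F> \<subseteq> M"
        using Fs(2) unfolding M_def MA_def by auto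
    qed (use k in simp)
    then obtain M' where M': "matching E M'" "card (V - \<Union>M') \<le> k + 1" by blast
    have sub: "\<Union>M' \<subseteq> V" by (rule matching_card_Union(3)[OF kg M'(1)])
    define l where "l = card (V - \<Union>M')"
    have n_eq: "card V = k * card M' + l"
      using card_Diff_subset[OF finite_subset[OF sub fV] sub] card_mono[OF fV sub]
        matching_card_Union(1)[OF kg M'(1)] unfolding l_def by simp
    \<comment> \<open>The only place where the residue enters: \<open>l \<le> k + 1\<close>, and
      \<open>l = k\<close> or \<open>l = k + 1\<close> would mean residue 0 or 1. The matching then
      has the full size \<open>n div k\<close>.\<close>
    have "l < k"
    proof (rule ccontr)
      assume "\<not> l < k"
      then have "l = k \<or> l = k + 1" using M'(2) unfolding l_def by auto
      moreover have "(k + 1) mod k = 1" using mod_add_self1[of k 1] k by simp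
      ultimately have "l mod k = 0 \<or> l mod k = 1" by auto
      then show False using r unfolding n_eq by simp
    qed
    then have "card V div k = card M'" unfolding n_eq by simp
    then show ?thesis using M'(1) by auto
  qed
  then show ?thesis unfolding \<alpha>_def by blast
qed

section \<open>The threshold\<close>

lemma two_choose_two: "2 * real (m choose 2) = real m * (real m - 1)"
proof (induction m)
  case (Suc m)
  have "Suc m choose 2 = m + (m choose 2)" by (simp add: numeral_2_eq_2)
  then show ?case using Suc.IH by (simp add: algebra_simps)
qed simp

text \<open>\<open>n^2\<close> and twice the binomial coefficient differ by a term linear in
  \<open>n\<close>, which the surplus \<open>\<gamma>\<close> absorbs.\<close>

lemma square_le_choose_two:
  fixes a \<gamma> :: real
  assumes a: "0 \<le> a" "0 < \<gamma>"
  shows "\<exists>n0. \<forall>n\<ge>n0. a * (real n)\<^sup>2 \<le> (a + \<gamma>) * (2 * real ((n - k + 2) choose 2))"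
proof -
  obtain n0 :: nat where n0: "(a + \<gamma>) * (2 * real k) / \<gamma> \<le> real n0" using real_arch_simple by blast
  have "a * (real n)\<^sup>2 \<le> (a + \<gamma>) * (2 * real ((n - k + 2) choose 2))" if n: "max n0 k \<le> n" for n
  proof -
    have "(a + \<gamma>) * (2 * real k) / \<gamma> \<le> real n" using n n0 by simp
    then have "(a + \<gamma>) * (2 * real k) \<le> \<gamma> * real n" using a by (simp add: field_simps)
    then have "(a + \<gamma>) * (2 * real k) * real n \<le> \<gamma> * real n * real n" by (rule mult_right_mono) simp
    then have "a * (real n)\<^sup>2 \<le> (a + \<gamma>) * ((real n)\<^sup>2 - 2 * real k * real n)"
      by (simp add: algebra_simps power2_eq_square)
    also have "\<dots> \<le> (a + \<gamma>) * (2 * real ((n - k + 2) choose 2))"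
    proof (rule mult_left_mono)
      define x where "x = real n - real k"
      have x: "0 \<le> x" "real (n - k + 2) = x + 2" using n unfolding x_def by (auto simp: of_nat_diff)
      have "(real n)\<^sup>2 - 2 * real k * real n \<le> x\<^sup>2"
        unfolding x_def by (simp add: power2_eq_square algebra_simps)
      also have "\<dots> \<le> (x + 2) * (x + 2 - 1)" using x by (simp add: power2_eq_square algebra_simps)
      finally show "(real n)\<^sup>2 - 2 * real k * real n \<le> 2 * real ((n - k + 2) choose 2)"
        unfolding two_choose_two x(2) .
    qed (use a in simp)
    finally show ?thesis .
  qed
  then show ?thesis by blast
qed

lemma two_degree_le_card_extensions:
  assumes kg: "kgraph k V E" and k: "2 \<le> k" and S: "S \<subseteq> V" "card S = k - 2"
  shows "2 * degree E S \<le> card (extensions V E S)"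
proof -
  have fV: "finite V" and Ek: "\<And>e. e \<in> E \<Longrightarrow> e \<subseteq> V \<and> card e = k" using kg unfolding kgraph_def by auto
  have fS: "finite S" using S(1) fV by (rule finite_subset)
  define D where "D e = {p \<in> extensions V E S. S \<union> {fst p, snd p} = e}" for e
  have fx: "finite (extensions V E S)"
    by (rule finite_subset[of _ "V \<times> V"]) (use fV in \<open>auto simp: extensions_def\<close>)
  have D2: "2 \<le> card (D e)" if e: "e \<in> E" "S \<subseteq> e" for e
  proof -
    have "card (e - S) = 2" using card_Diff_subset[OF fS e(2)] Ek[OF e(1)] S k by simp
    then obtain x y where xy: "e - S = {x, y}" "x \<noteq> y" by (auto simp: card_2_iff)
    have e_eq: "S \<union> {x, y} = e" "S \<union> {y, x} = e" using xy e(2) by blast+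
    have "{x, y} \<subseteq> V" using xy Ek[OF e(1)] by blast
    then have "{(x, y), (y, x)} \<subseteq> D e" unfolding D_def extensions_def using e_eq e(1) by simp
    then have "card {(x, y), (y, x)} \<le> card (D e)" using fx unfolding D_def by (intro card_mono) auto
    then show ?thesis using xy(2) by simp
  qed
  let ?L = "{e \<in> E. S \<subseteq> e}"
  have fL: "finite ?L" using kgraph_finite_edges[OF kg] by simp
  have "2 * degree E S = (\<Sum>e\<in>?L. 2)" unfolding degree_def by simp
  also have "\<dots> \<le> (\<Sum>e\<in>?L. card (D e))" using D2 by (intro sum_mono) simp
  also have "\<dots> = card (\<Union>e\<in>?L. D e)"
    by (rule card_UN_disjoint[symmetric, OF fL]) (use fx in \<open>auto simp: D_def\<close>)
  also have "\<dots> \<le> card (extensions V E S)" using fx unfolding D_def by (intro card_mono) auto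
  finally show ?thesis .
qed

lemma finite_degree_image: "finite V \<Longrightarrow> finite (degree E ` {S. S \<subseteq> V \<and> card S = d})"
  by simp

lemma dense_kgraph_of_min_degree:
  fixes \<alpha> :: real
  assumes kg: "kgraph k V E" and k: "2 \<le> k" and m: "m \<le> min_degree (k - 2) V E"
    and \<alpha>: "\<alpha> * (real (card V))\<^sup>2 \<le> 2 * real m"
  shows "dense_kgraph k \<alpha> V E"
  unfolding dense_kgraph_def
proof (intro conjI allI impI kg)
  fix S assume S: "S \<subseteq> V \<and> card S = k - 2"
  have "finite V" using kg unfolding kgraph_def by simp
  then have "min_degree (k - 2) V E \<le> degree E S"
    unfolding min_degree_def using S by (intro Min_le finite_degree_image) auto
  then have "2 * m \<le> card (extensions V E S)"
    using m two_degree_le_card_extensions[OF kg k, of S] S by linarith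
  then have "2 * real m \<le> real (card (extensions V E S))" by linarith
  then show "\<alpha> * (real (card V))\<^sup>2 \<le> real (card (extensions V E S))" using \<alpha> by linarith
qed

lemma card_supersets:
  assumes W: "finite W" and S: "S \<subseteq> W" "card S \<le> k"
  shows "card {e. S \<subseteq> e \<and> e \<subseteq> W \<and> card e = k} = (card W - card S) choose (k - card S)"
proof -
  have fS: "finite S" using S(1) W by (rule finite_subset)
  have "{e. S \<subseteq> e \<and> e \<subseteq> W \<and> card e = k} = (\<lambda>B. S \<union> B) ` {B. B \<subseteq> W - S \<and> card B = k - card S}"
  proof (intro equalityI subsetI)
    fix e assume e: "e \<in> {e. S \<subseteq> e \<and> e \<subseteq> W \<and> card e = k}"
    then have "card (e - S) = k - card S" using card_Diff_subset[OF fS, of e] by simp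
    moreover have "e = S \<union> (e - S)" "e - S \<subseteq> W - S" using e by auto
    ultimately show "e \<in> (\<lambda>B. S \<union> B) ` {B. B \<subseteq> W - S \<and> card B = k - card S}" by blast
  next
    fix e assume "e \<in> (\<lambda>B. S \<union> B) ` {B. B \<subseteq> W - S \<and> card B = k - card S}"
    then obtain B where B: "B \<subseteq> W - S" "card B = k - card S" "e = S \<union> B" by blast
    have "finite B" using B(1) W by (meson finite_Diff finite_subset)
    moreover have "S \<inter> B = {}" using B(1) by blast
    ultimately have "card e = k" using card_Un_disjoint[OF fS] B S(2) by simp
    then show "e \<in> {e. S \<subseteq> e \<and> e \<subseteq> W \<and> card e = k}" using B S(1) by blast
  qed
  moreover have "inj_on (\<lambda>B. S \<union> B) {B. B \<subseteq> W - S \<and> card B = k - card S}"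
    by (rule inj_onI) blast
  ultimately have "card {e. S \<subseteq> e \<and> e \<subseteq> W \<and> card e = k} = card {B. B \<subseteq> W - S \<and> card B = k - card S}"
    by (simp add: card_image)
  also have "\<dots> = card (W - S) choose (k - card S)" using W by (intro n_subsets) simp
  also have "card (W - S) = card W - card S" by (rule card_Diff_subset[OF fS S(1)])
  finally show ?thesis .
qed

lemma space_barrier:
  assumes k: "2 \<le> k" and n: "k \<le> n"
  shows "\<exists>(V :: nat set) E. kgraph k V E \<and> card V = n \<and>
    ((n - k + 2) choose 2) - ((n - (n div k - 1) - (k - 2)) choose 2) \<le> min_degree (k - 2) V E \<and>
    (\<forall>M. matching E M \<longrightarrow> card M < n div k)"
proof -
  define V A where "V = {..<n}" and "A = {..<n div k - 1}"
  define E where "E = {e. e \<subseteq> V \<and> card e = k \<and> e \<inter> A \<noteq> {}}"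
  have "n div k - 1 \<le> n" using div_le_dividend[of n k] by linarith
  then have AV: "A \<subseteq> V" unfolding A_def V_def by simp
  have fV: "finite V" and fA: "finite A" unfolding V_def A_def by auto
  have kg: "kgraph k V E" unfolding kgraph_def E_def using fV by auto
  have "0 < n div k" using k n by (simp add: div_greater_zero_iff)
  have "card M < n div k" if M: "matching E M" for M
  proof -
    have "\<exists>a. a \<in> e \<inter> A" if "e \<in> M" for e using M that unfolding matching_def E_def by blast
    then obtain f where f: "\<And>e. e \<in> M \<Longrightarrow> f e \<in> e \<inter> A" by metis
    have "inj_on f M"
    proof (rule inj_onI, rule ccontr)
      fix e e' assume e: "e \<in> M" "e' \<in> M" "f e = f e'" "e \<noteq> e'"
      then have "disjnt e e'" using M unfolding matching_def by (elim conjE pairwiseD) auto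
      then show False using f[OF e(1)] f[OF e(2)] e(3) unfolding disjnt_def by auto
    qed
    then have "card M \<le> card A" using f fA by (intro card_inj_on_le) auto
    then show ?thesis using \<open>0 < n div k\<close> unfolding A_def by simp
  qed
  moreover have "((n - k + 2) choose 2) - ((n - (n div k - 1) - (k - 2)) choose 2) \<le> min_degree (k - 2) V E"
  proof -
    have "((n - k + 2) choose 2) - ((n - (n div k - 1) - (k - 2)) choose 2) \<le> degree E S"
      if S: "S \<subseteq> V" "card S = k - 2" for S
    proof -
      let ?X = "\<lambda>W. {e. S \<subseteq> e \<and> e \<subseteq> W \<and> card e = k}"
      have "{e \<in> E. S \<subseteq> e} = ?X V - ?X (V - A)" unfolding E_def by auto
      then have "degree E S = card (?X V - ?X (V - A))" unfolding degree_def by simp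
      moreover have "finite (?X (V - A))" by (rule finite_subset[of _ "Pow V"]) (use fV in auto)
      then have "card (?X V) - card (?X (V - A)) \<le> card (?X V - ?X (V - A))"
        by (rule diff_card_le_card_Diff)
      moreover have "card (?X V) = (n - k + 2) choose 2"
      proof -
        have "card (?X V) = (card V - card S) choose (k - card S)" using S by (intro card_supersets[OF fV]) auto
        moreover have "card V - card S = n - k + 2" "k - card S = 2" using S k n unfolding V_def by auto
        ultimately show ?thesis by simp
      qed
      \<comment> \<open>If \<open>S\<close> meets \<open>A\<close>, then all its
        \<open>k\<close>-supersets in \<open>V\<close> are edges and nothing is subtracted.\<close>
      moreover have "card (?X (V - A)) \<le> (n - (n div k - 1) - (k - 2)) choose 2"
      proof (cases "S \<subseteq> V - A")
        case True
        have "card (?X (V - A)) = (card (V - A) - card S) choose (k - card S)"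
          using S fV True by (intro card_supersets) auto
        moreover have "card (V - A) = n - (n div k - 1)"
          using card_Diff_subset[OF fA AV] unfolding V_def A_def by simp
        moreover have "k - card S = 2" using S k by simp
        ultimately show ?thesis using S(2) by simp
      next
        case False
        then have "?X (V - A) = {}" by blast
        then show ?thesis by (metis card.empty le0)
      qed
      ultimately show ?thesis by linarith
    qed
    moreover have "\<exists>S. S \<subseteq> V \<and> card S = k - 2"
    proof -
      have "k - 2 \<le> card V" using n unfolding V_def by simp
      then show ?thesis by (meson obtain_subset_with_card_n)
    qed
    ultimately show ?thesis
      unfolding min_degree_def using fV by (subst Min_ge_iff) auto
  qed
  moreover have "card V = n" unfolding V_def by simp
  ultimately show ?thesis using kg by blast
qed

section \<open>Bounds for the threshold\<close>

lemma threshold_le: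
  assumes "\<And>(V :: nat set) E. kgraph k V E \<Longrightarrow> card V = n \<Longrightarrow> m \<le> min_degree d V E \<Longrightarrow>
    \<exists>M. matching E M \<and> card M = n div k"
  shows "matching_threshold d k n \<le> m"
  unfolding matching_threshold_def by (rule Least_le) (use assms in blast)

text \<open>\<open>LeastI\<close> needs some value with the defining property. Beyond
  \<open>2 ^ n\<close>, which bounds every degree, the property holds vacuously;
  \<open>d \<le> n\<close> makes \<open>min_degree\<close> the minimum of a nonempty set.\<close>

lemma threshold_gt:
  assumes V: "kgraph k (V :: nat set) E" "card V = n" and no: "\<And>M. matching E M \<Longrightarrow> card M \<noteq> n div k"
    and d: "d \<le> n"
  shows "min_degree d V E < matching_threshold d k n"
proof -
  let ?P = "\<lambda>m. \<forall>(V :: nat set) E. kgraph k V E \<and> card V = n \<and> m \<le> min_degree d V E \<longrightarrow>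
        (\<exists>M. matching E M \<and> card M = n div k)"
  have small: "min_degree d V' E' < Suc (2 ^ n)" if V': "kgraph k V' E'" "card V' = n" for V' :: "nat set" and E'
  proof -
    have fV': "finite V'" using V' unfolding kgraph_def by simp
    have "d \<le> card V'" using d V'(2) by simp
    then have "\<exists>S. S \<subseteq> V' \<and> card S = d" by (meson obtain_subset_with_card_n)
    then have "min_degree d V' E' \<in> degree E' ` {S. S \<subseteq> V' \<and> card S = d}"
      unfolding min_degree_def using fV' by (intro Min_in) auto
    then obtain S where "min_degree d V' E' = degree E' S" by blast
    also have "\<dots> \<le> card E'"
      unfolding degree_def using kgraph_finite_edges[OF V'(1)] by (intro card_mono) auto
    also have "\<dots> \<le> card (Pow V')" using V'(1) fV' unfolding kgraph_def by (intro card_mono) auto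
    also have "\<dots> = 2 ^ n" using fV' V'(2) by (simp add: card_Pow)
    finally show ?thesis by simp
  qed
  have "?P (Suc (2 ^ n))"
  proof (intro allI impI, elim conjE)
    fix V' :: "nat set" and E' assume "kgraph k V' E'" "card V' = n" "Suc (2 ^ n) \<le> min_degree d V' E'"
    with small[of V' E'] show "\<exists>M. matching E' M \<and> card M = n div k" by linarith
  qed
  then have "?P (matching_threshold d k n)" unfolding matching_threshold_def by (rule LeastI)
  then have "\<not> matching_threshold d k n \<le> min_degree d V E" using V no by blast
  then show ?thesis by simp
qed

lemma threshold_upper:
  fixes \<gamma> :: real
  assumes k: "4 \<le> k" and \<gamma>: "0 < \<gamma>"
  shows "\<exists>n0. \<forall>n\<ge>n0. 2 \<le> n mod k \<longrightarrow> real (matching_threshold (k - 2) k n) \<le>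
     ((2 * real k - 1) / (real k)\<^sup>2 + \<gamma>) * real ((n - k + 2) choose 2) + 1"
proof -
  define c where "c = (2 * real k - 1) / (real k)\<^sup>2"
  have c: "0 < c" unfolding c_def using k by auto
  have "\<exists>n1. \<forall>(V :: nat set) E. n1 \<le> card V \<longrightarrow> 2 \<le> card V mod k \<longrightarrow> dense_kgraph k (c + \<gamma> / 2) V E \<longrightarrow>
    (\<exists>M. matching E M \<and> card M = card V div k)"
    unfolding c_def using k \<gamma> by (intro near_perfect_matching) simp_all
  then obtain n1 where n1: "\<forall>(V :: nat set) E. n1 \<le> card V \<longrightarrow> 2 \<le> card V mod k \<longrightarrow> dense_kgraph k (c + \<gamma> / 2) V E \<longrightarrow>
    (\<exists>M. matching E M \<and> card M = card V div k)"
    by (elim exE)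
  \<comment> \<open>Half of \<open>\<gamma>\<close> is the surplus density for
    \<open>near_perfect_matching\<close>; the other half pays for passing from \<open>n^2\<close> to
    the binomial coefficient.\<close>
  have "\<exists>n2. \<forall>n\<ge>n2. (c + \<gamma> / 2) * (real n)\<^sup>2 \<le> (c + \<gamma> / 2 + \<gamma> / 2) * (2 * real ((n - k + 2) choose 2))"
    using c \<gamma> by (intro square_le_choose_two) auto
  moreover have "c + \<gamma> / 2 + \<gamma> / 2 = c + \<gamma>" by simp
  ultimately obtain n2 where n2: "\<forall>n\<ge>n2. (c + \<gamma> / 2) * (real n)\<^sup>2 \<le> (c + \<gamma>) * (2 * real ((n - k + 2) choose 2))"
    by metis
  have "real (matching_threshold (k - 2) k n) \<le> (c + \<gamma>) * real ((n - k + 2) choose 2) + 1"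
    if n: "max n1 n2 \<le> n" and r: "2 \<le> n mod k" for n
  proof -
    define m where "m = nat \<lceil>(c + \<gamma>) * real ((n - k + 2) choose 2)\<rceil>"
    have pos: "0 \<le> (c + \<gamma>) * real ((n - k + 2) choose 2)" using c \<gamma> by simp
    have m: "(c + \<gamma>) * real ((n - k + 2) choose 2) \<le> real m"
      "real m \<le> (c + \<gamma>) * real ((n - k + 2) choose 2) + 1"
      using pos unfolding m_def by linarith+
    have "matching_threshold (k - 2) k n \<le> m"
    proof (rule threshold_le)
      fix V :: "nat set" and E assume V: "kgraph k V E" "card V = n" "m \<le> min_degree (k - 2) V E"
      have "(c + \<gamma> / 2) * (real n)\<^sup>2 \<le> (c + \<gamma>) * (2 * real ((n - k + 2) choose 2))" using n2 n by simp
      then have "(c + \<gamma> / 2) * (real (card V))\<^sup>2 \<le> 2 * real m" using m(1) V(2) by simp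
      then have "dense_kgraph k (c + \<gamma> / 2) V E" using k by (intro dense_kgraph_of_min_degree[OF V(1) _ V(3)]) simp_all
      then show "\<exists>M. matching E M \<and> card M = n div k" using n1 n r V(2) by auto
    qed
    then have "real (matching_threshold (k - 2) k n) \<le> real m" by simp
    then show ?thesis using m(2) by linarith
  qed
  then show ?thesis unfolding c_def by blast
qed

lemma threshold_lower:
  fixes \<gamma> :: real
  assumes k: "4 \<le> k" and \<gamma>: "0 < \<gamma>"
  shows "\<exists>n0. \<forall>n\<ge>n0. (1 - (1 - 1 / real k)\<^sup>2 - \<gamma>) * real ((n - k + 2) choose 2)
     \<le> real (matching_threshold (k - 2) k n)"
proof -
  define \<theta> where "\<theta> = 1 - 1 / real k"
  have \<theta>: "0 \<le> \<theta>" unfolding \<theta>_def using k by simp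
  have "\<exists>n1. \<forall>n\<ge>n1. \<theta>\<^sup>2 * (real n)\<^sup>2 \<le> (\<theta>\<^sup>2 + \<gamma>) * (2 * real ((n - k + 2) choose 2))"
    using \<gamma> by (intro square_le_choose_two) auto
  then obtain n1 where n1: "\<forall>n\<ge>n1. \<theta>\<^sup>2 * (real n)\<^sup>2 \<le> (\<theta>\<^sup>2 + \<gamma>) * (2 * real ((n - k + 2) choose 2))"
    by blast
  have "(1 - \<theta>\<^sup>2 - \<gamma>) * real ((n - k + 2) choose 2) \<le> real (matching_threshold (k - 2) k n)"
    if n: "max n1 k \<le> n" for n
  proof -
    define b where "b = n - (n div k - 1) - (k - 2)"
    have "k \<le> n" using n by simp
    have "2 \<le> k" using k by simp
    from space_barrier[OF this \<open>k \<le> n\<close>] obtain V :: "nat set" and E where V: "kgraph k V E" "card V = n"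
      and deg: "((n - k + 2) choose 2) - (b choose 2) \<le> min_degree (k - 2) V E"
      and no: "\<forall>M. matching E M \<longrightarrow> card M < n div k"
      unfolding b_def by blast
    have "min_degree (k - 2) V E < matching_threshold (k - 2) k n"
      using V \<open>k \<le> n\<close> no by (intro threshold_gt) auto
    then have "((n - k + 2) choose 2) - (b choose 2) \<le> matching_threshold (k - 2) k n" using deg by linarith
    then have lower: "real ((n - k + 2) choose 2) - real (b choose 2) \<le> real (matching_threshold (k - 2) k n)"
      by linarith
    have b_le: "real b \<le> \<theta> * real n"
    proof -
      have "0 < n div k" using k \<open>k \<le> n\<close> by (simp add: div_greater_zero_iff)
      have "n < k * (n div k) + k" using k dividend_less_times_div[of k n] by simp
      then have "real n < real (k * (n div k) + k)" by (simp only: of_nat_less_iff)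
      then have d: "real n / real k < real (n div k) + 1" using k by (simp add: field_simps)
      show ?thesis
      proof (cases "n div k - 1 + (k - 2) \<le> n")
        case True
        then have "b + (n div k - 1 + (k - 2)) = n" unfolding b_def by simp
        \<comment> \<open>Together with \<open>d\<close> this gives
          \<open>b < n - n / k + (4 - k)\<close>, and the rounding error \<open>4 - k\<close> is not
          positive.\<close>
        then have "b + n div k + k = n + 3" using \<open>0 < n div k\<close> k by linarith
        then have "real b + real (n div k) + real k = real n + 3" by (metis of_nat_add of_nat_numeral)
        then have "real b \<le> real n - real n / real k" using d k by linarith
        then show ?thesis unfolding \<theta>_def by (simp add: algebra_simps)
      next
        case False
        then have "b = 0" unfolding b_def by simp
        then show ?thesis using \<theta> by simp
      qed
    qed
    have "2 * real (b choose 2) \<le> (real b)\<^sup>2"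
      unfolding two_choose_two by (simp add: power2_eq_square algebra_simps)
    also have "\<dots> \<le> (\<theta> * real n)\<^sup>2" using b_le by (intro power_mono) auto
    also have "\<dots> = \<theta>\<^sup>2 * (real n)\<^sup>2" by (rule power_mult_distrib)
    also have "\<dots> \<le> (\<theta>\<^sup>2 + \<gamma>) * (2 * real ((n - k + 2) choose 2))" using n1 n by simp
    finally have "real (b choose 2) \<le> (\<theta>\<^sup>2 + \<gamma>) * real ((n - k + 2) choose 2)" by simp
    then show ?thesis using lower by (simp add: algebra_simps)
  qed
  then show ?thesis unfolding \<theta>_def by blast
qed

theorem theorem1p8:
  fixes k l :: nat
  assumes "k \<ge> 4" and "l \<in> {2..k - 1}"
  shows "\<exists>\<epsilon> :: nat \<Rightarrow> real. \<epsilon> \<longlonglongrightarrow> 0 \<and>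
    (\<forall>n\<ge>k. [n = l] (mod k) \<longrightarrow>
       real (matching_threshold (k - 2) k n)
         = (1 - (1 - 1 / real k)\<^sup>2 + \<epsilon> n) * real ((n - k + 2) choose 2) \<and>
       (1 - (1 - 1 / real k)\<^sup>2 + \<epsilon> n) * real ((n - k + 2) choose 2)
         = ((2 * real k - 1) / (real k)\<^sup>2 + \<epsilon> n) * real ((n - k + 2) choose 2))"
proof -
  define c where "c = 1 - (1 - 1 / real k)\<^sup>2"
  have c_eq: "c = (2 * real k - 1) / (real k)\<^sup>2"
    unfolding c_def using assms(1) by (simp add: field_simps power2_eq_square)
  define B where "B n = real ((n - k + 2) choose 2)" for n
  define T where "T n = real (matching_threshold (k - 2) k n)" for n
  \<comment> \<open>The error term is solved for from the claimed equation. Off the residue class it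
    is set to 0, so that the whole sequence converges.\<close>
  define \<epsilon> where "\<epsilon> n = (if [n = l] (mod k) then T n / B n - c else 0)" for n
  \<comment> \<open>Truncated subtraction makes \<open>n - k + 2\<close> at least 2 for every
    \<open>n\<close>.\<close>
  have B: "0 < B n" for n unfolding B_def by simp
  have mod: "2 \<le> n mod k" if "[n = l] (mod k)" for n
  proof -
    have "l < k" "2 \<le> l" using assms by auto
    then show ?thesis using that unfolding cong_def by simp
  qed
  have "\<epsilon> \<longlonglongrightarrow> 0"
  proof (rule LIMSEQ_I)
    fix r :: real assume r: "0 < r"
    define \<gamma> where "\<gamma> = r / 3"
    have \<gamma>: "0 < \<gamma>" unfolding \<gamma>_def using r by simp
    obtain n1 where n1: "\<forall>n\<ge>n1. 2 \<le> n mod k \<longrightarrow> T n \<le> (c + \<gamma>) * B n + 1"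
      using threshold_upper[OF assms(1) \<gamma>] unfolding T_def B_def c_eq by blast
    obtain n2 where n2: "\<forall>n\<ge>n2. (c - \<gamma>) * B n \<le> T n"
      using threshold_lower[OF assms(1) \<gamma>] unfolding T_def B_def c_def by blast
    \<comment> \<open>From \<open>n^2 \<le> 4 * B n\<close> it follows that the additive 1 in the
      upper bound is at most \<open>\<gamma> * B n\<close> once
      \<open>n \<ge> 4 / \<gamma>\<close>.\<close>
    obtain n3 where n3: "\<forall>n\<ge>n3. 1 * (real n)\<^sup>2 \<le> (1 + 1) * (2 * B n)"
      using square_le_choose_two[of 1 1 k] unfolding B_def by auto
    obtain n4 :: nat where n4: "4 / \<gamma> \<le> real n4" using real_arch_simple by blast
    have "norm (\<epsilon> n - 0) < r" if n: "n \<ge> max (max n1 n2) (max n3 (max n4 1))" for n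
    proof (cases "[n = l] (mod k)")
      case True
      have "4 / \<gamma> \<le> real n" "1 \<le> real n" using n n4 by auto
      then have "4 / \<gamma> \<le> real n * real n" using mult_mono[of "4 / \<gamma>" "real n" 1 "real n"] \<gamma> by simp
      also have "\<dots> \<le> 4 * B n" using n3 n by (simp add: power2_eq_square)
      finally have "1 \<le> \<gamma> * B n" using \<gamma> by (simp add: field_simps)
      moreover have "T n \<le> (c + \<gamma>) * B n + 1" using n1 n mod[OF True] by simp
      ultimately have "T n \<le> (c + 2 * \<gamma>) * B n" by (simp add: algebra_simps)
      then have "T n / B n \<le> c + 2 * \<gamma>" using B[of n] by (simp add: divide_le_eq)
      moreover have "(c - \<gamma>) * B n \<le> T n" using n2 n by simp
      then have "c - \<gamma> \<le> T n / B n" using B[of n] by (simp add: le_divide_eq)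
      ultimately have "\<bar>T n / B n - c\<bar> \<le> 2 * \<gamma>" using \<gamma> by linarith
      then show ?thesis using True r unfolding \<epsilon>_def \<gamma>_def by simp
    next
      case False
      then show ?thesis using r unfolding \<epsilon>_def by simp
    qed
    then show "\<exists>no. \<forall>n\<ge>no. norm (\<epsilon> n - 0) < r" by blast
  qed
  moreover have "T n = (c + \<epsilon> n) * B n" if "[n = l] (mod k)" for n
    using that B[of n] unfolding \<epsilon>_def by simp
  ultimately show ?thesis
    unfolding c_def[symmetric] c_eq[symmetric] B_def[symmetric] T_def[symmetric] by blast
qed

end
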